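(* Let $m$ and $n$ be positive integers. The complex quasi-projective varieties $S^m\mathbb{C}^n$ and $\mathbb{C}^{mn}$ are piecewise isomorphic.
   Context: All varieties are complex quasi-projective varieties (not necessarily irreducible). For a variety $X$ and an integer $m\ge 1$, $S^mX := X^m/S_m$ denotes the $m$-th symmetric power of $X$, the quotient of the Cartesian power $X^m$ by the symmetric group $S_m$ permuting the factors; $\mathbb{C}^k$ denotes the $k$-dimensional complex affine space. Quasi-projective varieties $X$ and $Y$ are called piecewise isomorphic if there exist decompositions $X=\coprod_{i=1}^{s}X_i$ and $Y=\coprod_{i=1}^{s}Y_i$ (with $s$ finite) of $X$ and $Y$ into pairwise disjoint Zariski locally closed subsets such that $X_i$ and $Y_i$ are isomorphic (as varieties) for $i=1,\ldots,s$. *)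

theory Defs
  imports "HOL-Analysis.Analysis" "HOL-Combinatorics.Permutations"
begin

section \<open>Spaces with functions\<close>

text \<open>
  Complex varieties (reduced, not necessarily irreducible) are treated as spaces with functions:
  a Zariski topology together with the complex-valued regular functions on every open set.
  \<open>regular_on X U f\<close> is meaningful only for open \<open>U\<close>, and depends only on the values of \<open>f\<close> on \<open>U\<close>
  for all the spaces constructed below.
\<close>

record 'a fun_space =
  zariski :: "'a topology"
  regular_on :: "'a set \<Rightarrow> ('a \<Rightarrow> complex) \<Rightarrow> bool"

definition morphism :: "'a fun_space \<Rightarrow> 'b fun_space \<Rightarrow> ('a \<Rightarrow> 'b) \<Rightarrow> bool" where
  "morphism X Y \<phi> \<longleftrightarrow>
     continuous_map (zariski X) (zariski Y) \<phi> \<and>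
     (\<forall>V f. openin (zariski Y) V \<longrightarrow> regular_on Y V f \<longrightarrow>
        regular_on X {x \<in> topspace (zariski X). \<phi> x \<in> V} (f \<circ> \<phi>))"

definition isomorphic :: "'a fun_space \<Rightarrow> 'b fun_space \<Rightarrow> bool" where
  "isomorphic X Y \<longleftrightarrow>
     (\<exists>\<phi> \<psi>. morphism X Y \<phi> \<and> morphism Y X \<psi> \<and>
        (\<forall>x \<in> topspace (zariski X). \<psi> (\<phi> x) = x) \<and>
        (\<forall>y \<in> topspace (zariski Y). \<phi> (\<psi> y) = y))"

text \<open>The induced reduced structure on a subset: regular functions are those that extend
  locally to regular functions of the ambient space.\<close>

definition subspace_of :: "'a fun_space \<Rightarrow> 'a set \<Rightarrow> 'a fun_space" where
  "subspace_of X Z =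
     \<lparr> zariski = subtopology (zariski X) Z,
       regular_on = (\<lambda>V f. \<forall>x \<in> V. \<exists>U g. openin (zariski X) U \<and> x \<in> U \<and> regular_on X U g \<and>
                       (\<forall>y \<in> U \<inter> V. f y = g y)) \<rparr>"

definition locally_closed_in :: "'a topology \<Rightarrow> 'a set \<Rightarrow> bool" where
  "locally_closed_in T Z \<longleftrightarrow> (\<exists>U C. openin T U \<and> closedin T C \<and> Z = U \<inter> C)"

definition locally_closed_decomposition :: "'a fun_space \<Rightarrow> nat \<Rightarrow> (nat \<Rightarrow> 'a set) \<Rightarrow> bool" where
  "locally_closed_decomposition X s A \<longleftrightarrow>
     (\<forall>i \<in> {1..s}. locally_closed_in (zariski X) (A i)) \<and>
     disjoint_family_on A {1..s} \<and>
     (\<Union>i \<in> {1..s}. A i) = topspace (zariski X)"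

definition piecewise_isomorphic :: "'a fun_space \<Rightarrow> 'b fun_space \<Rightarrow> bool" where
  "piecewise_isomorphic X Y \<longleftrightarrow>
     (\<exists>s A B. locally_closed_decomposition X s A \<and> locally_closed_decomposition Y s B \<and>
        (\<forall>i \<in> {1..s}. isomorphic (subspace_of X (A i)) (subspace_of Y (B i))))"

section \<open>Affine varieties given by coordinate functions\<close>

text \<open>
  A set of points with complex-valued coordinate functions on it. The intended instances are those
  where the coordinates are finitely many and embed the points as a Zariski closed
  (or locally closed) subset of some \<open>\<complex>\<^sup>k\<close>; the structure below is then the
  usual one on this subset.
\<close>

record 'a coordinatized =
  points :: "'a set"
  coords :: "('a \<Rightarrow> complex) set"

inductive_set polynomial_functions :: "('a \<Rightarrow> complex) set \<Rightarrow> ('a \<Rightarrow> complex) set"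
  for C :: "('a \<Rightarrow> complex) set" where
  const: "(\<lambda>_. a) \<in> polynomial_functions C"
| coord: "c \<in> C \<Longrightarrow> c \<in> polynomial_functions C"
| add: "p \<in> polynomial_functions C \<Longrightarrow> q \<in> polynomial_functions C \<Longrightarrow>
    (\<lambda>x. p x + q x) \<in> polynomial_functions C"
| mult: "p \<in> polynomial_functions C \<Longrightarrow> q \<in> polynomial_functions C \<Longrightarrow>
    (\<lambda>x. p x * q x) \<in> polynomial_functions C"

definition zero_locus :: "'a coordinatized \<Rightarrow> ('a \<Rightarrow> complex) set \<Rightarrow> 'a set" where
  "zero_locus V F = {x \<in> points V. \<forall>f \<in> F. f x = 0}"

definition zariski_topology :: "'a coordinatized \<Rightarrow> 'a topology" where
  "zariski_topology V =
     topology (\<lambda>U. \<exists>F \<subseteq> polynomial_functions (coords V). U = points V - zero_locus V F)"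

definition variety :: "'a coordinatized \<Rightarrow> 'a fun_space" where
  "variety V =
     \<lparr> zariski = zariski_topology V,
       regular_on = (\<lambda>U f. \<forall>x \<in> U. \<exists>W. openin (zariski_topology V) W \<and> x \<in> W \<and> W \<subseteq> U \<and>
         (\<exists>g \<in> polynomial_functions (coords V). \<exists>h \<in> polynomial_functions (coords V).
            \<forall>y \<in> W. h y \<noteq> 0 \<and> f y = g y / h y)) \<rparr>"

definition affine_space :: "nat \<Rightarrow> (nat \<Rightarrow> complex) coordinatized" where
  "affine_space k =
     \<lparr> points = ({..<k} \<rightarrow>\<^sub>E UNIV), coords = {\<lambda>x. x j | j. j < k} \<rparr>"

definition cartesian_power :: "nat \<Rightarrow> 'a coordinatized \<Rightarrow> (nat \<Rightarrow> 'a) coordinatized" where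
  "cartesian_power m V =
     \<lparr> points = ({..<m} \<rightarrow>\<^sub>E points V),
       coords = {\<lambda>x. c (x i) | i c. i < m \<and> c \<in> coords V} \<rparr>"

section \<open>Quotients and symmetric powers\<close>

text \<open>
  The quotient has the equivalence classes as points, the quotient topology, and as regular functions
  those whose pullback is regular. For the orbit relation of a finite group
  acting on a quasi-projective variety this is the usual (geometric) quotient variety: regular functions
  on the quotient are the invariant regular functions upstairs. The preimage of a
  set \<open>U\<close> of classes under the projection is \<open>\<Union>U\<close>.
\<close>

definition quotient_topology :: "'a topology \<Rightarrow> ('a \<times> 'a) set \<Rightarrow> 'a set topology" where
  "quotient_topology T r = topology (\<lambda>U. U \<subseteq> topspace T // r \<and> openin T (\<Union>U))"

definition quotient_space :: "'a fun_space \<Rightarrow> ('a \<times> 'a) set \<Rightarrow> 'a set fun_space" where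
  "quotient_space X r =
     \<lparr> zariski = quotient_topology (zariski X) r,
       regular_on = (\<lambda>U f. regular_on X (\<Union>U) (\<lambda>x. f (r `` {x}))) \<rparr>"

definition permutation_orbits :: "nat \<Rightarrow> 'a set \<Rightarrow> ((nat \<Rightarrow> 'a) \<times> (nat \<Rightarrow> 'a)) set" where
  "permutation_orbits m P =
     {(x, y). x \<in> ({..<m} \<rightarrow>\<^sub>E P) \<and> y \<in> ({..<m} \<rightarrow>\<^sub>E P) \<and>
              (\<exists>\<sigma>. \<sigma> permutes {..<m} \<and> y = x \<circ> \<sigma>)}"

definition symmetric_power :: "nat \<Rightarrow> 'a coordinatized \<Rightarrow> (nat \<Rightarrow> 'a) set fun_space" where
  "symmetric_power m V =
     quotient_space (variety (cartesian_power m V)) (permutation_orbits m (points V))"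

section \<open>Basic facts\<close>

lemma istopology_zariski:
  "istopology (\<lambda>U. \<exists>F \<subseteq> polynomial_functions (coords V). U = points V - zero_locus V F)"
  (is "istopology ?P")
  unfolding istopology_def
proof (intro conjI allI impI)
  fix S T assume "?P S" "?P T"
  then obtain F G where F: "F \<subseteq> polynomial_functions (coords V)" "S = points V - zero_locus V F"
    and G: "G \<subseteq> polynomial_functions (coords V)" "T = points V - zero_locus V G" by auto
  let ?H = "{\<lambda>x. f x * g x | f g. f \<in> F \<and> g \<in> G}"
  have "?H \<subseteq> polynomial_functions (coords V)"
    using F(1) G(1) by (auto intro: polynomial_functions.mult)
  moreover have "x \<in> S \<inter> T \<longleftrightarrow> x \<in> points V - zero_locus V ?H" for x
  proof
    assume "x \<in> S \<inter> T"
    then obtain f g where "f \<in> F" "f x \<noteq> 0" "g \<in> G" "g x \<noteq> 0" "x \<in> points V"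
      unfolding F(2) G(2) zero_locus_def by auto
    then have "(\<lambda>x. f x * g x) \<in> ?H" "f x * g x \<noteq> 0" by auto
    then show "x \<in> points V - zero_locus V ?H"
      using \<open>x \<in> points V\<close> unfolding zero_locus_def by fastforce
  next
    assume "x \<in> points V - zero_locus V ?H"
    then show "x \<in> S \<inter> T" unfolding F(2) G(2) zero_locus_def by auto
  qed
  ultimately show "?P (S \<inter> T)" by blast
next
  fix \<K> assume "\<forall>K\<in>\<K>. ?P K"
  then obtain F where F: "\<And>K. K \<in> \<K> \<Longrightarrow> F K \<subseteq> polynomial_functions (coords V)"
    "\<And>K. K \<in> \<K> \<Longrightarrow> K = points V - zero_locus V (F K)" by metis
  have "x \<in> \<Union>\<K> \<longleftrightarrow> x \<in> points V - zero_locus V (\<Union>K\<in>\<K>. F K)" for x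
  proof -
    have "x \<in> K \<longleftrightarrow> x \<in> points V \<and> (\<exists>f \<in> F K. f x \<noteq> 0)" if "K \<in> \<K>" for K
    proof -
      have "x \<in> K \<longleftrightarrow> x \<in> points V - zero_locus V (F K)"
        using F(2)[OF that] by (rule arg_cong)
      then show ?thesis unfolding zero_locus_def by blast
    qed
    then show ?thesis unfolding zero_locus_def by auto
  qed
  then have "\<Union>\<K> = points V - zero_locus V (\<Union>K\<in>\<K>. F K)" by blast
  with F(1) show "?P (\<Union>\<K>)" by (meson UN_least)
qed

lemma openin_zariski_topology:
  "openin (zariski_topology V) U \<longleftrightarrow>
     (\<exists>F \<subseteq> polynomial_functions (coords V). U = points V - zero_locus V F)"
  unfolding zariski_topology_def by (subst topology_inverse'[OF istopology_zariski]) (rule refl)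

lemma topspace_zariski_topology [simp]: "topspace (zariski_topology V) = points V"
proof -
  have "openin (zariski_topology V) (points V)"
    unfolding openin_zariski_topology zero_locus_def
    by (intro exI[of _ "{\<lambda>_. 1}"]) (auto intro: polynomial_functions.const)
  moreover have "U \<subseteq> points V" if "openin (zariski_topology V) U" for U
    using that unfolding openin_zariski_topology by auto
  ultimately show ?thesis by (meson openin_subset openin_topspace subset_antisym)
qed

lemma equiv_permutation_orbits: "equiv ({..<m} \<rightarrow>\<^sub>E P) (permutation_orbits m P)"
proof (rule equivI)
  show "permutation_orbits m P \<subseteq> ({..<m} \<rightarrow>\<^sub>E P) \<times> ({..<m} \<rightarrow>\<^sub>E P)"
    by (auto simp: permutation_orbits_def)
  show "refl_on ({..<m} \<rightarrow>\<^sub>E P) (permutation_orbits m P)"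
  proof (rule refl_onI)
    fix x assume x: "x \<in> ({..<m} \<rightarrow>\<^sub>E P)"
    have "id permutes {..<m}" "x = x \<circ> id" by (simp_all add: permutes_id)
    with x show "(x, x) \<in> permutation_orbits m P" unfolding permutation_orbits_def by blast
  qed
  show "sym (permutation_orbits m P)"
  proof (rule symI)
    fix x y assume "(x, y) \<in> permutation_orbits m P"
    then obtain s where s: "s permutes {..<m}" "y = x \<circ> s"
      and xy: "x \<in> ({..<m} \<rightarrow>\<^sub>E P)" "y \<in> ({..<m} \<rightarrow>\<^sub>E P)"
      unfolding permutation_orbits_def by blast
    have "x = y \<circ> inv s" using s by (simp add: comp_assoc permutes_inv_o)
    with s(1) xy show "(y, x) \<in> permutation_orbits m P"
      unfolding permutation_orbits_def using permutes_inv by blast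
  qed
  show "trans (permutation_orbits m P)"
  proof (rule transI)
    fix x y z assume "(x, y) \<in> permutation_orbits m P" "(y, z) \<in> permutation_orbits m P"
    then obtain s t where s: "s permutes {..<m}" "y = x \<circ> s" "t permutes {..<m}" "z = y \<circ> t"
      and xz: "x \<in> ({..<m} \<rightarrow>\<^sub>E P)" "z \<in> ({..<m} \<rightarrow>\<^sub>E P)"
      unfolding permutation_orbits_def by blast
    have "z = x \<circ> (s \<circ> t)" using s by (simp add: comp_assoc)
    with s xz show "(x, z) \<in> permutation_orbits m P"
      unfolding permutation_orbits_def using permutes_compose by blast
  qed
qed

lemma istopology_quotient:
  assumes "equiv (topspace T) r"
  shows "istopology (\<lambda>U. U \<subseteq> topspace T // r \<and> openin T (\<Union>U))"
  unfolding istopology_def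
proof (intro conjI allI impI)
  fix A B assume A: "A \<subseteq> topspace T // r \<and> openin T (\<Union>A)"
    and B: "B \<subseteq> topspace T // r \<and> openin T (\<Union>B)"
  have "a = b" if "a \<in> A" "b \<in> B" "x \<in> a" "x \<in> b" for a b x
    using quotient_disj[OF assms, of a b] A B that by blast
  then have "\<Union>(A \<inter> B) = \<Union>A \<inter> \<Union>B" by blast
  then show "openin T (\<Union>(A \<inter> B))" using A B by auto
  show "A \<inter> B \<subseteq> topspace T // r" using A by auto
next
  fix \<K> assume K: "\<forall>K\<in>\<K>. K \<subseteq> topspace T // r \<and> openin T (\<Union>K)"
  then show "\<Union>\<K> \<subseteq> topspace T // r" by auto
  have "\<Union>(\<Union>\<K>) = (\<Union>K\<in>\<K>. \<Union>K)" by auto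
  then show "openin T (\<Union>(\<Union>\<K>))" using K by auto
qed

lemma openin_quotient_topology:
  assumes "equiv (topspace T) r"
  shows "openin (quotient_topology T r) U \<longleftrightarrow> U \<subseteq> topspace T // r \<and> openin T (\<Union>U)"
  unfolding quotient_topology_def
  by (subst topology_inverse'[OF istopology_quotient[OF assms]]) (rule refl)

lemma topspace_quotient_topology:
  assumes "equiv (topspace T) r"
  shows "topspace (quotient_topology T r) = topspace T // r"
proof -
  have "openin (quotient_topology T r) (topspace T // r)"
    by (simp add: openin_quotient_topology[OF assms] Union_quotient[OF assms])
  then show ?thesis
    by (metis assms openin_quotient_topology openin_subset openin_topspace subset_antisym)
qed

lemma topspace_affine_space [simp]:
  "topspace (zariski (variety (affine_space k))) = ({..<k} \<rightarrow>\<^sub>E UNIV)"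
  by (simp add: variety_def affine_space_def)

lemma topspace_symmetric_power:
  "topspace (zariski (symmetric_power m V)) = ({..<m} \<rightarrow>\<^sub>E points V) // permutation_orbits m (points V)"
  using equiv_permutation_orbits[of m "points V"]
  by (simp add: symmetric_power_def quotient_space_def variety_def topspace_quotient_topology
      cartesian_power_def)

end

theory Submission
  imports Defs "Jordan_Normal_Form.Determinant"
    "HOL-Computational_Algebra.Fundamental_Theorem_Algebra"
begin

text \<open>
  The bijection between \<open>S\<^sup>m \<complex>\<^sup>n\<close> and \<open>\<complex>\<^sup>m\<^sup>n\<close> is built one coordinate direction at a time.
  Suppose that the first \<open>l\<close> coordinates of the \<open>m\<close> points are known up to a permutation, that is,
  as a multiset of prefixes. The next coordinates then amount to a multiset of \<open>k\<close> complex numbers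
  over every prefix of multiplicity \<open>k\<close>, hence to a monic polynomial of degree \<open>k\<close>, hence to \<open>k\<close>
  complex numbers; these are \<open>m\<close> numbers altogether. To write them as one vector of \<open>\<complex>\<^sup>m\<close> in a way
  that does not depend on the multiplicities, separate the prefixes by the values of a linear form
  and take the polynomial of degree less than \<open>m\<close> whose Taylor coefficients of order less than \<open>k\<close>
  at the value of a prefix of multiplicity \<open>k\<close> are the \<open>k\<close> numbers that belong to this prefix.
  By Hermite interpolation there is exactly one such polynomial, and its \<open>m\<close> coefficients are the
  new coordinates. Doing this for \<open>l < n\<close> gives \<open>m n\<close> coordinates (\<open>coordinate\<close>), and every vector of
  \<open>\<complex>\<^sup>m\<^sup>n\<close> comes from exactly one multiset of \<open>m\<close> points
  (\<open>coordinates_surjective\<close>, \<open>coordinates_injective\<close>).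

  Multiplicities and the separating linear form jump, so this bijection need not be continuous. It
  is however computed by additions, multiplications and inversions, where \<open>0\<close> has the inverse \<open>0\<close>;
  functions obtained in this way are called piecewise rational below. Recording which of
  the finitely many denominators vanish cuts a variety into finitely many locally closed strata, on
  each of which a piecewise rational function is a quotient of polynomials. Hence a bijection that is
  piecewise rational in both directions is a piecewise isomorphism
  (\<open>piecewise_isomorphic_if_piecewise_rational\<close>).

  The formulas just described use an ordering of the points, whereas functions on \<open>S\<^sup>m \<complex>\<^sup>n\<close> must
  be expressed by symmetric polynomials. The passage is \<open>piecewise_rational_descent\<close>: an invariant
  piecewise rational function is a piecewise rational function of invariants. It is used in both
  directions. Since the coordinates do not depend on the ordering, they are piecewise rational in the
  symmetric polynomials (\<open>coordinate_rational_in_symmetric_polynomials\<close>). Conversely, the power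
  sums \<open>\<Sum>i<m. F (x i)\<close> are piecewise rational in the coordinates
  (\<open>power_sum_in_coordinate_field\<close>, by induction on the number of coordinates that \<open>F\<close> involves, with
  Newton's identities in the step), and they generate all symmetric functions.

  Finally, \<open>S\<^sup>m \<complex>\<^sup>n\<close>, defined as a quotient, is the variety whose points are the orbits and whose
  coordinate functions are finitely many generators of the ring of symmetric polynomials
  (\<open>piecewise_isomorphic_orbit_variety\<close>); here averaging over the group turns
  a local expression of a regular function into one by symmetric polynomials.
\<close>

section \<open>Piecewise rational functions\<close>

text \<open>
  Inversion is the total function with \<open>inverse 0 = 0\<close>. This is what makes case distinctions
  available: \<open>1 - f * inverse f\<close> is the indicator function of the zero set of \<open>f\<close>.
\<close>

inductive_set piecewise_rational :: "('a \<Rightarrow> complex) set \<Rightarrow> ('a \<Rightarrow> complex) set"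
  for C :: "('a \<Rightarrow> complex) set" where
  const: "(\<lambda>_. a) \<in> piecewise_rational C"
| coord: "c \<in> C \<Longrightarrow> c \<in> piecewise_rational C"
| add: "p \<in> piecewise_rational C \<Longrightarrow> q \<in> piecewise_rational C \<Longrightarrow>
    (\<lambda>x. p x + q x) \<in> piecewise_rational C"
| mult: "p \<in> piecewise_rational C \<Longrightarrow> q \<in> piecewise_rational C \<Longrightarrow>
    (\<lambda>x. p x * q x) \<in> piecewise_rational C"
| inverse: "p \<in> piecewise_rational C \<Longrightarrow> (\<lambda>x. inverse (p x)) \<in> piecewise_rational C"

lemma piecewise_rational_subst:
  assumes "f \<in> piecewise_rational C"
    and "\<And>c. c \<in> C \<Longrightarrow> (\<lambda>x. c (\<phi> x)) \<in> piecewise_rational D"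
  shows "(\<lambda>x. f (\<phi> x)) \<in> piecewise_rational D"
  using assms(1)
  by induction (auto intro: piecewise_rational.intros assms(2))

lemma piecewise_rational_trans:
  assumes "f \<in> piecewise_rational C" "C \<subseteq> piecewise_rational D"
  shows "f \<in> piecewise_rational D"
  using piecewise_rational_subst[of f C "\<lambda>x. x" D] assms by auto

lemma piecewise_rational_mono: "C \<subseteq> D \<Longrightarrow> f \<in> piecewise_rational C \<Longrightarrow> f \<in> piecewise_rational D"
  by (rule piecewise_rational_trans[of f C]) (auto intro: piecewise_rational.coord)

lemma polynomial_functions_subst:
  assumes "f \<in> polynomial_functions C"
    and "\<And>c. c \<in> C \<Longrightarrow> (\<lambda>x. c (\<phi> x)) \<in> polynomial_functions D"
  shows "(\<lambda>x. f (\<phi> x)) \<in> polynomial_functions D"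
  using assms(1)
  by induction (auto intro: polynomial_functions.intros assms(2))

lemma polynomial_functions_mono:
  "C \<subseteq> D \<Longrightarrow> f \<in> polynomial_functions C \<Longrightarrow> f \<in> polynomial_functions D"
  using polynomial_functions_subst[of f C "\<lambda>x. x" D] by (auto intro: polynomial_functions.coord)

lemma polynomial_imp_piecewise_rational:
  assumes "f \<in> polynomial_functions C" shows "f \<in> piecewise_rational C"
  using assms by induction (auto intro: piecewise_rational.intros)

lemma polynomial_functions_sum:
  assumes "\<And>i. i \<in> I \<Longrightarrow> f i \<in> polynomial_functions C"
  shows "(\<lambda>x. \<Sum>i\<in>I. f i x) \<in> polynomial_functions C"
  using assms
  by (induction I rule: infinite_finite_induct) (auto intro: polynomial_functions.intros)

lemma polynomial_functions_prod:
  assumes "\<And>i. i \<in> I \<Longrightarrow> f i \<in> polynomial_functions C"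
  shows "(\<lambda>x. \<Prod>i\<in>I. f i x) \<in> polynomial_functions C"
  using assms
  by (induction I rule: infinite_finite_induct) (auto intro: polynomial_functions.intros)

lemma piecewise_rational_sum:
  assumes "\<And>i. i \<in> I \<Longrightarrow> f i \<in> piecewise_rational C"
  shows "(\<lambda>x. \<Sum>i\<in>I. f i x) \<in> piecewise_rational C"
  using assms
  by (induction I rule: infinite_finite_induct) (auto intro: piecewise_rational.intros)

lemma piecewise_rational_prod:
  assumes "\<And>i. i \<in> I \<Longrightarrow> f i \<in> piecewise_rational C"
  shows "(\<lambda>x. \<Prod>i\<in>I. f i x) \<in> piecewise_rational C"
  using assms
  by (induction I rule: infinite_finite_induct) (auto intro: piecewise_rational.intros)

lemma piecewise_rational_uminus:
  "f \<in> piecewise_rational C \<Longrightarrow> (\<lambda>x. - f x) \<in> piecewise_rational C"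
  using piecewise_rational.mult[OF piecewise_rational.const[of "-1"], of f] by simp

lemma piecewise_rational_diff:
  "f \<in> piecewise_rational C \<Longrightarrow> g \<in> piecewise_rational C \<Longrightarrow> (\<lambda>x. f x - g x) \<in> piecewise_rational C"
  using piecewise_rational.add[OF _ piecewise_rational_uminus, of f C g] by simp

lemma piecewise_rational_divide:
  "f \<in> piecewise_rational C \<Longrightarrow> g \<in> piecewise_rational C \<Longrightarrow> (\<lambda>x. f x / g x) \<in> piecewise_rational C"
  unfolding divide_inverse by (intro piecewise_rational.mult piecewise_rational.inverse)

text \<open>
  A condition is constructible if its indicator function is piecewise rational, so that
  piecewise rational functions may be defined by cases on it.
\<close>

definition constructible :: "('a \<Rightarrow> complex) set \<Rightarrow> ('a \<Rightarrow> bool) \<Rightarrow> bool" where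
  "constructible C P \<longleftrightarrow> (\<lambda>x. if P x then 1 else 0) \<in> piecewise_rational C"

lemma constructible_eq:
  assumes "f \<in> piecewise_rational C" "g \<in> piecewise_rational C"
  shows "constructible C (\<lambda>x. f x = g x)"
proof -
  have "(\<lambda>x. 1 - (f x - g x) * inverse (f x - g x)) \<in> piecewise_rational C"
    by (intro piecewise_rational_diff piecewise_rational.mult piecewise_rational.inverse
        piecewise_rational.const assms)
  moreover have "(\<lambda>x. 1 - (f x - g x) * inverse (f x - g x)) = (\<lambda>x. if f x = g x then 1 else 0)"
    by (auto simp: fun_eq_iff)
  ultimately show ?thesis by (simp add: constructible_def)
qed

lemma constructible_not: "constructible C P \<Longrightarrow> constructible C (\<lambda>x. \<not> P x)"
  using piecewise_rational_diff[OF piecewise_rational.const[of 1], of "\<lambda>x. if P x then 1 else 0" C]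
  unfolding constructible_def
  by (rule back_subst[where P = "\<lambda>f. f \<in> piecewise_rational C"]) auto

lemma constructible_conj:
  "constructible C P \<Longrightarrow> constructible C Q \<Longrightarrow> constructible C (\<lambda>x. P x \<and> Q x)"
  using piecewise_rational.mult[of "\<lambda>x. if P x then 1 else 0" C "\<lambda>x. if Q x then 1 else 0"]
  unfolding constructible_def
  by (rule back_subst[where P = "\<lambda>f. f \<in> piecewise_rational C"]) auto

lemma constructible_const: "constructible C (\<lambda>_. b)"
  unfolding constructible_def by (rule piecewise_rational.const)

lemma constructible_imp:
  "constructible C P \<Longrightarrow> constructible C Q \<Longrightarrow> constructible C (\<lambda>x. P x \<longrightarrow> Q x)"
  using constructible_not[OF constructible_conj[OF _ constructible_not], of C P Q] by simp

lemma constructible_ball: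
  assumes "finite I" "\<And>i. i \<in> I \<Longrightarrow> constructible C (P i)"
  shows "constructible C (\<lambda>x. \<forall>i\<in>I. P i x)"
  using assms by (induction I) (auto intro: constructible_const constructible_conj)

lemma piecewise_rational_if:
  assumes "constructible C P" "f \<in> piecewise_rational C" "g \<in> piecewise_rational C"
  shows "(\<lambda>x. if P x then f x else g x) \<in> piecewise_rational C"
proof -
  have "(\<lambda>x. (if P x then 1 else 0) * f x + (if \<not> P x then 1 else 0) * g x) \<in> piecewise_rational C"
    using assms(1) constructible_not[OF assms(1)]
    by (intro piecewise_rational.add piecewise_rational.mult assms(2,3)) (simp_all add: constructible_def)
  then show ?thesis
    by (rule back_subst[where P = "\<lambda>f. f \<in> piecewise_rational C"]) auto
qed

text \<open>
  This is how integers that depend on the point, such as multiplicities, may occur as indices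
  in formulas, provided that they range over a finite set.
\<close>

lemma piecewise_rational_of_nat_case:
  assumes "finite I" "\<And>x. N x \<in> I"
    and "\<And>r. r \<in> I \<Longrightarrow> constructible C (\<lambda>x. N x = r)"
    and "\<And>r. r \<in> I \<Longrightarrow> f r \<in> piecewise_rational C"
  shows "(\<lambda>x. f (N x) x) \<in> piecewise_rational C"
proof -
  have "(\<lambda>x. \<Sum>r\<in>I. if N x = r then f r x else 0) \<in> piecewise_rational C"
    by (intro piecewise_rational_sum piecewise_rational_if assms piecewise_rational.const)
  moreover have "(\<lambda>x. \<Sum>r\<in>I. if N x = r then f r x else 0) = (\<lambda>x. f (N x) x)"
    using assms(1,2) by (simp add: fun_eq_iff)
  ultimately show ?thesis by simp
qed

section \<open>Descent to the invariants of a finite group\<close>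

text \<open>
  If \<open>R\<close> is a ring of functions and \<open>K\<close> is closed under products, this is the ring that they
  generate, written as the \<open>R\<close>-linear span of \<open>K\<close>. The normal form matters because averaging over a group
  is \<open>R\<close>-linear when the elements of \<open>R\<close> are invariant, but it is not multiplicative.
\<close>

inductive_set combinations :: "('a \<Rightarrow> complex) set \<Rightarrow> ('a \<Rightarrow> complex) set \<Rightarrow> ('a \<Rightarrow> complex) set"
  for R K :: "('a \<Rightarrow> complex) set" where
  product: "a \<in> R \<Longrightarrow> g \<in> K \<Longrightarrow> (\<lambda>x. a x * g x) \<in> combinations R K"
| add: "p \<in> combinations R K \<Longrightarrow> q \<in> combinations R K \<Longrightarrow> (\<lambda>x. p x + q x) \<in> combinations R K"

lemma combinations_mult:
  assumes R: "\<And>a b. a \<in> R \<Longrightarrow> b \<in> R \<Longrightarrow> (\<lambda>x. a x * b x) \<in> R"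
    and K: "\<And>a b. a \<in> K \<Longrightarrow> b \<in> K \<Longrightarrow> (\<lambda>x. a x * b x) \<in> K"
    and p: "p \<in> combinations R K" and q: "q \<in> combinations R K"
  shows "(\<lambda>x. p x * q x) \<in> combinations R K"
  using p
proof induction
  case (product a g)
  from q show ?case
  proof induction
    case (product b h)
    have "(\<lambda>x. (a x * b x) * (g x * h x)) \<in> combinations R K"
      by (intro combinations.product R K product \<open>a \<in> R\<close> \<open>g \<in> K\<close>)
    then show ?case by (simp add: mult_ac)
  next
    case (add p q)
    from combinations.add[OF add.IH] show ?case by (simp add: distrib_left)
  qed
next
  case (add p1 p2)
  from combinations.add[OF add.IH] show ?case by (simp add: distrib_right)
qed

text \<open>
  Surjectivity and closure under composition suffice for a group here: right multiplication by an
  element is injective on the finite set \<open>G\<close>, hence a bijection.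
\<close>

locale finite_transformation_group =
  fixes G :: "('a \<Rightarrow> 'a) set"
  assumes finite_G: "finite G"
    and id_G: "id \<in> G"
    and comp_G: "\<And>g h. g \<in> G \<Longrightarrow> h \<in> G \<Longrightarrow> g \<circ> h \<in> G"
    and surj_G: "\<And>g. g \<in> G \<Longrightarrow> surj g"
begin

lemma translation_bij: "g \<in> G \<Longrightarrow> bij_betw (\<lambda>h. h \<circ> g) G G"
proof -
  assume g: "g \<in> G"
  have "inj_on (\<lambda>h. h \<circ> g) G"
    by (rule inj_onI) (metis surj_G[OF g] comp_assoc comp_id surj_iff)
  moreover have "(\<lambda>h. h \<circ> g) ` G \<subseteq> G" using comp_G g by auto
  ultimately show ?thesis
    using finite_G by (simp add: bij_betw_def endo_inj_surj)
qed

definition invariant :: "('a \<Rightarrow> 'b) \<Rightarrow> bool" where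
  "invariant f \<longleftrightarrow> (\<forall>g\<in>G. \<forall>x. f (g x) = f x)"

definition reynolds :: "('a \<Rightarrow> complex) \<Rightarrow> 'a \<Rightarrow> complex" where
  "reynolds f x = (\<Sum>g\<in>G. f (g x))"

lemma invariant_reynolds: "invariant (reynolds f)"
  unfolding invariant_def
proof (intro ballI allI)
  fix g x assume g: "g \<in> G"
  show "reynolds f (g x) = reynolds f x"
    using sum.reindex_bij_betw[OF translation_bij[OF g], of "\<lambda>h. f (h x)"]
    by (simp add: reynolds_def)
qed

lemma card_G_pos: "card G > 0"
  using finite_G id_G by (auto simp: card_gt_0_iff)

lemma reynolds_invariant: "invariant f \<Longrightarrow> reynolds f x = of_nat (card G) * f x"
  by (simp add: reynolds_def invariant_def)

lemma reynolds_mult_invariant: "invariant a \<Longrightarrow> reynolds (\<lambda>x. a x * f x) x = a x * reynolds f x"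
  by (simp add: reynolds_def invariant_def sum_distrib_left)

lemma reynolds_add: "reynolds (\<lambda>x. f x + h x) x = reynolds f x + reynolds h x"
  by (simp add: reynolds_def sum.distrib)

definition orbit_poly :: "('a \<Rightarrow> complex) \<Rightarrow> 'a \<Rightarrow> complex poly" where
  "orbit_poly f x = (\<Prod>g\<in>G. [:- f (g x), 1:])"

lemma invariant_orbit_poly: "invariant (orbit_poly f)"
  unfolding invariant_def
proof (intro ballI allI)
  fix g x assume g: "g \<in> G"
  show "orbit_poly f (g x) = orbit_poly f x"
    using prod.reindex_bij_betw[OF translation_bij[OF g], of "\<lambda>h. [:- f (h x), 1:]"]
    by (simp add: orbit_poly_def)
qed

lemma poly_orbit_poly: "poly (orbit_poly f x) (f x) = 0"
  unfolding orbit_poly_def poly_prod using id_G finite_G by (intro prod_zero bexI[of _ id]) auto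

lemma degree_orbit_poly: "degree (orbit_poly f x) = card G"
  unfolding orbit_poly_def by (subst degree_prod_eq_sum_degree) auto

lemma lead_coeff_orbit_poly: "coeff (orbit_poly f x) (card G) = 1"
  using degree_orbit_poly[of f x] lead_coeff_prod[of "\<lambda>g. [:- f (g x), 1:]" G]
  by (simp add: orbit_poly_def)

text \<open>
  The coefficients are, up to sign, the elementary symmetric functions of the values of \<open>f\<close> on an
  orbit, so they stay in every ring of functions that contains \<open>f\<close> and is stable under the group.
\<close>

lemma coeff_orbit_poly_in:
  assumes const: "\<And>a. (\<lambda>_. a) \<in> B"
    and add: "\<And>p q. p \<in> B \<Longrightarrow> q \<in> B \<Longrightarrow> (\<lambda>x. p x + q x) \<in> B"
    and mult: "\<And>p q. p \<in> B \<Longrightarrow> q \<in> B \<Longrightarrow> (\<lambda>x. p x * q x) \<in> B"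
    and action: "\<And>p g. p \<in> B \<Longrightarrow> g \<in> G \<Longrightarrow> (\<lambda>x. p (g x)) \<in> B"
    and f: "f \<in> B"
  shows "(\<lambda>x. coeff (orbit_poly f x) k) \<in> B"
proof -
  have "H \<subseteq> G \<Longrightarrow> (\<lambda>x. coeff (\<Prod>g\<in>H. [:- f (g x), 1:]) k) \<in> B" for H k
  proof (induction H arbitrary: k rule: infinite_finite_induct)
    case (insert g H)
    have shift: "(\<lambda>x. coeff (pCons 0 (\<Prod>g\<in>H. [:- f (g x), 1:])) k) \<in> B"
      using insert by (cases k) (auto intro: const)
    have "(\<lambda>x. f (g x)) \<in> B" "(\<lambda>x. coeff (\<Prod>g\<in>H. [:- f (g x), 1:]) k) \<in> B"
      using insert f by (auto intro: action)
    from add[OF mult[OF const[of "-1"] mult[OF this]] shift] show ?case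
      using insert.hyps by (simp add: mult_pCons_left)
  qed (auto intro: const)
  then show ?thesis unfolding orbit_poly_def by blast
qed

end

lemma combinations_sum:
  assumes "finite I" "(\<lambda>_. 0) \<in> combinations R K"
    and "\<And>i. i \<in> I \<Longrightarrow> f i \<in> combinations R K"
  shows "(\<lambda>x. \<Sum>i\<in>I. f i x) \<in> combinations R K"
  using assms by (induction I rule: finite_induct) (auto intro: combinations.add)

text \<open>
  The inverse of a root is a polynomial in this root, with coefficients that are rational in the
  coefficients of \<open>p\<close>. If \<open>s\<close> is the order of vanishing of \<open>p\<close> at \<open>0\<close>, then a nonzero root \<open>v\<close> satisfies
  \<open>coeff p s + v * q v = 0\<close>, so \<open>- q v / coeff p s\<close> is its inverse \<open>w\<close>. The formula uses \<open>v * w\<^sup>2\<close> instead of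
  \<open>w\<close>, because this also has the required value at \<open>v = 0\<close>; squaring makes the sign irrelevant.
\<close>

lemma inverse_via_char_poly:
  fixes v :: complex
  assumes p: "poly p v = 0" "coeff p N = 1" "degree p \<le> N"
  shows "inverse v = (\<Sum>s\<le>N. if (\<forall>i<s. coeff p i = 0) \<and> coeff p s \<noteq> 0
    then v * ((\<Sum>i\<in>{s<..N}. coeff p i * v ^ (i - Suc s)) * inverse (coeff p s)) ^ 2 else 0)"
proof -
  define s where "s = (LEAST i. coeff p i \<noteq> 0)"
  have ex: "coeff p N \<noteq> 0" using p by simp
  have s: "coeff p s \<noteq> 0" "\<And>i. i < s \<Longrightarrow> coeff p i = 0"
    unfolding s_def using LeastI[of "\<lambda>i. coeff p i \<noteq> 0", OF ex] not_less_Least by blast+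
  have sN: "s \<le> N" unfolding s_def by (rule Least_le) fact
  have uniq: "(\<forall>i<s'. coeff p i = 0) \<and> coeff p s' \<noteq> 0 \<longleftrightarrow> s' = s" for s'
    using s by (metis linorder_neqE_nat)
  have "(\<Sum>s'\<le>N. if (\<forall>i<s'. coeff p i = 0) \<and> coeff p s' \<noteq> 0
    then v * ((\<Sum>i\<in>{s'<..N}. coeff p i * v ^ (i - Suc s')) * inverse (coeff p s')) ^ 2 else 0)
    = v * ((\<Sum>i\<in>{s<..N}. coeff p i * v ^ (i - Suc s)) * inverse (coeff p s)) ^ 2"
    unfolding uniq using sN by simp
  also have "\<dots> = inverse v"
  proof (cases "v = 0")
    case False
    have "0 = (\<Sum>i\<le>N. coeff p i * v ^ i)"
      using p(1,3) poly_as_sum_of_monoms'[of p N] by (metis (no_types, lifting) poly_monom poly_sum sum.cong)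
    also have "\<dots> = (\<Sum>i\<in>{s..N}. coeff p i * v ^ i)"
      by (rule sum.mono_neutral_right) (auto simp: s(2))
    also have "\<dots> = coeff p s * v ^ s + (\<Sum>i\<in>{s<..N}. coeff p i * v ^ i)"
      by (rule sum.head[OF sN])
    also have "(\<Sum>i\<in>{s<..N}. coeff p i * v ^ i)
        = v ^ Suc s * (\<Sum>i\<in>{s<..N}. coeff p i * v ^ (i - Suc s))"
      unfolding sum_distrib_left
    proof (rule sum.cong)
      fix i assume "i \<in> {s<..N}"
      then have "v ^ i = v ^ Suc s * v ^ (i - Suc s)"
        by (metis Suc_leI greaterThanAtMost_iff le_add_diff_inverse power_add)
      then show "coeff p i * v ^ i = v ^ Suc s * (coeff p i * v ^ (i - Suc s))" by simp
    qed simp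
    finally have "v ^ s * (coeff p s + v * (\<Sum>i\<in>{s<..N}. coeff p i * v ^ (i - Suc s))) = 0"
      by (simp add: algebra_simps)
    then have "v * (\<Sum>i\<in>{s<..N}. coeff p i * v ^ (i - Suc s)) = - coeff p s"
      using False by (simp add: add_eq_0_iff2)
    then have "(\<Sum>i\<in>{s<..N}. coeff p i * v ^ (i - Suc s)) = - coeff p s / v"
      using False by (metis nonzero_mult_div_cancel_left)
    then show ?thesis using False s(1) by (simp add: power2_eq_square inverse_eq_divide)
  qed simp
  finally show ?thesis by simp
qed

context finite_transformation_group
begin

text \<open>
  The ring \<open>B\<close> of combinations of \<open>K\<close> over \<open>R\<close> consists of functions that need not be invariant, but
  averaging an element of \<open>B\<close> gives an element of \<open>R\<close>. So the invariant elements of \<open>B\<close> lie in \<open>R\<close>, and it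
  suffices that \<open>B\<close> contains all piecewise rational functions. The only case that is not clear is the
  inverse of \<open>a \<in> B\<close>. Now \<open>a\<close> is a root of its orbit polynomial, whose coefficients are invariant
  elements of \<open>B\<close>, thus in \<open>R\<close>; and the inverse of a root is a polynomial in it over \<open>R\<close>.
\<close>

theorem piecewise_rational_descent:
  assumes R: "\<And>f. f \<in> piecewise_rational R \<Longrightarrow> f \<in> R"
    and inv_R: "\<And>f. f \<in> R \<Longrightarrow> invariant f"
    and one_K: "(\<lambda>_. 1) \<in> K"
    and mult_K: "\<And>a b. a \<in> K \<Longrightarrow> b \<in> K \<Longrightarrow> (\<lambda>x. a x * b x) \<in> K"
    and action_K: "\<And>a g. a \<in> K \<Longrightarrow> g \<in> G \<Longrightarrow> (\<lambda>x. a (g x)) \<in> K"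
    and reynolds_K: "\<And>a. a \<in> K \<Longrightarrow> reynolds a \<in> R"
    and C: "C \<subseteq> combinations R K"
    and f: "f \<in> piecewise_rational C" "invariant f"
  shows "f \<in> R"
proof -
  have R_const: "(\<lambda>_. a) \<in> R" for a by (rule R) (rule piecewise_rational.const)
  have R_mult: "(\<lambda>x. a x * b x) \<in> R" if "a \<in> R" "b \<in> R" for a b
    by (rule R) (intro piecewise_rational.mult piecewise_rational.coord that)
  have R_add: "(\<lambda>x. a x + b x) \<in> R" if "a \<in> R" "b \<in> R" for a b
    by (rule R) (intro piecewise_rational.add piecewise_rational.coord that)
  let ?B = "combinations R K"
  have from_R: "a \<in> ?B" if "a \<in> R" for a
    using combinations.product[OF that one_K] by simp
  have B_const: "(\<lambda>_. a) \<in> ?B" for a by (rule from_R) (rule R_const)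
  have B_mult: "(\<lambda>x. a x * b x) \<in> ?B" if "a \<in> ?B" "b \<in> ?B" for a b
    by (rule combinations_mult[OF _ _ that]) (fact R_mult, fact mult_K)
  have B_power: "(\<lambda>x. a x ^ k) \<in> ?B" if "a \<in> ?B" for a k
    by (induction k) (auto intro: B_const B_mult that)
  have B_action: "(\<lambda>x. a (g x)) \<in> ?B" if "a \<in> ?B" "g \<in> G" for a g
    using that(1)
  proof induction
    case (product a b)
    have "a (g x) = a x" for x using inv_R[OF product(1)] that(2) by (auto simp: invariant_def)
    then show ?case using combinations.product[OF product(1) action_K[OF product(2) that(2)]] by simp
  qed (auto intro: combinations.add)
  have B_reynolds: "reynolds a \<in> R" if "a \<in> ?B" for a
    using that
  proof induction
    case (product a b)
    have "reynolds (\<lambda>x. a x * b x) = (\<lambda>x. a x * reynolds b x)"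
      using reynolds_mult_invariant[OF inv_R[OF product(1)]] by auto
    then show ?case using R_mult[OF product(1) reynolds_K[OF product(2)]] by simp
  next
    case (add p q)
    then show ?case using R_add[OF add.IH] by (simp add: reynolds_add[abs_def])
  qed
  have B_invariant: "a \<in> R" if "a \<in> ?B" "invariant a" for a
  proof -
    have "(\<lambda>x. (1 / of_nat (card G)) * reynolds a x) = a"
      using reynolds_invariant[OF that(2)] card_G_pos by auto
    then show ?thesis using R_mult[OF R_const B_reynolds[OF that(1)], of "1 / of_nat (card G)"] by simp
  qed
  have B_inverse: "(\<lambda>x. inverse (a x)) \<in> ?B" if a: "a \<in> ?B" for a
  proof -
    let ?c = "\<lambda>i x. coeff (orbit_poly a x) i"
    have c: "?c i \<in> R" for i
    proof (rule B_invariant)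
      show "?c i \<in> ?B"
        by (rule coeff_orbit_poly_in)
          (fact B_const combinations.add B_mult B_action a)+
      show "invariant (?c i)" using invariant_orbit_poly[of a] by (simp add: invariant_def)
    qed
    let ?N = "card G"
    have ind0: "(\<lambda>x. if (\<forall>i\<in>{..<s}. ?c i x = 0) \<and> \<not> ?c s x = 0 then 1 else 0) \<in> R" for s
      by (rule R, fold constructible_def, intro constructible_conj constructible_ball
          constructible_not constructible_eq piecewise_rational.const piecewise_rational.coord c) simp
    have ind: "(\<lambda>x. if (\<forall>i<s. ?c i x = 0) \<and> ?c s x \<noteq> 0 then 1 else 0) \<in> ?B" for s
      using from_R[OF ind0[of s]] by (simp only: Ball_def lessThan_iff)
    have inv: "(\<lambda>x. inverse (?c s x)) \<in> ?B" for s
      by (rule from_R, rule R) (intro piecewise_rational.inverse piecewise_rational.coord c)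
    have "(\<lambda>x. \<Sum>i\<in>{s<..?N}. ?c i x * a x ^ (i - Suc s)) \<in> ?B" for s
      by (intro combinations_sum B_const B_mult B_power a from_R c) simp
    then have "(\<lambda>x. \<Sum>s\<le>?N. (if (\<forall>i<s. ?c i x = 0) \<and> ?c s x \<noteq> 0 then 1 else 0) *
        (a x * ((\<Sum>i\<in>{s<..?N}. ?c i x * a x ^ (i - Suc s)) * inverse (?c s x)) ^ 2)) \<in> ?B"
      by (intro combinations_sum[of "{..?N}"] B_mult[OF ind] B_mult[OF a] B_power B_mult[OF _ inv] B_const) auto
    moreover have "(\<lambda>x. inverse (a x)) = (\<lambda>x. \<Sum>s\<le>?N. (if (\<forall>i<s. ?c i x = 0) \<and> ?c s x \<noteq> 0 then 1 else 0) *
        (a x * ((\<Sum>i\<in>{s<..?N}. ?c i x * a x ^ (i - Suc s)) * inverse (?c s x)) ^ 2))"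
    proof
      fix x
      show "inverse (a x) = (\<Sum>s\<le>?N. (if (\<forall>i<s. ?c i x = 0) \<and> ?c s x \<noteq> 0 then 1 else 0) *
        (a x * ((\<Sum>i\<in>{s<..?N}. ?c i x * a x ^ (i - Suc s)) * inverse (?c s x)) ^ 2))"
        by (subst inverse_via_char_poly[OF poly_orbit_poly lead_coeff_orbit_poly
              eq_refl[OF degree_orbit_poly]]) (auto intro!: sum.cong)
    qed
    ultimately show ?thesis by simp
  qed
  have "f \<in> ?B" using f(1)
  proof induction
    case (coord c) then show ?case using C by auto
  qed (auto intro: B_const B_mult B_inverse combinations.add)
  then show ?thesis using f(2) by (rule B_invariant)
qed

definition invariant_polynomials :: "('a \<Rightarrow> complex) set \<Rightarrow> ('a \<Rightarrow> complex) set" where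
  "invariant_polynomials C = {p \<in> polynomial_functions C. invariant p}"

text \<open>
  Noether's argument. Every coordinate is a root of its orbit polynomial, which is monic of degree
  \<open>card G\<close>. Therefore each polynomial is a combination of the finitely many monomials with exponents
  below \<open>card G\<close>, over the algebra generated by the coefficients of the orbit polynomials; averaging
  shows that these coefficients and the averages of the monomials generate the invariants.
\<close>

theorem noether_finite_generation:
  assumes "finite C" and stable: "\<And>c g. c \<in> C \<Longrightarrow> g \<in> G \<Longrightarrow> (\<lambda>x. c (g x)) \<in> C"
  obtains F where "finite F" "F \<subseteq> invariant_polynomials C"
    "invariant_polynomials C \<subseteq> polynomial_functions F"
proof -
  let ?N = "card G" and ?P = "polynomial_functions C"
  define E where "E = (\<lambda>(c, s). \<lambda>x. coeff (orbit_poly c x) s) ` (C \<times> {..<?N})"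
  define monomial :: "(('a \<Rightarrow> complex) \<Rightarrow> nat) \<Rightarrow> 'a \<Rightarrow> complex"
    where "monomial \<alpha> = (\<lambda>x. \<Prod>c\<in>C. c x ^ \<alpha> c)" for \<alpha>
  define M where "M = monomial ` (C \<rightarrow>\<^sub>E {..<?N})"
  define F where "F = E \<union> reynolds ` M"
  have P_action: "(\<lambda>x. p (g x)) \<in> ?P" if "p \<in> ?P" "g \<in> G" for p g
    using polynomial_functions_subst[OF that(1), of g C] stable[OF _ that(2)]
    by (auto intro: polynomial_functions.coord)
  have E_P: "E \<subseteq> invariant_polynomials C"
  proof
    fix e assume "e \<in> E"
    then obtain c s where cs: "c \<in> C" "e = (\<lambda>x. coeff (orbit_poly c x) s)" unfolding E_def by auto
    have "e \<in> ?P" unfolding cs(2)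
      by (rule coeff_orbit_poly_in)
        (fact polynomial_functions.const polynomial_functions.add polynomial_functions.mult
          P_action polynomial_functions.coord[OF cs(1)])+
    moreover have "invariant e"
      using invariant_orbit_poly[of c] unfolding cs(2) by (simp add: invariant_def)
    ultimately show "e \<in> invariant_polynomials C" by (simp add: invariant_polynomials_def)
  qed
  have P_power: "(\<lambda>x. p x ^ k) \<in> ?P" if "p \<in> ?P" for p k
    by (induction k) (auto intro: polynomial_functions.intros that)
  have P_reynolds: "reynolds p \<in> invariant_polynomials C" if "p \<in> ?P" for p
    using invariant_reynolds polynomial_functions_sum[OF P_action[OF that], of G "\<lambda>g. g"]
    by (simp add: invariant_polynomials_def reynolds_def[abs_def])
  have M_P: "M \<subseteq> ?P"
    unfolding M_def monomial_def
    by (auto intro!: polynomial_functions_prod P_power intro: polynomial_functions.coord)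
  let ?A = "polynomial_functions E" and ?S = "combinations (polynomial_functions E) M"
  have const_S: "(\<lambda>_. a) \<in> ?S" for a
  proof -
    have "monomial (\<lambda>c\<in>C. 0) \<in> M" unfolding M_def using card_G_pos by (intro imageI) auto
    moreover have "monomial (\<lambda>c\<in>C. 0) = (\<lambda>_. 1)" by (auto simp: monomial_def)
    ultimately show ?thesis
      using combinations.product[OF polynomial_functions.const[of a E], of "monomial (\<lambda>c\<in>C. 0)" M]
      by simp
  qed
  have coord_S: "(\<lambda>x. c x * p x) \<in> ?S" if c: "c \<in> C" and "p \<in> ?S" for c p
    using that(2)
  proof induction
    case (product a g)
    obtain \<alpha> where \<alpha>: "g = monomial \<alpha>" "\<alpha> \<in> C \<rightarrow>\<^sub>E {..<?N}" using product(2) unfolding M_def by auto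
    define rest where "rest = (\<lambda>x. \<Prod>c'\<in>C - {c}. c' x ^ \<alpha> c')"
    have split: "monomial (\<alpha>(c := k)) x = c x ^ k * rest x" for k x
      unfolding monomial_def rest_def using c \<open>finite C\<close>
      by (subst prod.remove[OF \<open>finite C\<close> c]) (auto intro!: prod.cong)
    have g: "g x = c x ^ \<alpha> c * rest x" for x using split[of "\<alpha> c"] \<alpha>(1) by simp
    have in_M: "monomial (\<alpha>(c := k)) \<in> M" if "k < ?N" for k
      unfolding M_def using that \<alpha>(2) c by (intro imageI) (auto simp: PiE_iff extensional_def)
    show ?case
    proof (cases "Suc (\<alpha> c) < ?N")
      case True
      have "(\<lambda>x. a x * monomial (\<alpha>(c := Suc (\<alpha> c))) x) \<in> ?S"
        by (intro combinations.product product in_M True)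
      then show ?thesis unfolding split g by (simp add: mult_ac)
    next
      case False
      then have N: "?N = Suc (\<alpha> c)" using \<alpha>(2) c by (auto simp: PiE_iff)
      let ?e = "\<lambda>s x. coeff (orbit_poly c x) s"
      have red: "c x ^ ?N = (\<Sum>s<?N. - 1 * ?e s x * c x ^ s)" for x
      proof -
        have "0 = (\<Sum>s\<le>?N. ?e s x * c x ^ s)"
          using poly_orbit_poly[of c x] by (simp add: degree_orbit_poly poly_altdef)
        also have "\<dots> = (\<Sum>s<?N. ?e s x * c x ^ s) + c x ^ ?N"
          by (simp add: lead_coeff_orbit_poly lessThan_Suc_atMost[symmetric])
        finally show ?thesis by (simp add: sum_negf add_eq_0_iff)
      qed
      have eA: "(\<lambda>x. - 1 * ?e s x) \<in> ?A" if "s < ?N" for s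
        using that c unfolding E_def
        by (intro polynomial_functions.mult polynomial_functions.const polynomial_functions.coord) auto
      \<comment> \<open>The orbit polynomial rewrites the power \<open>?N\<close> of \<open>c\<close> by lower powers.\<close>
      have "(\<lambda>x. \<Sum>s<?N. (a x * (- 1 * ?e s x)) * monomial (\<alpha>(c := s)) x) \<in> ?S"
        by (intro combinations_sum const_S combinations.product polynomial_functions.mult[OF product(1)]
            eA in_M) auto
      also have "(\<lambda>x. \<Sum>s<?N. (a x * (- 1 * ?e s x)) * monomial (\<alpha>(c := s)) x)
         = (\<lambda>x. a x * (\<Sum>s<?N. - 1 * ?e s x * c x ^ s) * rest x)"
        unfolding split by (simp add: sum_distrib_left sum_distrib_right mult_ac)
      also have "\<dots> = (\<lambda>x. c x * (a x * g x))"
      proof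
        fix x
        have "c x ^ ?N = c x * c x ^ \<alpha> c" by (simp add: N)
        then show "a x * (\<Sum>s<?N. - 1 * ?e s x * c x ^ s) * rest x = c x * (a x * g x)"
          unfolding red[symmetric] g by (simp add: mult_ac)
      qed
      finally show ?thesis .
    qed
  next
    case (add p q)
    from combinations.add[OF add.IH] show ?case by (simp add: distrib_left)
  qed
  have poly_S: "(\<lambda>x. p x * q x) \<in> ?S" if "p \<in> ?P" "q \<in> ?S" for p q
    using that
  proof (induction arbitrary: q)
    case (const a)
    from this show ?case
    proof induction
      case (product b g)
      from combinations.product[OF polynomial_functions.mult[OF polynomial_functions.const[of a] product(1)] product(2)]
      show ?case by (simp add: mult_ac)
    next
      case (add p q)
      from combinations.add[OF add.IH] show ?case by (simp add: distrib_left)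
    qed
  next
    case (coord c) then show ?case by (rule coord_S)
  next
    case (add p q)
    from combinations.add[OF add.IH(1)[OF add.prems] add.IH(2)[OF add.prems]]
    show ?case by (simp add: distrib_right)
  next
    case (mult p q)
    from mult.IH(1)[OF mult.IH(2)[OF mult.prems]] show ?case by (simp add: mult.assoc)
  qed
  have inv_A: "invariant a" if "a \<in> ?A" for a
    using that
  proof induction
    case (coord c) then show ?case using E_P by (auto simp: invariant_polynomials_def)
  qed (auto simp: invariant_def)
  have rey_S: "reynolds p \<in> polynomial_functions F" if "p \<in> ?S" for p
    using that
  proof induction
    case (product a g)
    have "reynolds (\<lambda>x. a x * g x) = (\<lambda>x. a x * reynolds g x)"
      using reynolds_mult_invariant[OF inv_A[OF product(1)]] by auto
    moreover have "a \<in> polynomial_functions F"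
      using product(1) by (rule polynomial_functions_mono[rotated]) (auto simp: F_def)
    ultimately show ?case using product(2)
      by (auto simp: F_def intro!: polynomial_functions.mult intro: polynomial_functions.coord)
  next
    case (add p q)
    then show ?case using polynomial_functions.add[OF add.IH] by (simp add: reynolds_add[abs_def])
  qed
  show ?thesis
  proof
    show "finite F" unfolding F_def E_def M_def using \<open>finite C\<close> by (auto intro!: finite_PiE)
    show "F \<subseteq> invariant_polynomials C" using E_P P_reynolds M_P unfolding F_def by auto
    show "invariant_polynomials C \<subseteq> polynomial_functions F"
    proof
      fix p assume "p \<in> invariant_polynomials C"
      then have p: "p \<in> ?P" "invariant p" by (auto simp: invariant_polynomials_def)
      have p_eq: "(\<lambda>x. (1 / of_nat (card G)) * reynolds p x) = p"
        using reynolds_invariant[OF p(2)] card_G_pos by auto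
      have "p \<in> ?S" using poly_S[OF p(1) const_S, of 1] by simp
      then have "(\<lambda>x. (1 / of_nat (card G)) * reynolds p x) \<in> polynomial_functions F"
        by (intro polynomial_functions.mult polynomial_functions.const rey_S)
      then show "p \<in> polynomial_functions F" unfolding p_eq .
    qed
  qed
qed

end

section \<open>Multisymmetric functions and power sums\<close>

text \<open>
  Sums over permutations are computed by adding one index after the other, which leads through
  partial injections.
\<close>

definition injections :: "nat \<Rightarrow> nat \<Rightarrow> (nat \<Rightarrow> nat) set" where
  "injections k m = {j \<in> {..<k} \<rightarrow>\<^sub>E {..<m}. inj_on j {..<k}}"

lemma finite_injections: "finite (injections k m)"
  unfolding injections_def by (rule finite_subset[of _ "{..<k} \<rightarrow>\<^sub>E {..<m}"]) (auto intro: finite_PiE)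

lemma bij_betw_injections_Suc:
  "bij_betw (\<lambda>(j, v). j(k := v)) (SIGMA j : injections k m. {..<m} - j ` {..<k}) (injections (Suc k) m)"
proof (rule bij_betwI[where g = "\<lambda>j. (restrict j {..<k}, j k)"])
  show "(\<lambda>(j, v). j(k := v)) \<in> (SIGMA j : injections k m. {..<m} - j ` {..<k}) \<rightarrow> injections (Suc k) m"
    by (auto simp: injections_def PiE_iff extensional_def inj_on_def less_Suc_eq)
  show "(\<lambda>j. (restrict j {..<k}, j k)) \<in> injections (Suc k) m \<rightarrow> (SIGMA j : injections k m. {..<m} - j ` {..<k})"
    by (fastforce simp: injections_def PiE_iff inj_on_def)
  show "(\<lambda>j. (restrict j {..<k}, j k)) ((\<lambda>(j, v). j(k := v)) p) = p"
    if "p \<in> (SIGMA j : injections k m. {..<m} - j ` {..<k})" for p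
    using that by (auto simp: injections_def PiE_iff extensional_def fun_eq_iff)
  show "(\<lambda>(j, v). j(k := v)) ((\<lambda>j. (restrict j {..<k}, j k)) j) = j"
    if "j \<in> injections (Suc k) m" for j
    using that by (auto simp: injections_def PiE_iff extensional_def fun_eq_iff less_Suc_eq)
qed

text \<open>
  Multiplying the sum over injections of length \<open>k\<close> by a power sum adds an index \<open>v\<close> that is free to
  collide with an earlier one. If it collides with the index at position \<open>s\<close>, the factors \<open>F s\<close> and \<open>F k\<close>
  are evaluated at the same point, which is again a sum over injections of length \<open>k\<close>.
\<close>

lemma injective_monomial_sum_Suc:
  fixes x :: "nat \<Rightarrow> 'b" and F :: "nat \<Rightarrow> 'b \<Rightarrow> complex"
  shows "(\<Sum>j\<in>injections (Suc k) m. \<Prod>i<Suc k. F i (x (j i))) =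
    (\<Sum>j\<in>injections k m. \<Prod>i<k. F i (x (j i))) * (\<Sum>v<m. F k (x v))
    - (\<Sum>s<k. \<Sum>j\<in>injections k m. \<Prod>i<k. (F(s := \<lambda>y. F s y * F k y)) i (x (j i)))"
proof -
  let ?P = "\<lambda>j. \<Prod>i<k. F i (x (j i))"
  have "(\<Sum>j\<in>injections (Suc k) m. \<Prod>i<Suc k. F i (x (j i)))
      = (\<Sum>(j, v)\<in>(SIGMA j : injections k m. {..<m} - j ` {..<k}). \<Prod>i<Suc k. F i (x ((j(k := v)) i)))"
    by (subst sum.reindex_bij_betw[OF bij_betw_injections_Suc, symmetric]) (auto intro!: sum.cong)
  also have "\<dots> = (\<Sum>j\<in>injections k m. \<Sum>v\<in>{..<m} - j ` {..<k}. ?P j * F k (x v))"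
    by (subst sum.Sigma) (auto simp: finite_injections intro!: sum.cong prod.cong)
  also have "\<dots> = (\<Sum>j\<in>injections k m. ?P j * (\<Sum>v<m. F k (x v)) - (\<Sum>s<k. ?P j * F k (x (j s))))"
  proof (rule sum.cong[OF refl])
    fix j assume j: "j \<in> injections k m"
    have "(\<Sum>v\<in>j ` {..<k}. F k (x v)) = (\<Sum>s<k. F k (x (j s)))"
      using j by (subst sum.reindex) (auto simp: injections_def)
    moreover have "(\<Sum>v\<in>{..<m} - j ` {..<k}. F k (x v)) = (\<Sum>v<m. F k (x v)) - (\<Sum>v\<in>j ` {..<k}. F k (x v))"
      using j by (intro sum_diff) (auto simp: injections_def)
    ultimately show "(\<Sum>v\<in>{..<m} - j ` {..<k}. ?P j * F k (x v))
        = ?P j * (\<Sum>v<m. F k (x v)) - (\<Sum>s<k. ?P j * F k (x (j s)))"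
      by (simp add: sum_distrib_left[symmetric] right_diff_distrib)
  qed
  also have "\<dots> = (\<Sum>j\<in>injections k m. ?P j) * (\<Sum>v<m. F k (x v))
      - (\<Sum>s<k. \<Sum>j\<in>injections k m. ?P j * F k (x (j s)))"
    by (subst sum.swap) (simp add: sum_subtractf sum_distrib_right)
  also have "(\<Sum>s<k. \<Sum>j\<in>injections k m. ?P j * F k (x (j s)))
      = (\<Sum>s<k. \<Sum>j\<in>injections k m. \<Prod>i<k. (F(s := \<lambda>y. F s y * F k y)) i (x (j i)))"
  proof (intro sum.cong refl)
    fix s j assume s: "s \<in> {..<k}"
    have "(\<Prod>i<k. (F(s := \<lambda>y. F s y * F k y)) i (x (j i)))
        = F s (x (j s)) * F k (x (j s)) * (\<Prod>i\<in>{..<k} - {s}. F i (x (j i)))"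
      using s by (subst prod.remove[of _ s]) (auto intro!: prod.cong)
    also have "\<dots> = ?P j * F k (x (j s))"
      using s by (subst prod.remove[of _ s "\<lambda>i. F i (x (j i))"]) auto
    finally show "?P j * F k (x (j s)) = (\<Prod>i<k. (F(s := \<lambda>y. F s y * F k y)) i (x (j i)))" by simp
  qed
  finally show ?thesis .
qed

lemma bij_betw_permutes_injections:
  "bij_betw (\<lambda>\<sigma>. restrict \<sigma> {..<m}) {\<sigma>. \<sigma> permutes {..<m}} (injections m m)"
proof (rule bij_betwI[where g = "\<lambda>j i. if i < m then j i else i"])
  show "(\<lambda>\<sigma>. restrict \<sigma> {..<m}) \<in> {\<sigma>. \<sigma> permutes {..<m}} \<rightarrow> injections m m"
  proof (rule Pi_I)
    fix \<sigma> assume "\<sigma> \<in> {\<sigma>. \<sigma> permutes {..<m}}"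
    then have \<sigma>: "\<sigma> permutes {..<m}" by simp
    then have "inj_on (restrict \<sigma> {..<m}) {..<m}" using permutes_inj_on[OF \<sigma>] by simp
    moreover have "\<sigma> i < m" if "i < m" for i using permutes_in_image[OF \<sigma>, of i] that by simp
    ultimately show "restrict \<sigma> {..<m} \<in> injections m m" unfolding injections_def by auto
  qed
  show "(\<lambda>j i. if i < m then j i else i) \<in> injections m m \<rightarrow> {\<sigma>. \<sigma> permutes {..<m}}"
  proof (intro Pi_I CollectI bij_imp_permutes)
    fix j assume j: "j \<in> injections m m"
    have "bij_betw j {..<m} {..<m}"
      using j endo_inj_surj[of "{..<m}" j] by (auto simp: injections_def bij_betw_def PiE_iff)
    then show "bij_betw (\<lambda>i. if i < m then j i else i) {..<m} {..<m}"
      by (rule bij_betw_cong[THEN iffD1, rotated]) simp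
  qed auto
  show "(\<lambda>i. if i < m then (restrict \<sigma> {..<m}) i else i) = \<sigma>" if "\<sigma> \<in> {\<sigma>. \<sigma> permutes {..<m}}" for \<sigma>
    using that by (auto simp: fun_eq_iff permutes_def)
  show "restrict (\<lambda>i. if i < m then j i else i) {..<m} = j" if "j \<in> injections m m" for j
    using that by (auto simp: injections_def PiE_iff extensional_def fun_eq_iff)
qed

text \<open>
  The injections of length \<open>m\<close> into \<open>m\<close> indices are the permutations, so the recursion for
  injections expresses a symmetrized product as a polynomial in power sums.
\<close>

lemma symmetrized_product_in_power_sum_algebra:
  fixes R :: "((nat \<Rightarrow> 'b) \<Rightarrow> complex) set" and \<F> :: "('b \<Rightarrow> complex) set"
  assumes R: "\<And>f. f \<in> piecewise_rational R \<Longrightarrow> f \<in> R"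
    and \<F>_mult: "\<And>f g. f \<in> \<F> \<Longrightarrow> g \<in> \<F> \<Longrightarrow> (\<lambda>y. f y * g y) \<in> \<F>"
    and power_sums: "\<And>f. f \<in> \<F> \<Longrightarrow> (\<lambda>x. \<Sum>i<m. f (x i)) \<in> R"
    and F: "\<And>i. F i \<in> \<F>"
  shows "(\<lambda>x. \<Sum>\<sigma> | \<sigma> permutes {..<m}. \<Prod>i<m. F i (x (\<sigma> i))) \<in> R"
proof -
  note in_R = piecewise_rational.coord[of _ R]
  have "(\<lambda>x. \<Sum>j\<in>injections k m. \<Prod>i<k. F i (x (j i))) \<in> R" if "\<And>i. F i \<in> \<F>" for k and F :: "nat \<Rightarrow> 'b \<Rightarrow> complex"
    using that
  proof (induction k arbitrary: F)
    case 0
    show ?case by (rule R) (simp add: piecewise_rational.const)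
  next
    case (Suc k)
    have "(\<lambda>x. \<Sum>j\<in>injections k m. \<Prod>i<k. (F(s := \<lambda>y. F s y * F k y)) i (x (j i))) \<in> R" for s
      using Suc.prems \<F>_mult by (intro Suc.IH) auto
    then have corrections: "(\<lambda>x. \<Sum>s<k. \<Sum>j\<in>injections k m. \<Prod>i<k. (F(s := \<lambda>y. F s y * F k y)) i (x (j i)))
        \<in> piecewise_rational R"
      by (intro piecewise_rational_sum in_R)
    have "(\<lambda>x. (\<Sum>j\<in>injections k m. \<Prod>i<k. F i (x (j i))) * (\<Sum>v<m. F k (x v))) \<in> piecewise_rational R"
      by (intro piecewise_rational.mult in_R Suc.IH Suc.prems power_sums)
    from R[OF piecewise_rational_diff[OF this corrections]] show ?case
      unfolding injective_monomial_sum_Suc .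
  qed
  from this[where k = m and F = F, OF F] show ?thesis
    by (rule back_subst[where P = "\<lambda>f. f \<in> R"])
      (simp add: fun_eq_iff sum.reindex_bij_betw[OF bij_betw_permutes_injections, symmetric])
qed

section \<open>Power sums of the roots of a polynomial\<close>

text \<open>
  For \<open>f = \<Prod>i\<in>I. 1 - y i X\<close> the generating function of the power sums is \<open>\<Sum>i\<in>I. 1 / (1 - y i X)\<close>.
  Its product with \<open>f\<close> is \<open>card I\<cdot>f - X f'\<close>, and this is the identity of the coefficients of \<open>X\<^sup>b\<close>.
  The reversed polynomial is used, rather than the monic one with roots \<open>y i\<close>, since the formula is then
  the same for all \<open>b\<close>.
\<close>

lemma newton_identity:
  fixes y :: "nat \<Rightarrow> complex"
  assumes "finite I"
  defines "f \<equiv> \<Prod>i\<in>I. [:1, - y i:]"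
  shows "(\<Sum>i\<in>I. y i ^ b) =
    (of_nat (card I) - of_nat b) * coeff f b - (\<Sum>s<b. (\<Sum>i\<in>I. y i ^ s) * coeff f (b - s))"
proof -
  \<comment> \<open>\<open>1 / (1 - a X)\<close> as a formal power series\<close>
  have geometric: "fps_of_poly [:1, - a:] * Abs_fps (\<lambda>s. a ^ s) = 1" for a :: complex
  proof (rule fps_ext)
    fix n show "fps_nth (fps_of_poly [:1, - a:] * Abs_fps (\<lambda>s. a ^ s)) n = fps_nth 1 n"
      by (cases n) (simp_all add: fps_of_poly_pCons algebra_simps)
  qed
  let ?rest = "\<lambda>i. \<Prod>i'\<in>I - {i}. [:1, - y i':]"
  have f_split: "f = [:1, - y i:] * ?rest i" if "i \<in> I" for i
    unfolding f_def by (rule prod.remove) (use assms that in auto)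
  have pd: "pderiv f = (\<Sum>i\<in>I. [:- y i:] * ?rest i)"
    unfolding f_def pderiv_prod by (intro sum.cong) (auto simp: pderiv_pCons mult_ac)
  have sum_rest_eq: "(\<Sum>i\<in>I. ?rest i) = Polynomial.smult (of_nat (card I)) f - pCons 0 (pderiv f)"
  proof -
    have "?rest i = f - pCons 0 ([:- y i:] * ?rest i)" if "i \<in> I" for i
      using f_split[OF that] by (simp add: algebra_simps)
    then have "(\<Sum>i\<in>I. ?rest i) = (\<Sum>i\<in>I. f - pCons 0 ([:- y i:] * ?rest i))"
      by (intro sum.cong refl)
    also have "\<dots> = (\<Sum>i\<in>I. f) - (\<Sum>i\<in>I. [:0, 1:] * ([:- y i:] * ?rest i))"
      by (simp add: sum_subtractf)
    also have "(\<Sum>i\<in>I. [:0, 1:] * ([:- y i:] * ?rest i)) = [:0, 1:] * pderiv f"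
      unfolding pd sum_distrib_left ..
    finally show ?thesis by (simp add: of_nat_poly)
  qed
  have sum_rest: "coeff (\<Sum>i\<in>I. ?rest i) b = (of_nat (card I) - of_nat b) * coeff f b"
    unfolding sum_rest_eq by (cases b) (simp_all add: coeff_pderiv algebra_simps)
  have "fps_of_poly (\<Sum>i\<in>I. ?rest i) = Abs_fps (\<lambda>s. \<Sum>i\<in>I. y i ^ s) * fps_of_poly f"
  proof -
    have "fps_of_poly (?rest i) = Abs_fps (\<lambda>s. y i ^ s) * fps_of_poly f" if "i \<in> I" for i
    proof -
      have "Abs_fps (\<lambda>s. y i ^ s) * fps_of_poly f
          = (fps_of_poly [:1, - y i:] * Abs_fps (\<lambda>s. y i ^ s)) * fps_of_poly (?rest i)"
        unfolding f_split[OF that] fps_of_poly_mult by (simp only: mult_ac)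
      then show ?thesis unfolding geometric by simp
    qed
    moreover have "Abs_fps (\<lambda>s. \<Sum>i\<in>I. y i ^ s) = (\<Sum>i\<in>I. Abs_fps (\<lambda>s. y i ^ s))"
      by (simp add: fps_eq_iff fps_sum_nth)
    ultimately show ?thesis by (simp add: fps_of_poly_sum sum_distrib_right)
  qed
  then have "fps_nth (fps_of_poly (\<Sum>i\<in>I. ?rest i)) b
      = fps_nth (Abs_fps (\<lambda>s. \<Sum>i\<in>I. y i ^ s) * fps_of_poly f) b" by (rule arg_cong)
  then have "coeff (\<Sum>i\<in>I. ?rest i) b = (\<Sum>s=0..b. (\<Sum>i\<in>I. y i ^ s) * coeff f (b - s))"
    unfolding fps_mult_nth fps_of_poly_nth fps_nth_Abs_fps .
  also have "\<dots> = (\<Sum>s<b. (\<Sum>i\<in>I. y i ^ s) * coeff f (b - s)) + (\<Sum>i\<in>I. y i ^ b) * coeff f 0"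
    by (simp add: atLeast0AtMost lessThan_Suc_atMost[symmetric])
  also have "coeff f 0 = 1"
    unfolding f_def by (simp add: poly_0_coeff_0[symmetric] poly_prod)
  finally show ?thesis using sum_rest by simp
qed

section \<open>Hermite interpolation\<close>

lemma smult_one_mat_mult_vec:
  fixes c :: "'a :: comm_ring_1"
  shows "(c \<cdot>\<^sub>m 1\<^sub>m m) *\<^sub>v Matrix.vec m v = c \<cdot>\<^sub>v Matrix.vec m v"
proof (rule Matrix.eq_vecI)
  fix i assume i: "i < dim_vec (c \<cdot>\<^sub>v Matrix.vec m v)"
  have "(\<Sum>j = 0..<m. c * (if j = i then 1 else 0) * v j) = (\<Sum>j = 0..<m. if j = i then c * v j else 0)"
    by (rule sum.cong) auto
  with i show "vec_index ((c \<cdot>\<^sub>m 1\<^sub>m m) *\<^sub>v Matrix.vec m v) i = vec_index (c \<cdot>\<^sub>v Matrix.vec m v) i"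
    by (simp add: scalar_prod_def eq_commute[of i])
qed simp

text \<open>
  The explicit formula for the solution is needed because it shows that the solution is piecewise
  rational in the entries of the system.
\<close>

lemma cramer:
  fixes M :: "nat \<Rightarrow> nat \<Rightarrow> complex" and b :: "nat \<Rightarrow> complex"
  assumes kernel: "\<And>v. (\<And>i. i < m \<Longrightarrow> (\<Sum>j<m. M i j * v j) = 0) \<Longrightarrow> (\<And>j. j < m \<Longrightarrow> v j = 0)"
  defines "A \<equiv> Matrix.mat m m (\<lambda>(i, j). M i j)"
  shows "\<exists>v. \<forall>i<m. (\<Sum>j<m. M i j * v j) = b i"
    and "(\<And>i. i < m \<Longrightarrow> (\<Sum>j<m. M i j * v j) = b i) \<Longrightarrow> j < m \<Longrightarrow>
      v j = (\<Sum>i<m. cofactor A i j * b i) / Determinant.det A"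
proof -
  have A: "A \<in> carrier_mat m m" unfolding A_def by simp
  have mv: "i < m \<Longrightarrow> vec_index (A *\<^sub>v Matrix.vec m v) i = (\<Sum>j<m. M i j * v j)" for v i
    by (simp add: A_def scalar_prod_def lessThan_atLeast0)
  have "Determinant.det A \<noteq> 0"
  proof
    assume "Determinant.det A = 0"
    then obtain w where w: "w \<in> carrier_vec m" "w \<noteq> 0\<^sub>v m" "A *\<^sub>v w = 0\<^sub>v m"
      using det_0_iff_vec_prod_zero_field[OF A] by auto
    have "w = Matrix.vec m (\<lambda>i. vec_index w i)" using w(1) by auto
    then have "i < m \<Longrightarrow> (\<Sum>j<m. M i j * vec_index w j) = 0" for i
      using mv[of i "\<lambda>i. vec_index w i"] w(3) by simp
    from kernel[OF this] have "vec_index w j = 0" if "j < m" for j using that by blast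
    then have "w = 0\<^sub>v m" using w(1) by auto
    with w(2) show False ..
  qed
  note det = this
  have adj: "(\<Sum>i<m. cofactor A i j * (\<Sum>j'<m. M i j' * v j')) = Determinant.det A * v j" if "j < m" for v j
  proof -
    have "adj_mat A *\<^sub>v (A *\<^sub>v Matrix.vec m v) = (adj_mat A * A) *\<^sub>v Matrix.vec m v"
      using A adj_mat(1)[OF A] by simp
    also have "\<dots> = Determinant.det A \<cdot>\<^sub>v Matrix.vec m v"
      unfolding adj_mat(3)[OF A] by (simp add: smult_one_mat_mult_vec)
    finally have "vec_index (adj_mat A *\<^sub>v (A *\<^sub>v Matrix.vec m v)) j = Determinant.det A * v j" using that by simp
    moreover have "vec_index (adj_mat A *\<^sub>v (A *\<^sub>v Matrix.vec m v)) j
        = (\<Sum>i<m. adj_mat A $$ (j, i) * vec_index (A *\<^sub>v Matrix.vec m v) i)"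
      using that A adj_mat(1)[OF A] by (simp add: scalar_prod_def lessThan_atLeast0)
    moreover have "i < m \<Longrightarrow> adj_mat A $$ (j, i) = cofactor A i j" for i
      using that A by (simp add: adj_mat_def)
    ultimately show ?thesis using mv by simp
  qed
  show "v j = (\<Sum>i<m. cofactor A i j * b i) / Determinant.det A"
    if "\<And>i. i < m \<Longrightarrow> (\<Sum>j<m. M i j * v j) = b i" "j < m" for v j
  proof -
    have "(\<Sum>i<m. cofactor A i j * (\<Sum>j'<m. M i j' * v j')) = (\<Sum>i<m. cofactor A i j * b i)"
      by (intro sum.cong refl) (simp add: that(1))
    then show ?thesis using adj[OF that(2), of v] det by (simp add: nonzero_eq_divide_eq mult.commute)
  qed
  have "(\<Sum>j<m. M i j * ((\<Sum>i'<m. cofactor A i' j * b i') / Determinant.det A)) = b i" if "i < m" for i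
  proof -
    have "(A *\<^sub>v (adj_mat A *\<^sub>v Matrix.vec m b)) = (A * adj_mat A) *\<^sub>v Matrix.vec m b"
      using A adj_mat(1)[OF A] by simp
    also have "\<dots> = Determinant.det A \<cdot>\<^sub>v Matrix.vec m b"
      unfolding adj_mat(2)[OF A] by (simp add: smult_one_mat_mult_vec)
    finally have "vec_index (A *\<^sub>v (adj_mat A *\<^sub>v Matrix.vec m b)) i = Determinant.det A * b i" using that by simp
    moreover have "adj_mat A *\<^sub>v Matrix.vec m b = Matrix.vec m (\<lambda>j. \<Sum>i'<m. cofactor A i' j * b i')"
      using A by (auto simp: adj_mat_def scalar_prod_def lessThan_atLeast0)
    ultimately have "(\<Sum>j<m. M i j * (\<Sum>i'<m. cofactor A i' j * b i')) = Determinant.det A * b i"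
      using mv[OF that] by simp
    moreover have "(\<Sum>j<m. M i j * ((\<Sum>i'<m. cofactor A i' j * b i') / Determinant.det A))
        = (\<Sum>j<m. M i j * (\<Sum>i'<m. cofactor A i' j * b i')) / Determinant.det A"
      by (simp only: times_divide_eq_right sum_divide_distrib[symmetric])
    ultimately show ?thesis using det by simp
  qed
  then show "\<exists>v. \<forall>i<m. (\<Sum>j<m. M i j * v j) = b i"
    by (intro exI[of _ "\<lambda>j. (\<Sum>i'<m. cofactor A i' j * b i') / Determinant.det A"]) simp
qed

text \<open>
  A list \<open>t\<close> of nodes, possibly with repetitions, prescribes Taylor coefficients of order less than
  \<open>k\<close> at a node that occurs \<open>k\<close> times. The \<open>rank\<close> of an index counts the earlier occurrences of its node,
  so the pairs of a node and an order correspond to the indices below \<open>m\<close>. Thus interpolation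
  becomes a linear system with \<open>m\<close> equations.
\<close>

definition multiplicity_at :: "nat \<Rightarrow> (nat \<Rightarrow> complex) \<Rightarrow> nat \<Rightarrow> nat" where
  "multiplicity_at m t i = card {i'. i' < m \<and> t i' = t i}"

definition rank :: "(nat \<Rightarrow> complex) \<Rightarrow> nat \<Rightarrow> nat" where
  "rank t i = card {i'. i' < i \<and> t i' = t i}"

definition taylor :: "complex poly \<Rightarrow> complex \<Rightarrow> complex poly" where
  "taylor g a = pcompose g [:a, 1:]"

text \<open>
  The bound on the degree is expressed by coefficients, so that for \<open>m = 0\<close> it leaves the zero
  polynomial only.
\<close>

definition interpolates :: "nat \<Rightarrow> (nat \<Rightarrow> complex) \<Rightarrow> (nat \<Rightarrow> nat \<Rightarrow> complex) \<Rightarrow> complex poly \<Rightarrow> bool" where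
  "interpolates m t b g \<longleftrightarrow> (\<forall>k\<ge>m. coeff g k = 0) \<and>
     (\<forall>i<m. \<forall>r<multiplicity_at m t i. coeff (taylor g (t i)) r = b i r)"

lemma rank_bij:
  assumes "i < m"
  shows "bij_betw (rank t) {i'. i' < m \<and> t i' = t i} {..<multiplicity_at m t i}"
proof -
  let ?S = "{i'. i' < m \<and> t i' = t i}"
  have mono: "rank t i' < rank t i''" if "i' \<in> ?S" "i'' \<in> ?S" "i' < i''" for i' i''
    unfolding rank_def
  proof (intro psubset_card_mono psubsetI)
    show "{j. j < i' \<and> t j = t i'} \<subseteq> {j. j < i'' \<and> t j = t i''}" using that by auto
    have "i' \<in> {j. j < i'' \<and> t j = t i''}" using that by auto
    then show "{j. j < i' \<and> t j = t i'} \<noteq> {j. j < i'' \<and> t j = t i''}" by blast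
  qed simp
  have inj: "inj_on (rank t) ?S"
  proof (rule inj_onI)
    fix i' i'' assume "i' \<in> ?S" "i'' \<in> ?S" "rank t i' = rank t i''"
    then show "i' = i''" using mono[of i' i''] mono[of i'' i'] by (cases i' i'' rule: linorder_cases) auto
  qed
  moreover have "rank t ` ?S = {..<multiplicity_at m t i}"
  proof (rule card_subset_eq)
    show "rank t ` ?S \<subseteq> {..<multiplicity_at m t i}"
    proof (intro image_subsetI)
      fix i' assume i': "i' \<in> ?S"
      then have "{j. j < i' \<and> t j = t i'} \<subseteq> ?S - {i'}" by auto
      then have "rank t i' \<le> card (?S - {i'})" unfolding rank_def by (intro card_mono) auto
      also have "\<dots> < card ?S" using i' by (intro card_Diff1_less) auto
      finally show "rank t i' \<in> {..<multiplicity_at m t i}" by (simp add: multiplicity_at_def)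
    qed
    show "card (rank t ` ?S) = card {..<multiplicity_at m t i}"
      using card_image[OF inj] by (simp add: multiplicity_at_def)
  qed simp
  ultimately show ?thesis by (simp add: bij_betw_def)
qed

lemma rank_less_multiplicity: "i < m \<Longrightarrow> rank t i < multiplicity_at m t i"
  using rank_bij[of i m t] by (auto simp: bij_betw_def)

lemma rank_attained:
  assumes "i < m" "r < multiplicity_at m t i"
  obtains i' where "i' < m" "t i' = t i" "rank t i' = r"
proof -
  have "r \<in> rank t ` {i'. i' < m \<and> t i' = t i}"
    using bij_betw_imp_surj_on[OF rank_bij[OF assms(1), of t]] assms(2) by simp
  then show ?thesis using that by blast
qed

lemma pcompose_power: "pcompose (p ^ k) q = pcompose p q ^ k"
  by (induction k) (simp_all add: pcompose_mult pcompose_1)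

lemma order_ge_taylor:
  assumes "g \<noteq> 0" "\<And>r. r < k \<Longrightarrow> coeff (taylor g a) r = 0"
  shows "k \<le> order a g"
proof -
  have "monom 1 k dvd taylor g a" using assms(2) by (simp add: monom_1_dvd_iff')
  then obtain h where h: "taylor g a = monom 1 k * h" by (elim dvdE)
  have "g = pcompose (taylor g a) [:- a, 1:]"
  proof -
    have "pcompose [:a, 1:] [:- a, 1:] = [:0, 1:]" by (simp add: pcompose_pCons)
    then show ?thesis unfolding taylor_def pcompose_assoc[symmetric] by simp
  qed
  also have "\<dots> = [:- a, 1:] ^ k * pcompose h [:- a, 1:]"
  proof -
    have "pcompose (monom 1 k) [:- a, 1:] = [:- a, 1:] ^ k"
      unfolding monom_altdef smult_1_left pcompose_power by (simp add: pcompose_pCons)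
    then show ?thesis unfolding h pcompose_mult by simp
  qed
  finally have "[:- a, 1:] ^ k dvd g" by (rule dvdI)
  then show ?thesis using assms(1) order_divides[of a k g] by blast
qed

text \<open>
  A solution of the homogeneous problem has at least \<open>m\<close> roots counted with multiplicity.
\<close>

lemma interpolates_zero_unique:
  assumes "interpolates m t (\<lambda>_ _. 0) g"
  shows "g = 0"
proof (rule ccontr)
  assume g: "g \<noteq> 0"
  have "image_mset t (mset_set {..<m}) \<subseteq># proots g"
  proof (rule mset_subset_eqI)
    fix a
    have count: "count (image_mset t (mset_set {..<m})) a = card {i. i < m \<and> t i = a}"
    proof -
      have "(\<Sum>i\<in>t -` {a} \<inter> {..<m}. count (mset_set {..<m}) i) = (\<Sum>i\<in>t -` {a} \<inter> {..<m}. 1)"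
        by (intro sum.cong) auto
      moreover have "t -` {a} \<inter> {..<m} = {i. i < m \<and> t i = a}" by auto
      ultimately show ?thesis by (simp add: count_image_mset)
    qed
    show "count (image_mset t (mset_set {..<m})) a \<le> count (proots g) a"
    proof (cases "\<exists>i<m. t i = a")
      case True
      then obtain i where i: "i < m" "t i = a" by blast
      then have "multiplicity_at m t i \<le> order a g"
        using assms g by (intro order_ge_taylor) (auto simp: interpolates_def)
      then show ?thesis using i g by (simp add: count multiplicity_at_def)
    next
      case False
      then have empty: "{i. i < m \<and> t i = a} = {}" by auto
      show ?thesis unfolding count empty by simp
    qed
  qed
  from size_mset_mono[OF this] have "m \<le> size (proots g)" by simp
  also have "\<dots> \<le> degree g" by (rule size_proots_le)
  finally show False using assms g by (auto simp: interpolates_def)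
qed

lemma taylor_diff: "taylor (g - h) a = taylor g a - taylor h a"
  by (simp add: taylor_def pcompose_diff)

lemma interpolates_unique:
  assumes "interpolates m t b g" "interpolates m t b h" shows "g = h"
  using interpolates_zero_unique[of m t "g - h"] assms
  by (simp add: interpolates_def taylor_diff)

lemma coeff_taylor:
  assumes "\<forall>k\<ge>m. coeff g k = 0"
  shows "coeff (taylor g a) r = (\<Sum>j<m. coeff ([:a, 1:] ^ j) r * coeff g j)"
proof -
  have "g = (\<Sum>j<m. monom (coeff g j) j)"
    using assms by (intro poly_eqI) (simp add: coeff_sum not_less)
  then have "taylor g a = (\<Sum>j<m. pcompose (monom (coeff g j) j) [:a, 1:])"
    unfolding taylor_def using pcompose_sum[of "\<lambda>j. monom (coeff g j) j" "{..<m}" "[:a, 1:]"] by simp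
  also have "\<dots> = (\<Sum>j<m. Polynomial.smult (coeff g j) ([:a, 1:] ^ j))"
  proof (intro sum.cong refl)
    fix j
    have "pcompose [:0, 1:] [:a, 1:] = [:a, 1:]" by (simp add: pcompose_pCons)
    then show "pcompose (monom (coeff g j) j) [:a, 1:] = Polynomial.smult (coeff g j) ([:a, 1:] ^ j)"
      unfolding monom_altdef pcompose_smult pcompose_power by simp
  qed
  finally show ?thesis by (simp add: coeff_sum mult.commute)
qed

text \<open>
  A confluent Vandermonde matrix: row \<open>i\<close> maps the coefficients of \<open>g\<close> to the Taylor coefficient
  of \<open>g\<close> at \<open>t i\<close> of order \<open>rank t i\<close>.
\<close>

definition hermite_matrix :: "(nat \<Rightarrow> complex) \<Rightarrow> nat \<Rightarrow> nat \<Rightarrow> complex" where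
  "hermite_matrix t i j = coeff ([:t i, 1:] ^ j) (rank t i)"

lemma interpolates_iff_hermite_matrix:
  assumes cons: "\<And>i i' r. i < m \<Longrightarrow> i' < m \<Longrightarrow> t i = t i' \<Longrightarrow> b i r = b i' r"
    and g: "\<forall>k\<ge>m. coeff g k = 0"
  shows "interpolates m t b g \<longleftrightarrow> (\<forall>i<m. (\<Sum>j<m. hermite_matrix t i j * coeff g j) = b i (rank t i))"
proof -
  have "(\<Sum>j<m. hermite_matrix t i j * coeff g j) = coeff (taylor g (t i)) (rank t i)" for i
    unfolding coeff_taylor[OF g] hermite_matrix_def ..
  moreover have "(\<forall>i<m. \<forall>r<multiplicity_at m t i. coeff (taylor g (t i)) r = b i r)
     \<longleftrightarrow> (\<forall>i<m. coeff (taylor g (t i)) (rank t i) = b i (rank t i))"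
  proof (intro iffI allI impI)
    fix i r assume rk: "\<forall>i<m. coeff (taylor g (t i)) (rank t i) = b i (rank t i)"
      and i: "i < m" "r < multiplicity_at m t i"
    \<comment> \<open>The condition of order \<open>r\<close> at \<open>t i\<close> is the equation of the index with this node and rank \<open>r\<close>.\<close>
    obtain i' where "i' < m" "t i' = t i" "rank t i' = r" using rank_attained[OF i] .
    with rk i cons[of i i' r] show "coeff (taylor g (t i)) r = b i r" by auto
  qed (auto simp: rank_less_multiplicity)
  ultimately show ?thesis using g by (simp add: interpolates_def)
qed

lemma hermite_matrix_kernel:
  assumes "\<And>i. i < m \<Longrightarrow> (\<Sum>j<m. hermite_matrix t i j * v j) = 0" "j < m"
  shows "v j = 0"
proof -
  define g where "g = (\<Sum>j<m. monom (v j) j)"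
  have coeff_g: "coeff g k = (if k < m then v k else 0)" for k
    by (simp add: g_def coeff_sum)
  have "interpolates m t (\<lambda>_ _. 0) g"
    by (subst interpolates_iff_hermite_matrix) (use assms(1) in \<open>simp_all add: coeff_g\<close>)
  from interpolates_zero_unique[OF this] show ?thesis using coeff_g[of j] assms(2) by simp
qed

lemma hermite_interpolation:
  assumes cons: "\<And>i i' r. i < m \<Longrightarrow> i' < m \<Longrightarrow> t i = t i' \<Longrightarrow> b i r = b i' r"
  shows "\<exists>!g. interpolates m t b g"
proof -
  obtain v where v: "\<forall>i<m. (\<Sum>j<m. hermite_matrix t i j * v j) = b i (rank t i)"
  proof -
    have "\<exists>v. \<forall>i<m. (\<Sum>j<m. hermite_matrix t i j * v j) = b i (rank t i)"
    proof (rule cramer(1))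
      fix v j assume "\<And>i. i < m \<Longrightarrow> (\<Sum>j<m. hermite_matrix t i j * v j) = 0" "j < m"
      then show "v j = 0" by (rule hermite_matrix_kernel)
    qed
    then show ?thesis using that by blast
  qed
  define g where "g = (\<Sum>j<m. monom (v j) j)"
  have coeff_g: "coeff g k = (if k < m then v k else 0)" for k
    by (simp add: g_def coeff_sum)
  have "interpolates m t b g"
    by (subst interpolates_iff_hermite_matrix[OF cons]) (use v in \<open>simp_all add: coeff_g\<close>)
  then show ?thesis using interpolates_unique by blast
qed

definition hermite :: "nat \<Rightarrow> (nat \<Rightarrow> complex) \<Rightarrow> (nat \<Rightarrow> nat \<Rightarrow> complex) \<Rightarrow> complex poly" where
  "hermite m t b = (THE g. interpolates m t b g)"

lemma interpolates_hermite:
  assumes "\<And>i i' r. i < m \<Longrightarrow> i' < m \<Longrightarrow> t i = t i' \<Longrightarrow> b i r = b i' r"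
  shows "interpolates m t b (hermite m t b)"
  unfolding hermite_def by (rule theI') (rule hermite_interpolation[OF assms])

lemma hermite_eqI: "interpolates m t b g \<Longrightarrow> hermite m t b = g"
  unfolding hermite_def using interpolates_unique by blast

lemma piecewise_rational_coeff_prod:
  assumes "\<And>i k. i \<in> I \<Longrightarrow> (\<lambda>x. coeff (p i x) k) \<in> piecewise_rational C"
  shows "(\<lambda>x. coeff (\<Prod>i\<in>I. p i x) k) \<in> piecewise_rational C"
  using assms
proof (induction I arbitrary: k rule: infinite_finite_induct)
  case (insert i I)
  then show ?case
    by (simp add: coeff_mult piecewise_rational_sum piecewise_rational.mult)
qed (simp_all add: piecewise_rational.const)

lemma piecewise_rational_coeff_linear:
  assumes "f \<in> piecewise_rational C" "h \<in> piecewise_rational C"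
  shows "(\<lambda>x. coeff [:f x, h x:] k) \<in> piecewise_rational C"
proof -
  consider "k = 0" | "k = Suc 0" | k' where "k = Suc (Suc k')" by (cases k rule: nat.exhaust; cases "k - 1") auto
  then show ?thesis
    by cases (use assms in \<open>simp_all add: piecewise_rational.const\<close>)
qed

lemma piecewise_rational_coeff_linear_power:
  assumes "f \<in> piecewise_rational C"
  shows "(\<lambda>x. coeff ([:f x, 1:] ^ j) k) \<in> piecewise_rational C"
  using piecewise_rational_coeff_prod[of "{..<j}" "\<lambda>_ x. [:f x, 1:]" C k]
    piecewise_rational_coeff_linear[OF assms piecewise_rational.const]
  by simp

lemma piecewise_rational_coeff_taylor:
  assumes "\<And>x. \<forall>k\<ge>m. coeff (g x) k = 0"
    and "\<And>j. (\<lambda>x. coeff (g x) j) \<in> piecewise_rational C" "f \<in> piecewise_rational C"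
  shows "(\<lambda>x. coeff (taylor (g x) (f x)) r) \<in> piecewise_rational C"
  unfolding coeff_taylor[OF assms(1)]
  by (intro piecewise_rational_sum piecewise_rational.mult piecewise_rational_coeff_linear_power assms(2,3))

lemma piecewise_rational_det:
  assumes "\<And>i j. i < n \<Longrightarrow> j < n \<Longrightarrow> (\<lambda>x. M x i j) \<in> piecewise_rational C"
  shows "(\<lambda>x. Determinant.det (Matrix.mat n n (\<lambda>(i, j). M x i j))) \<in> piecewise_rational C"
proof -
  have "(\<lambda>x. \<Sum>p | p permutes {0..<n}. signof p * (\<Prod>i = 0..<n. M x i (p i))) \<in> piecewise_rational C"
    by (intro piecewise_rational_sum piecewise_rational.mult piecewise_rational.const
        piecewise_rational_prod assms) (auto dest: permutes_in_image)
  moreover have "Determinant.det (Matrix.mat n n (\<lambda>(i, j). M x i j))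
      = (\<Sum>p | p permutes {0..<n}. signof p * (\<Prod>i = 0..<n. M x i (p i)))" for x
    by (subst det_def'[of _ n])
      (auto intro!: sum.cong prod.cong arg_cong2[where f = "(*)"] dest: permutes_in_image)
  ultimately show ?thesis by simp
qed

lemma piecewise_rational_cofactor:
  assumes "\<And>i j. i < n \<Longrightarrow> j < n \<Longrightarrow> (\<lambda>x. M x i j) \<in> piecewise_rational C" "i < n" "j < n"
  shows "(\<lambda>x. cofactor (Matrix.mat n n (\<lambda>(i, j). M x i j)) i j) \<in> piecewise_rational C"
proof -
  have "mat_delete (Matrix.mat n n (\<lambda>(i, j). M x i j)) i j = Matrix.mat (n - 1) (n - 1)
      (\<lambda>(i', j'). M x (if i' < i then i' else Suc i') (if j' < j then j' else Suc j'))" for x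
    unfolding mat_delete_def using assms(2,3) by (intro Matrix.eq_matI) auto
  then show ?thesis
    unfolding cofactor_def
    by (auto intro!: piecewise_rational.mult piecewise_rational.const piecewise_rational_det assms(1))
qed

lemma constructible_rank:
  assumes "\<And>i. i \<le> n \<Longrightarrow> (\<lambda>x. t x i) \<in> piecewise_rational C"
  shows "constructible C (\<lambda>x. rank (t x) n = r)"
proof -
  have "of_nat (rank (t x) n) = (\<Sum>i'<n. if t x i' = t x n then 1 else 0 :: complex)" for x
    unfolding rank_def card_eq_sum of_nat_sum
    by (subst sum.inter_filter[symmetric]) (auto intro: sum.cong)
  moreover have "(\<lambda>x. \<Sum>i'<n. if t x i' = t x n then 1 else 0) \<in> piecewise_rational C"
    by (intro piecewise_rational_sum, fold constructible_def) (intro constructible_eq assms; simp)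
  ultimately have "(\<lambda>x. of_nat (rank (t x) n)) \<in> piecewise_rational C" by simp
  from constructible_eq[OF this piecewise_rational.const[of "of_nat r"]] show ?thesis by simp
qed

lemma piecewise_rational_at_rank:
  assumes t: "\<And>i. i \<le> n \<Longrightarrow> (\<lambda>x. t x i) \<in> piecewise_rational C"
    and f: "\<And>r. r \<le> n \<Longrightarrow> (\<lambda>x. f x r) \<in> piecewise_rational C"
  shows "(\<lambda>x. f x (rank (t x) n)) \<in> piecewise_rational C"
proof (rule piecewise_rational_of_nat_case[where I = "{..n}" and N = "\<lambda>x. rank (t x) n" and f = "\<lambda>r x. f x r"])
  show "rank (t x) n \<in> {..n}" for x
    using card_mono[of "{..<n}" "{i'. i' < n \<and> t x i' = t x n}"] by (auto simp: rank_def)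
qed (auto intro: constructible_rank t f)

text \<open>
  By Cramer's rule the coefficients are quotients of determinants. The shape of the matrix depends
  on coincidences among the nodes, but only through the ranks, which are constructible.
\<close>

theorem piecewise_rational_hermite:
  assumes t: "\<And>i. i < m \<Longrightarrow> (\<lambda>x. t x i) \<in> piecewise_rational C"
    and b: "\<And>i r. i < m \<Longrightarrow> (\<lambda>x. b x i r) \<in> piecewise_rational C"
    and cons: "\<And>x i i' r. i < m \<Longrightarrow> i' < m \<Longrightarrow> t x i = t x i' \<Longrightarrow> b x i r = b x i' r"
  shows "(\<lambda>x. coeff (hermite m (t x) (b x)) j) \<in> piecewise_rational C"
proof (cases "j < m")
  case False
  have "interpolates m (t x) (b x) (hermite m (t x) (b x))" for x
    by (rule interpolates_hermite) (rule cons)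
  with False have "coeff (hermite m (t x) (b x)) j = 0" for x
    unfolding interpolates_def by (meson not_less)
  then show ?thesis by (simp add: piecewise_rational.const)
next
  case True
  let ?A = "\<lambda>x. Matrix.mat m m (\<lambda>(i, j). hermite_matrix (t x) i j)"
  have matrix: "(\<lambda>x. hermite_matrix (t x) i j) \<in> piecewise_rational C" if "i < m" for i j
    unfolding hermite_matrix_def
  proof (rule piecewise_rational_at_rank[where f = "\<lambda>x r. coeff ([:t x i, 1:] ^ j) r"])
    show "(\<lambda>x. t x i') \<in> piecewise_rational C" if "i' \<le> i" for i' using that \<open>i < m\<close> by (intro t) simp
    show "(\<lambda>x. coeff ([:t x i, 1:] ^ j) r) \<in> piecewise_rational C" for r
      by (intro piecewise_rational_coeff_linear_power t \<open>i < m\<close>)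
  qed
  have rhs: "(\<lambda>x. b x i (rank (t x) i)) \<in> piecewise_rational C" if "i < m" for i
  proof (rule piecewise_rational_at_rank[where f = "\<lambda>x r. b x i r"])
    show "(\<lambda>x. t x i') \<in> piecewise_rational C" if "i' \<le> i" for i' using that \<open>i < m\<close> by (intro t) simp
    show "(\<lambda>x. b x i r) \<in> piecewise_rational C" for r by (intro b \<open>i < m\<close>)
  qed
  have "coeff (hermite m (t x) (b x)) j
      = (\<Sum>i<m. cofactor (?A x) i j * b x i (rank (t x) i)) / Determinant.det (?A x)" for x
  proof (rule cramer(2))
    let ?g = "hermite m (t x) (b x)"
    show "v j = 0" if "\<And>i. i < m \<Longrightarrow> (\<Sum>j<m. hermite_matrix (t x) i j * v j) = 0" "j < m" for v j
      using that by (rule hermite_matrix_kernel)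
    have g: "interpolates m (t x) (b x) ?g" by (rule interpolates_hermite[OF cons])
    then have "\<forall>k\<ge>m. coeff ?g k = 0" unfolding interpolates_def by blast
    from interpolates_iff_hermite_matrix[of m "t x" "b x", OF cons this] g
    show "(\<Sum>j<m. hermite_matrix (t x) i j * coeff ?g j) = b x i (rank (t x) i)" if "i < m" for i
      using that by blast
  qed (fact True)
  moreover have "(\<lambda>x. (\<Sum>i<m. cofactor (?A x) i j * b x i (rank (t x) i)) / Determinant.det (?A x))
      \<in> piecewise_rational C"
    using True
    by (intro piecewise_rational_divide piecewise_rational_sum piecewise_rational.mult
        piecewise_rational_cofactor piecewise_rational_det matrix rhs) auto
  ultimately show ?thesis by simp
qed

section \<open>The coordinates of a configuration\<close>

text \<open>
  A tuple \<open>x\<close> represents the points \<open>x 0, \<dots>, x (m - 1)\<close>, and \<open>x i j\<close> is the \<open>j\<close>-th coordinate of the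
  point \<open>x i\<close>. All other values of \<open>x\<close> are arbitrary, so that functions of tuples are defined on a whole
  type and permuting the points acts on it.
\<close>

type_synonym tuple = "nat \<Rightarrow> nat \<Rightarrow> complex"


definition same_prefix :: "nat \<Rightarrow> (nat \<Rightarrow> complex) \<Rightarrow> (nat \<Rightarrow> complex) \<Rightarrow> bool" where
  "same_prefix l p q \<longleftrightarrow> (\<forall>j<l. p j = q j)"

text \<open>
  Along the moment curve \<open>(1, a, a\<^sup>2, \<dots>)\<close> every nonzero vector of length \<open>l\<close> is annihilated by fewer
  than \<open>l\<close> of these forms, so a bounded search finds one that separates given points.
\<close>

definition linear_form :: "nat \<Rightarrow> nat \<Rightarrow> (nat \<Rightarrow> complex) \<Rightarrow> complex" where
  "linear_form a l p = (\<Sum>j<l. of_nat a ^ j * p j)"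

definition separates :: "nat \<Rightarrow> nat \<Rightarrow> tuple \<Rightarrow> nat \<Rightarrow> bool" where
  "separates m l x a \<longleftrightarrow> (\<forall>i\<in>{..<m}. \<forall>i'\<in>{..<m}.
     linear_form a l (x i) = linear_form a l (x i') \<longrightarrow> same_prefix l (x i) (x i'))"

text \<open>
  The least separating parameter depends on the unordered configuration only, which makes the
  construction invariant, and it is bounded in terms of \<open>m\<close> and \<open>l\<close>, which makes it piecewise rational.
\<close>

definition node :: "nat \<Rightarrow> nat \<Rightarrow> tuple \<Rightarrow> nat \<Rightarrow> complex" where
  "node m l x i = linear_form (LEAST a. separates m l x a) l (x i)"

lemma few_collisions:
  assumes "\<not> same_prefix l p q"
  shows "finite {a. linear_form a l p = linear_form a l q}"
    and "card {a. linear_form a l p = linear_form a l q} \<le> l"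
proof -
  \<comment> \<open>The form with parameter \<open>a\<close> takes equal values at \<open>p\<close> and \<open>q\<close> iff \<open>a\<close> is a root of \<open>P\<close>.\<close>
  define P where "P = (\<Sum>j<l. monom (p j - q j) j)"
  have coeff_P: "coeff P j = (if j < l then p j - q j else 0)" for j
    by (simp add: P_def coeff_sum)
  have "P \<noteq> 0" using assms coeff_P unfolding same_prefix_def by (metis coeff_0 eq_iff_diff_eq_0)
  have deg: "degree P \<le> l" by (rule degree_le) (simp add: coeff_P)
  have eq: "linear_form a l p = linear_form a l q \<longleftrightarrow> poly P (of_nat a) = 0" for a
    by (simp add: linear_form_def P_def poly_sum poly_monom sum_subtractf algebra_simps)
  let ?S = "{a. linear_form a l p = linear_form a l q}"
  have img: "(of_nat :: nat \<Rightarrow> complex) ` ?S \<subseteq> {z. poly P z = 0}" by (auto simp: eq)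
  have inj: "inj_on (of_nat :: nat \<Rightarrow> complex) ?S" by (simp add: inj_on_def)
  have fin: "finite {z. poly P z = 0}" using \<open>P \<noteq> 0\<close> by (rule poly_roots_finite)
  show "finite ?S" using finite_subset[OF img fin] finite_image_iff[OF inj] by simp
  have "card ?S \<le> card {z. poly P z = 0}" by (rule card_inj_on_le[OF inj img fin])
  also have "\<dots> \<le> degree P" using \<open>P \<noteq> 0\<close> by (rule card_poly_roots_bound)
  finally show "card ?S \<le> l" using deg by simp
qed

lemma separates_bounded: "\<exists>a\<le>m * m * l. separates m l x a"
proof (rule ccontr)
  assume none: "\<not> (\<exists>a\<le>m * m * l. separates m l x a)"
  let ?I = "{..<m} \<times> {..<m}"
  define bad where "bad = (\<lambda>(i, i'). if same_prefix l (x i) (x i') then {}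
    else {a. linear_form a l (x i) = linear_form a l (x i')})"
  have fin: "finite (bad p)" and card: "card (bad p) \<le> l" for p
    using few_collisions[of l "x (fst p)" "x (snd p)"] by (auto simp: bad_def split: prod.splits)
  have "{..m * m * l} \<subseteq> (\<Union>p\<in>?I. bad p)"
  proof
    fix a assume "a \<in> {..m * m * l}"
    then have "\<not> separates m l x a" using none by auto
    then obtain i i' where "i < m" "i' < m" "linear_form a l (x i) = linear_form a l (x i')"
      "\<not> same_prefix l (x i) (x i')" unfolding separates_def by auto
    then have "a \<in> bad (i, i')" "(i, i') \<in> ?I" by (auto simp: bad_def)
    then show "a \<in> (\<Union>p\<in>?I. bad p)" by blast
  qed
  then have "card {..m * m * l} \<le> card (\<Union>p\<in>?I. bad p)" by (intro card_mono) (auto intro: fin)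
  also have "\<dots> \<le> (\<Sum>p\<in>?I. card (bad p))" by (rule card_UN_le) simp
  also have "\<dots> \<le> (\<Sum>p\<in>?I. l)" by (intro sum_mono card)
  also have "\<dots> = m * m * l" by (simp add: card_cartesian_product)
  finally show False by simp
qed

lemma separates_least: "separates m l x (LEAST a. separates m l x a)"
  using separates_bounded[of m l x] by (meson LeastI)

lemma node_eq_iff:
  assumes "i < m" "i' < m"
  shows "node m l x i = node m l x i' \<longleftrightarrow> same_prefix l (x i) (x i')"
proof
  assume "node m l x i = node m l x i'"
  then show "same_prefix l (x i) (x i')"
    using separates_least[of m l x] assms unfolding separates_def node_def by blast
next
  assume "same_prefix l (x i) (x i')"
  then show "node m l x i = node m l x i'"
    unfolding node_def linear_form_def same_prefix_def by (intro sum.cong) auto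
qed

definition prefix_coords :: "nat \<Rightarrow> nat \<Rightarrow> (tuple \<Rightarrow> complex) set" where
  "prefix_coords m l = {\<lambda>x. x i j | i j. i < m \<and> j < l}"

abbreviation tuple_polynomials :: "nat \<Rightarrow> nat \<Rightarrow> (tuple \<Rightarrow> complex) set" where
  "tuple_polynomials m l \<equiv> polynomial_functions (prefix_coords m l)"

lemma prefix_coordsI: "i < m \<Longrightarrow> j < l \<Longrightarrow> (\<lambda>x. x i j) \<in> prefix_coords m l"
  unfolding prefix_coords_def by blast

lemma prefix_coords_mono: "l \<le> l' \<Longrightarrow> prefix_coords m l \<subseteq> prefix_coords m l'"
  unfolding prefix_coords_def by (blast intro: less_le_trans)

lemma piecewise_rational_point_coord:
  "i < m \<Longrightarrow> j < l \<Longrightarrow> (\<lambda>x. x i j) \<in> piecewise_rational (prefix_coords m l)"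
  by (intro piecewise_rational.coord prefix_coordsI)

lemma piecewise_rational_linear_form:
  "i < m \<Longrightarrow> (\<lambda>x. linear_form a l (x i)) \<in> piecewise_rational (prefix_coords m l)"
  unfolding linear_form_def
  by (intro piecewise_rational_sum piecewise_rational.mult piecewise_rational.const
      piecewise_rational_point_coord) auto

lemma constructible_same_prefix:
  assumes "i < m" "i' < m"
  shows "constructible (prefix_coords m l) (\<lambda>x. same_prefix l (x i) (x i'))"
proof -
  have "constructible (prefix_coords m l) (\<lambda>x. \<forall>j\<in>{..<l}. x i j = x i' j)"
    by (intro constructible_ball constructible_eq piecewise_rational_point_coord assms) auto
  then show ?thesis unfolding same_prefix_def Ball_def lessThan_iff .
qed

lemma constructible_separates: "constructible (prefix_coords m l) (\<lambda>x. separates m l x a)"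
  unfolding separates_def
  by (intro constructible_ball constructible_imp constructible_eq piecewise_rational_linear_form
      constructible_same_prefix) auto

lemma piecewise_rational_node:
  assumes "i < m"
  shows "(\<lambda>x. node m l x i) \<in> piecewise_rational (prefix_coords m l)"
  unfolding node_def
proof (rule piecewise_rational_of_nat_case[where I = "{..m * m * l}"
      and f = "\<lambda>a x. linear_form a l (x i)" and N = "\<lambda>x. LEAST a. separates m l x a"])
  show "(LEAST a. separates m l x a) \<in> {..m * m * l}" for x
    using separates_bounded[of m l x] by (auto intro: Least_le le_trans)
  show "constructible (prefix_coords m l) (\<lambda>x. (LEAST a. separates m l x a) = r)" for r
  proof -
    have "constructible (prefix_coords m l) (\<lambda>x. separates m l x r \<and> (\<forall>a\<in>{..<r}. \<not> separates m l x a))"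
      by (intro constructible_conj constructible_ball constructible_not constructible_separates) auto
    moreover have "separates m l x r \<and> (\<forall>a\<in>{..<r}. \<not> separates m l x a)
        \<longleftrightarrow> (LEAST a. separates m l x a) = r" for x
    proof
      assume *: "separates m l x r \<and> (\<forall>a\<in>{..<r}. \<not> separates m l x a)"
      show "(LEAST a. separates m l x a) = r"
        by (rule Least_equality) (use * not_le in auto)
    next
      assume least: "(LEAST a. separates m l x a) = r"
      have "\<not> separates m l x a" if "a < r" for a
        by (rule not_less_Least) (use that least in simp)
      then show "separates m l x r \<and> (\<forall>a\<in>{..<r}. \<not> separates m l x a)"
        using separates_least[of m l x] unfolding least by simp
    qed
    ultimately show ?thesis by simp
  qed
qed (auto intro: piecewise_rational_linear_form assms)

definition fibre :: "nat \<Rightarrow> nat \<Rightarrow> tuple \<Rightarrow> nat \<Rightarrow> nat set" where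
  "fibre m l x i = {i'. i' < m \<and> same_prefix l (x i') (x i)}"

definition fibre_poly :: "nat \<Rightarrow> nat \<Rightarrow> tuple \<Rightarrow> nat \<Rightarrow> complex poly" where
  "fibre_poly m l x i = (\<Prod>i'\<in>fibre m l x i. [:- x i' l, 1:])"

text \<open>
  Over the prefix of \<open>x i\<close>, the \<open>l\<close>-th coordinates of the points with this prefix are the roots of the
  monic \<open>fibre_poly m l x i\<close>. The interpolant stores its coefficients below the leading one as Taylor coefficients
  at the node of the prefix.
\<close>

definition interpolant :: "nat \<Rightarrow> nat \<Rightarrow> tuple \<Rightarrow> complex poly" where
  "interpolant m l x = hermite m (node m l x) (\<lambda>i. coeff (fibre_poly m l x i))"

definition coordinate :: "nat \<Rightarrow> nat \<Rightarrow> tuple \<Rightarrow> complex" where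
  "coordinate m k x = coeff (interpolant m (k div m) x) (k mod m)"

lemma finite_fibre: "finite (fibre m l x i)"
  by (simp add: fibre_def)

lemma fibre_cong: "same_prefix l (x i) (x i') \<Longrightarrow> fibre m l x i = fibre m l x i'"
  by (auto simp: fibre_def same_prefix_def)

lemma fibre_poly_cong:
  "i < m \<Longrightarrow> i' < m \<Longrightarrow> node m l x i = node m l x i' \<Longrightarrow> fibre_poly m l x i = fibre_poly m l x i'"
  using fibre_cong[of l x i i' m] by (simp add: node_eq_iff fibre_poly_def)

lemma interpolates_interpolant:
  "interpolates m (node m l x) (\<lambda>i. coeff (fibre_poly m l x i)) (interpolant m l x)"
  unfolding interpolant_def
proof (rule interpolates_hermite)
  show "coeff (fibre_poly m l x i) r = coeff (fibre_poly m l x i') r"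
    if "i < m" "i' < m" "node m l x i = node m l x i'" for i i' r
    using fibre_poly_cong[OF that] by simp
qed

lemma multiplicity_at_node: "i < m \<Longrightarrow> multiplicity_at m (node m l x) i = card (fibre m l x i)"
  unfolding multiplicity_at_def fibre_def
  by (rule arg_cong[where f = card], rule Collect_cong) (use node_eq_iff in blast)

lemma coeff_interpolant_eq_0: "k \<ge> m \<Longrightarrow> coeff (interpolant m l x) k = 0"
  using interpolates_interpolant[of m l x] unfolding interpolates_def by blast

lemma degree_fibre_poly: "degree (fibre_poly m l x i) = card (fibre m l x i)"
  unfolding fibre_poly_def by (subst degree_prod_eq_sum_degree) auto

lemma lead_coeff_fibre_poly: "coeff (fibre_poly m l x i) (card (fibre m l x i)) = 1"
  using degree_fibre_poly[of m l x i] lead_coeff_prod[of "\<lambda>i'. [:- x i' l, 1:]" "fibre m l x i"]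
  by (simp add: fibre_poly_def)

lemma coeff_fibre_poly:
  assumes "i < m" "r < card (fibre m l x i)"
  shows "coeff (fibre_poly m l x i) r = coeff (taylor (interpolant m l x) (node m l x i)) r"
  using interpolates_interpolant[of m l x] assms multiplicity_at_node[of i m l x]
  by (simp add: interpolates_def)

lemma piecewise_rational_fibre_poly:
  assumes "i < m"
  shows "(\<lambda>x. coeff (fibre_poly m l x i) r) \<in> piecewise_rational (prefix_coords m (Suc l))"
proof -
  let ?p = "\<lambda>i' x. if same_prefix l (x i') (x i) then [:- x i' l, 1:] else 1"
  have "(\<lambda>x. coeff (?p i' x) k) \<in> piecewise_rational (prefix_coords m (Suc l))" if "i' < m" for i' k
  proof -
    have "constructible (prefix_coords m (Suc l)) (\<lambda>x. same_prefix l (x i') (x i))"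
      using constructible_same_prefix[OF that assms, of l]
        piecewise_rational_mono[OF prefix_coords_mono[of l "Suc l" m]]
      unfolding constructible_def by simp
    moreover have "(\<lambda>x. coeff [:- x i' l, 1:] k) \<in> piecewise_rational (prefix_coords m (Suc l))"
      using that
      by (intro piecewise_rational_coeff_linear piecewise_rational_uminus piecewise_rational.const
          piecewise_rational_point_coord) auto
    ultimately have "(\<lambda>x. if same_prefix l (x i') (x i) then coeff [:- x i' l, 1:] k else coeff 1 k)
        \<in> piecewise_rational (prefix_coords m (Suc l))"
      by (intro piecewise_rational_if piecewise_rational.const)
    then show ?thesis unfolding if_distrib[of "\<lambda>p. coeff p k"] .
  qed
  then have "(\<lambda>x. coeff (\<Prod>i'<m. ?p i' x) r) \<in> piecewise_rational (prefix_coords m (Suc l))"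
    by (intro piecewise_rational_coeff_prod) auto
  moreover have "(\<Prod>i'<m. ?p i' x) = fibre_poly m l x i" for x
    unfolding fibre_poly_def fibre_def
    by (subst prod.inter_filter[symmetric]) (auto intro: prod.cong)
  ultimately show ?thesis by simp
qed

lemma piecewise_rational_interpolant:
  "(\<lambda>x. coeff (interpolant m l x) j) \<in> piecewise_rational (prefix_coords m (Suc l))"
  unfolding interpolant_def
proof (rule piecewise_rational_hermite[where b = "\<lambda>x i. coeff (fibre_poly m l x i)"])
  show "(\<lambda>x. node m l x i) \<in> piecewise_rational (prefix_coords m (Suc l))" if "i < m" for i
    using piecewise_rational_mono[OF prefix_coords_mono[of l "Suc l" m] piecewise_rational_node[OF that]] by simp
  show "(\<lambda>x. coeff (fibre_poly m l x i) r) \<in> piecewise_rational (prefix_coords m (Suc l))" if "i < m" for i r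
    using that by (rule piecewise_rational_fibre_poly)
  show "coeff (fibre_poly m l x i) r = coeff (fibre_poly m l x i') r"
    if "i < m" "i' < m" "node m l x i = node m l x i'" for x i i' r
    using fibre_poly_cong[OF that] by simp
qed

lemma piecewise_rational_coordinate:
  assumes "k < m * n"
  shows "coordinate m k \<in> piecewise_rational (prefix_coords m n)"
proof -
  have "Suc (k div m) \<le> n" using assms by (simp add: less_mult_imp_div_less mult.commute Suc_leI)
  from piecewise_rational_mono[OF prefix_coords_mono[OF this] piecewise_rational_interpolant]
  show ?thesis unfolding coordinate_def[abs_def] .
qed

lemma piecewise_rational_cong:
  assumes "f \<in> piecewise_rational C" "\<And>c. c \<in> C \<Longrightarrow> c x = c y"
  shows "f x = f y"
  using assms(1) by induction (auto simp: assms(2))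

text \<open>
  The interpolant is a function of the coordinates \<open>x i j\<close> with \<open>i < m\<close> and \<open>j \<le> l\<close>, since its
  coefficients are piecewise rational in them.
\<close>

lemma interpolant_local:
  assumes "\<And>i j. i < m \<Longrightarrow> j \<le> l \<Longrightarrow> x i j = y i j"
  shows "interpolant m l x = interpolant m l y"
proof (rule poly_eqI)
  fix j show "coeff (interpolant m l x) j = coeff (interpolant m l y) j"
    by (rule piecewise_rational_cong[OF piecewise_rational_interpolant])
      (auto simp: prefix_coords_def less_Suc_eq_le assms)
qed

section \<open>Invariance under relabelling the points\<close>

lemma bij_betw_permutes_Collect:
  assumes "\<sigma> permutes {..<m}"
  shows "bij_betw \<sigma> {i. i < m \<and> P (\<sigma> i)} {i. i < m \<and> P i}"
proof (rule bij_betwI[where g = "inv_into UNIV \<sigma>"])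
  show "\<sigma> \<in> {i. i < m \<and> P (\<sigma> i)} \<rightarrow> {i. i < m \<and> P i}"
    using permutes_in_image[OF assms] by auto
  show "inv_into UNIV \<sigma> \<in> {i. i < m \<and> P i} \<rightarrow> {i. i < m \<and> P (\<sigma> i)}"
    using permutes_in_image[OF permutes_inv[OF assms]] permutes_inverses[OF assms] by auto
qed (auto simp: permutes_inverses[OF assms])

lemma interpolates_permute:
  assumes "\<sigma> permutes {..<m}" "interpolates m t b g"
  shows "interpolates m (t \<circ> \<sigma>) (b \<circ> \<sigma>) g"
proof -
  have "multiplicity_at m (t \<circ> \<sigma>) i = multiplicity_at m t (\<sigma> i)" for i
    unfolding multiplicity_at_def
    using bij_betw_same_card[OF bij_betw_permutes_Collect[OF assms(1), of "\<lambda>i'. t i' = t (\<sigma> i)"]] by simp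
  then show ?thesis
    using assms(2) permutes_in_image[OF assms(1)] by (simp add: interpolates_def)
qed

lemma separates_permute:
  assumes "\<sigma> permutes {..<m}"
  shows "separates m l (x \<circ> \<sigma>) a \<longleftrightarrow> separates m l x a"
proof -
  have "separates m l (x \<circ> \<sigma>) a \<longleftrightarrow> (\<forall>i\<in>\<sigma> ` {..<m}. \<forall>i'\<in>\<sigma> ` {..<m}.
     linear_form a l (x i) = linear_form a l (x i') \<longrightarrow> same_prefix l (x i) (x i'))"
    unfolding separates_def by simp
  then show ?thesis unfolding permutes_image[OF assms] separates_def .
qed

lemma interpolant_permute:
  assumes "\<sigma> permutes {..<m}"
  shows "interpolant m l (x \<circ> \<sigma>) = interpolant m l x"
proof -
  have node: "node m l (x \<circ> \<sigma>) = node m l x \<circ> \<sigma>"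
    by (simp add: fun_eq_iff node_def separates_permute[OF assms])
  have "bij_betw \<sigma> (fibre m l (x \<circ> \<sigma>) i) (fibre m l x (\<sigma> i))" for i
    unfolding fibre_def
    using bij_betw_permutes_Collect[OF assms, of "\<lambda>i'. same_prefix l (x i') (x (\<sigma> i))"] by simp
  then have "fibre_poly m l (x \<circ> \<sigma>) i = fibre_poly m l x (\<sigma> i)" for i
    unfolding fibre_poly_def by (subst prod.reindex_bij_betw[symmetric]) (auto simp: o_def)
  then have "(\<lambda>i. coeff (fibre_poly m l (x \<circ> \<sigma>) i)) = (\<lambda>i. coeff (fibre_poly m l x i)) \<circ> \<sigma>"
    by (simp add: fun_eq_iff)
  then show ?thesis
    using interpolates_permute[OF assms interpolates_interpolant[of m l x]]
    unfolding interpolant_def[of m l "x \<circ> \<sigma>"] node by (intro hermite_eqI) simp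
qed

text \<open>
  The group acts on all functions on \<open>nat\<close>; permutations fix the indices from \<open>m\<close> on.
\<close>

definition index_permutations :: "nat \<Rightarrow> ((nat \<Rightarrow> 'b) \<Rightarrow> (nat \<Rightarrow> 'b)) set" where
  "index_permutations m = (\<lambda>\<sigma> x. x \<circ> \<sigma>) ` {\<sigma>. \<sigma> permutes {..<m}}"

interpretation relabelling: finite_transformation_group "index_permutations m" for m
proof
  show "finite (index_permutations m)"
    unfolding index_permutations_def by (simp add: finite_permutations)
  show "id \<in> index_permutations m"
    unfolding index_permutations_def by (rule image_eqI[of _ _ id]) (auto simp: permutes_id)
  show "g \<circ> h \<in> index_permutations m" if gh: "g \<in> index_permutations m" "h \<in> index_permutations m"
    for g h :: "(nat \<Rightarrow> 'a) \<Rightarrow> nat \<Rightarrow> 'a"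
  proof -
    obtain \<sigma> \<tau> where "\<sigma> permutes {..<m}" "g = (\<lambda>x. x \<circ> \<sigma>)" "\<tau> permutes {..<m}" "h = (\<lambda>x. x \<circ> \<tau>)"
      using gh unfolding index_permutations_def by auto
    then show ?thesis unfolding index_permutations_def
      by (intro image_eqI[of _ _ "\<tau> \<circ> \<sigma>"]) (auto simp: permutes_compose fun_eq_iff)
  qed
  show "surj g" if g: "g \<in> index_permutations m" for g :: "(nat \<Rightarrow> 'a) \<Rightarrow> nat \<Rightarrow> 'a"
  proof -
    obtain \<sigma> where "\<sigma> permutes {..<m}" "g = (\<lambda>x. x \<circ> \<sigma>)"
      using g unfolding index_permutations_def by auto
    then have "g (y \<circ> inv_into UNIV \<sigma>) = y" for y by (simp add: comp_assoc permutes_inv_o)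
    then show ?thesis by (rule surjI[where f = "\<lambda>y. y \<circ> inv_into UNIV \<sigma>"])
  qed
qed

lemma relabelling_invariant_iff:
  "relabelling.invariant m f \<longleftrightarrow> (\<forall>\<sigma> x. \<sigma> permutes {..<m} \<longrightarrow> f (x \<circ> \<sigma>) = f x)"
  unfolding relabelling.invariant_def unfolding index_permutations_def by auto

lemma relabelling_reynolds:
  fixes f :: "tuple \<Rightarrow> complex"
  shows "relabelling.reynolds m f x = (\<Sum>\<sigma> | \<sigma> permutes {..<m}. f (x \<circ> \<sigma>))"
proof -
  have "inj_on (\<lambda>\<sigma> (x :: nat \<Rightarrow> nat \<Rightarrow> complex). x \<circ> \<sigma>) {\<sigma>. \<sigma> permutes {..<m}}"
  proof (rule inj_onI, rule ext)
    fix \<sigma> \<tau> :: "nat \<Rightarrow> nat" and i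
    assume "(\<lambda>x :: nat \<Rightarrow> nat \<Rightarrow> complex. x \<circ> \<sigma>) = (\<lambda>x. x \<circ> \<tau>)"
    from fun_cong[OF this, of "\<lambda>i j. of_nat i"] show "\<sigma> i = \<tau> i" by (simp add: fun_eq_iff)
  qed
  then show ?thesis unfolding relabelling.reynolds_def unfolding index_permutations_def
    by (simp add: sum.reindex)
qed

lemma coordinate_invariant: "relabelling.invariant m (coordinate m k)"
  unfolding relabelling_invariant_iff coordinate_def by (simp add: interpolant_permute)

section \<open>Power sums in terms of the coordinates\<close>

lemma of_nat_card_fibre:
  "(of_nat (card (fibre m l x i)) :: complex) = (\<Sum>i'<m. if same_prefix l (x i') (x i) then 1 else 0)"
  unfolding fibre_def card_eq_sum of_nat_sum
  by (subst sum.inter_filter[symmetric]) (auto intro: sum.cong)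

lemma piecewise_rational_card_fibre:
  assumes "i < m"
  shows "(\<lambda>x. of_nat (card (fibre m l x i))) \<in> piecewise_rational (prefix_coords m l)"
  unfolding of_nat_card_fibre
  by (intro piecewise_rational_sum, fold constructible_def) (intro constructible_same_prefix assms; simp)

lemma constructible_card_fibre:
  assumes "i < m"
  shows "constructible (prefix_coords m l) (\<lambda>x. card (fibre m l x i) = r)"
  using constructible_eq[OF piecewise_rational_card_fibre[OF assms] piecewise_rational.const[of "of_nat r"]]
  by simp

text \<open>
  In these terms the \<open>l\<close>-th coordinates are known up to the ordering of points with the same
  prefix, while the prefixes are still ordered.
\<close>

definition level_data :: "nat \<Rightarrow> nat \<Rightarrow> (tuple \<Rightarrow> complex) set" where
  "level_data m l = prefix_coords m l \<union> (\<lambda>j x. coeff (interpolant m l x) j) ` {..<m}"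

lemma piecewise_rational_level_data:
  "f \<in> piecewise_rational (prefix_coords m l) \<Longrightarrow> f \<in> piecewise_rational (level_data m l)"
  by (rule piecewise_rational_mono) (auto simp: level_data_def)

lemma piecewise_rational_taylor_interpolant:
  assumes "i < m"
  shows "(\<lambda>x. coeff (taylor (interpolant m l x) (node m l x i)) r) \<in> piecewise_rational (level_data m l)"
proof (rule piecewise_rational_coeff_taylor[where m = m])
  show "\<forall>k\<ge>m. coeff (interpolant m l x) k = 0" for x by (simp add: coeff_interpolant_eq_0)
  show "(\<lambda>x. coeff (interpolant m l x) j) \<in> piecewise_rational (level_data m l)" for j
  proof (cases "j < m")
    case True
    then show ?thesis by (intro piecewise_rational.coord) (auto simp: level_data_def)
  next
    case False
    then show ?thesis by (simp add: coeff_interpolant_eq_0 piecewise_rational.const)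
  qed
  show "(\<lambda>x. node m l x i) \<in> piecewise_rational (level_data m l)"
    by (intro piecewise_rational_level_data piecewise_rational_node assms)
qed

text \<open>
  The leading coefficient \<open>1\<close> of \<open>fibre_poly\<close> is not recorded by the interpolant and has to be
  supplied; after reversal it is the constant coefficient.
\<close>

lemma coeff_reflected_fibre_poly:
  assumes "i < m"
  shows "coeff (\<Prod>i'\<in>fibre m l x i. [:1, - x i' l:]) s =
    (if card (fibre m l x i) < s then 0 else if s = 0 then 1
     else coeff (taylor (interpolant m l x) (node m l x i)) (card (fibre m l x i) - s))"
proof -
  have "reflect_poly [:- y, 1:] = [:1, - y:]" for y :: complex
    by (simp add: reflect_poly_def)
  then have "(\<Prod>i'\<in>fibre m l x i. [:1, - x i' l:]) = reflect_poly (fibre_poly m l x i)"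
    unfolding fibre_poly_def reflect_poly_prod by simp
  then have "coeff (\<Prod>i'\<in>fibre m l x i. [:1, - x i' l:]) s = (if card (fibre m l x i) < s then 0
      else coeff (fibre_poly m l x i) (card (fibre m l x i) - s))"
    by (simp add: coeff_reflect_poly degree_fibre_poly)
  then show ?thesis
    using coeff_fibre_poly[OF assms, of "card (fibre m l x i) - s" l x] lead_coeff_fibre_poly[of m l x i]
    by auto
qed

lemma piecewise_rational_fibre_power_sum:
  assumes i: "i < m"
  shows "(\<lambda>x. \<Sum>i'\<in>fibre m l x i. x i' l ^ b) \<in> piecewise_rational (level_data m l)"
proof (induction b rule: less_induct)
  case (less b)
  let ?M = "\<lambda>x. card (fibre m l x i)" and ?f = "\<lambda>x. \<Prod>i'\<in>fibre m l x i. [:1, - x i' l:]"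
  have coeff: "(\<lambda>x. coeff (?f x) s) \<in> piecewise_rational (level_data m l)" for s
    unfolding coeff_reflected_fibre_poly[OF i]
  proof (rule piecewise_rational_of_nat_case[where I = "{..m}" and N = ?M and
      f = "\<lambda>M x. if M < s then 0 else if s = 0 then 1
        else coeff (taylor (interpolant m l x) (node m l x i)) (M - s)"])
    show "?M x \<in> {..m}" for x
      using card_mono[of "{..<m}" "fibre m l x i"] by (auto simp: fibre_def)
    show "constructible (level_data m l) (\<lambda>x. ?M x = r)" for r
      using constructible_card_fibre[OF i, of l r] piecewise_rational_level_data
      unfolding constructible_def by blast
    show "(\<lambda>x. if r < s then 0 else if s = 0 then 1
        else coeff (taylor (interpolant m l x) (node m l x i)) (r - s)) \<in> piecewise_rational (level_data m l)" for r
      by (cases "r < s"; cases "s = 0")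
        (simp_all add: piecewise_rational.const piecewise_rational_taylor_interpolant[OF i])
  qed simp
  have card: "(\<lambda>x. of_nat (?M x)) \<in> piecewise_rational (level_data m l)"
    by (intro piecewise_rational_level_data piecewise_rational_card_fibre i)
  have "(\<lambda>x. (of_nat (?M x) - of_nat b) * coeff (?f x) b
      - (\<Sum>s<b. (\<Sum>i'\<in>fibre m l x i. x i' l ^ s) * coeff (?f x) (b - s))) \<in> piecewise_rational (level_data m l)"
    by (intro piecewise_rational_diff piecewise_rational.mult piecewise_rational_sum
        piecewise_rational.const coeff card less.IH) simp
  moreover have "(\<Sum>i'\<in>fibre m l x i. x i' l ^ b) = (of_nat (?M x) - of_nat b) * coeff (?f x) b
      - (\<Sum>s<b. (\<Sum>i'\<in>fibre m l x i. x i' l ^ s) * coeff (?f x) (b - s))" for x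
    by (rule newton_identity[OF finite_fibre])
  ultimately show ?case by presburger
qed

text \<open>
  If a sum over all points is replaced by a sum of fibre sums, every point is counted once for each
  point of its fibre.
\<close>

lemma power_sum_via_fibres:
  assumes G: "\<And>p q. same_prefix l p q \<Longrightarrow> G p = (G q :: complex)"
  shows "(\<Sum>i<m. G (x i) * x i l ^ b) =
    (\<Sum>i<m. G (x i) * (\<Sum>i'\<in>fibre m l x i. x i' l ^ b) / of_nat (card (fibre m l x i)))"
proof -
  let ?same = "\<lambda>i i'. same_prefix l (x i) (x i')" and ?M = "\<lambda>i. of_nat (card (fibre m l x i)) :: complex"
  have sym: "?same i i' \<longleftrightarrow> ?same i' i" for i i' by (auto simp: same_prefix_def)
  have "(\<Sum>i<m. G (x i) * (\<Sum>i'\<in>fibre m l x i. x i' l ^ b) / ?M i)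
      = (\<Sum>i<m. \<Sum>i'<m. if ?same i' i then G (x i') * x i' l ^ b / ?M i' else 0)"
  proof (rule sum.cong[OF refl])
    fix i
    have "(\<Sum>i'<m. if ?same i' i then G (x i') * x i' l ^ b / ?M i' else 0)
        = (\<Sum>i'\<in>fibre m l x i. G (x i') * x i' l ^ b / ?M i')"
      unfolding fibre_def by (subst sum.inter_filter[symmetric]) (auto intro: sum.cong)
    also have "\<dots> = (\<Sum>i'\<in>fibre m l x i. G (x i) * x i' l ^ b / ?M i)"
    proof (rule sum.cong[OF refl])
      fix i' assume "i' \<in> fibre m l x i"
      then have "?same i' i" by (simp add: fibre_def)
      with G[OF this] fibre_cong[OF this] show "G (x i') * x i' l ^ b / ?M i' = G (x i) * x i' l ^ b / ?M i"
        by simp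
    qed
    finally show "G (x i) * (\<Sum>i'\<in>fibre m l x i. x i' l ^ b) / ?M i
        = (\<Sum>i'<m. if ?same i' i then G (x i') * x i' l ^ b / ?M i' else 0)"
      by (simp add: sum_distrib_left sum_divide_distrib)
  qed
  also have "\<dots> = (\<Sum>i'<m. \<Sum>i<m. if ?same i' i then G (x i') * x i' l ^ b / ?M i' else 0)"
    by (rule sum.swap)
  also have "\<dots> = (\<Sum>i'<m. G (x i') * x i' l ^ b)"
  proof (rule sum.cong[OF refl])
    fix i' assume "i' \<in> {..<m}"
    then have "i' \<in> fibre m l x i'" by (simp add: fibre_def same_prefix_def)
    then have "card (fibre m l x i') \<noteq> 0" using finite_fibre[of m l x i'] by auto
    moreover have "(\<Sum>i<m. if ?same i' i then G (x i') * x i' l ^ b / ?M i' else 0)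
        = (\<Sum>i<m. if ?same i i' then 1 else 0) * (G (x i') * x i' l ^ b / ?M i')"
      unfolding sum_distrib_right by (intro sum.cong) (auto simp: sym)
    ultimately show "(\<Sum>i<m. if ?same i' i then G (x i') * x i' l ^ b / ?M i' else 0)
        = G (x i') * x i' l ^ b"
      unfolding of_nat_card_fibre[symmetric] by simp
  qed
  finally show ?thesis by simp
qed

abbreviation point_polynomials :: "nat \<Rightarrow> ((nat \<Rightarrow> complex) \<Rightarrow> complex) set" where
  "point_polynomials l \<equiv> polynomial_functions ((\<lambda>j p. p j) ` {..<l})"

lemma point_polynomial_same_prefix:
  assumes "F \<in> point_polynomials l" "same_prefix l p q"
  shows "F p = F q"
  using piecewise_rational_cong[OF polynomial_imp_piecewise_rational[OF assms(1)], of p q] assms(2)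
  by (auto simp: same_prefix_def)

definition pointwise_products :: "nat \<Rightarrow> nat \<Rightarrow> (tuple \<Rightarrow> complex) set" where
  "pointwise_products m l = {\<lambda>x. \<Prod>i<m. F i (x i) | F. \<forall>i. F i \<in> point_polynomials l}"

lemma pointwise_productsI:
  "(\<And>i. F i \<in> point_polynomials l) \<Longrightarrow> (\<lambda>x. \<Prod>i<m. F i (x i)) \<in> pointwise_products m l"
  unfolding pointwise_products_def by blast

definition power_sum :: "nat \<Rightarrow> ('b \<Rightarrow> complex) \<Rightarrow> (nat \<Rightarrow> 'b) \<Rightarrow> complex" where
  "power_sum m F x = (\<Sum>i<m. F (x i))"

text \<open>
  The monomials in the ordered coordinates are products of functions of single points, and their
  averages are polynomials in power sums.
\<close>

lemma descent_to_power_sums: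
  assumes R: "\<And>f. f \<in> piecewise_rational R \<Longrightarrow> f \<in> R"
    and inv_R: "\<And>f. f \<in> R \<Longrightarrow> relabelling.invariant m f"
    and power_sums: "\<And>F. F \<in> point_polynomials l \<Longrightarrow> power_sum m F \<in> R"
    and f: "f \<in> piecewise_rational (prefix_coords m l \<union> R)" "relabelling.invariant m f"
  shows "f \<in> R"
proof (rule relabelling.piecewise_rational_descent[where K = "pointwise_products m l"])
  show one: "(\<lambda>_. 1) \<in> pointwise_products m l"
    using pointwise_productsI[of "\<lambda>_ _. 1" l m] by (simp add: polynomial_functions.const)
  show "(\<lambda>x. a x * b x) \<in> pointwise_products m l"
    if ab: "a \<in> pointwise_products m l" "b \<in> pointwise_products m l" for a b
  proof -
    from ab obtain F H where F: "a = (\<lambda>x. \<Prod>i<m. F i (x i))" "\<And>i. F i \<in> point_polynomials l"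
      and H: "b = (\<lambda>x. \<Prod>i<m. H i (x i))" "\<And>i. H i \<in> point_polynomials l"
      unfolding pointwise_products_def by blast
    have "(\<lambda>x. \<Prod>i<m. (\<lambda>p. F i p * H i p) (x i)) \<in> pointwise_products m l"
      by (rule pointwise_productsI) (intro polynomial_functions.mult F H)
    then show ?thesis by (simp add: F(1) H(1) prod.distrib)
  qed
  show "(\<lambda>x. a (g x)) \<in> pointwise_products m l"
    if a: "a \<in> pointwise_products m l" and g: "g \<in> index_permutations m" for a g
  proof -
    from a obtain F where F: "a = (\<lambda>x. \<Prod>i<m. F i (x i))" "\<And>i. F i \<in> point_polynomials l"
      unfolding pointwise_products_def by blast
    from g obtain \<sigma> where \<sigma>: "\<sigma> permutes {..<m}" "g = (\<lambda>x. x \<circ> \<sigma>)"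
      unfolding index_permutations_def by blast
    have "(\<lambda>x. \<Prod>i<m. F (inv_into UNIV \<sigma> i) (x i)) \<in> pointwise_products m l"
      by (rule pointwise_productsI) (rule F)
    moreover have "a (g x) = (\<Prod>i<m. F (inv_into UNIV \<sigma> i) (x i))" for x
      unfolding F(1) \<sigma>(2)
      by (subst prod.permute[OF \<sigma>(1)]) (simp add: o_def permutes_inverses[OF \<sigma>(1)])
    ultimately show ?thesis by simp
  qed
  show "relabelling.reynolds m a \<in> R" if a: "a \<in> pointwise_products m l" for a
  proof -
    from a obtain F where F: "a = (\<lambda>x. \<Prod>i<m. F i (x i))" "\<And>i. F i \<in> point_polynomials l"
      unfolding pointwise_products_def by blast
    have "(\<lambda>x. \<Sum>\<sigma> | \<sigma> permutes {..<m}. \<Prod>i<m. F i (x (\<sigma> i))) \<in> R"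
      by (rule symmetrized_product_in_power_sum_algebra[where \<F> = "point_polynomials l"])
        (fact R polynomial_functions.mult power_sums[unfolded power_sum_def[abs_def]] F)+
    moreover have "relabelling.reynolds m a = (\<lambda>x. \<Sum>\<sigma> | \<sigma> permutes {..<m}. \<Prod>i<m. F i (x (\<sigma> i)))"
      by (rule ext) (simp add: relabelling_reynolds F(1))
    ultimately show ?thesis by simp
  qed
  show "prefix_coords m l \<union> R \<subseteq> combinations R (pointwise_products m l)"
  proof (intro Un_least subsetI)
    fix c :: "tuple \<Rightarrow> complex" assume "c \<in> prefix_coords m l"
    then obtain i j where ij: "i < m" "j < l" "c = (\<lambda>x. x i j)" unfolding prefix_coords_def by blast
    let ?F = "\<lambda>i'. if i' = i then (\<lambda>p. p j) else (\<lambda>_. 1 :: complex)"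
    have "(\<lambda>x. \<Prod>i'<m. ?F i' (x i')) \<in> pointwise_products m l"
    proof (rule pointwise_productsI)
      show "?F i' \<in> point_polynomials l" for i'
        using ij(2) by (simp add: polynomial_functions.const polynomial_functions.coord)
    qed
    moreover have "(\<Prod>i'<m. ?F i' (x i')) = c x" for x
    proof -
      have "(\<Prod>i'<m. ?F i' (x i')) = (\<Prod>i'<m. if i' = i then x i j else 1)" by (intro prod.cong) auto
      then show ?thesis using ij by simp
    qed
    ultimately have "c \<in> pointwise_products m l" by simp
    from combinations.product[OF R[OF piecewise_rational.const[of 1]] this]
    show "c \<in> combinations R (pointwise_products m l)" by simp
  next
    fix c assume "c \<in> R"
    from combinations.product[OF this one] show "c \<in> combinations R (pointwise_products m l)" by simp
  qed
  show "h \<in> R" if "h \<in> piecewise_rational R" for h using that by (rule R)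
  show "relabelling.invariant m h" if "h \<in> R" for h using that by (rule inv_R)
  show "f \<in> piecewise_rational (prefix_coords m l \<union> R)" by (rule f(1))
  show "relabelling.invariant m f" by (rule f(2))
qed

definition coordinate_field :: "nat \<Rightarrow> nat \<Rightarrow> (tuple \<Rightarrow> complex) set" where
  "coordinate_field m l = piecewise_rational (coordinate m ` {..<m * l})"

lemma coordinate_field_closed: "f \<in> piecewise_rational (coordinate_field m l) \<Longrightarrow> f \<in> coordinate_field m l"
  unfolding coordinate_field_def by (erule piecewise_rational_trans) simp

lemma coordinate_field_invariant:
  assumes "f \<in> coordinate_field m l" shows "relabelling.invariant m f"
  unfolding relabelling_invariant_iff
proof (intro allI impI)
  fix \<sigma> and x :: tuple assume "\<sigma> permutes {..<m}"
  then show "f (x \<circ> \<sigma>) = f x"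
    using coordinate_invariant[of m]
    by (intro piecewise_rational_cong[OF assms[unfolded coordinate_field_def]])
      (auto simp: relabelling_invariant_iff)
qed

lemma interpolant_in_coordinate_field:
  assumes "j < m" shows "(\<lambda>x. coeff (interpolant m l x) j) \<in> coordinate_field m (Suc l)"
proof -
  have "coordinate m (m * l + j) = (\<lambda>x. coeff (interpolant m l x) j)"
    using assms by (simp add: coordinate_def fun_eq_iff)
  then show ?thesis
    using assms unfolding coordinate_field_def
    by (metis add.commute imageI lessThan_iff mult_Suc_right nat_add_left_cancel_less piecewise_rational.coord)
qed

lemma point_polynomial_Suc:
  assumes "F \<in> point_polynomials (Suc l)"
  shows "F \<in> combinations (point_polynomials l) (range (\<lambda>b p. p l ^ b))"
  using assms
proof induction
  case (const a)
  from combinations.product[OF polynomial_functions.const[of a] rangeI[of "\<lambda>b p. p l ^ b" 0]] show ?case by simp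
next
  case (coord c)
  then obtain j where j: "j < Suc l" "c = (\<lambda>p. p j)" by auto
  show ?case
  proof (cases "j = l")
    case True
    from combinations.product[OF polynomial_functions.const[of 1] rangeI[of "\<lambda>b p. p l ^ b" 1]]
    show ?thesis using True j by simp
  next
    case False
    then have "c \<in> point_polynomials l" using j by (intro polynomial_functions.coord) auto
    from combinations.product[OF this rangeI[of "\<lambda>b p. p l ^ b" 0]] show ?thesis by simp
  qed
next
  case (add p q) show ?case by (intro combinations.add add.IH)
next
  case (mult p q)
  have powers: "(\<lambda>x. a x * b x) \<in> range (\<lambda>b p. p l ^ b)"
    if ab: "a \<in> range (\<lambda>b p. p l ^ b)" "b \<in> range (\<lambda>b p. p l ^ b)" for a b :: "(nat \<Rightarrow> complex) \<Rightarrow> complex"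
  proof -
    from ab obtain s t where "a = (\<lambda>p. p l ^ s)" "b = (\<lambda>p. p l ^ t)" by auto
    then have "(\<lambda>x. a x * b x) = (\<lambda>p. p l ^ (s + t))" by (simp add: power_add)
    then show ?thesis by blast
  qed
  from polynomial_functions.mult powers mult.IH show ?case by (rule combinations_mult)
qed

text \<open>
  Induction on \<open>l\<close>. In the step it suffices to consider \<open>F = G\<cdot>p\<^sub>l\<^sup>b\<close> with \<open>G\<close> a polynomial in the first \<open>l\<close>
  coordinates. By Newton's identities this power sum is piecewise rational in the ordered prefixes and the
  coordinates of block \<open>l\<close>. It does not depend on the ordering, so by descent it is piecewise rational
  in that block and in invariants of the prefixes, which are covered by the induction hypothesis.
\<close>

theorem power_sum_in_coordinate_field:
  "F \<in> point_polynomials l \<Longrightarrow> power_sum m F \<in> coordinate_field m l"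
proof (induction l arbitrary: F)
  case 0
  have "F p = F (\<lambda>_. 0)" for p
    by (rule point_polynomial_same_prefix[OF 0]) (simp add: same_prefix_def)
  then have "power_sum m F = (\<lambda>x. \<Sum>i<m. F (\<lambda>_. 0))"
    unfolding power_sum_def by (intro ext sum.cong refl)
  then show ?case unfolding coordinate_field_def by (simp only: piecewise_rational.const)
next
  case (Suc l)
  let ?R = "coordinate_field m (Suc l)"
  have mono: "coordinate_field m l \<subseteq> ?R"
    unfolding coordinate_field_def by (auto intro!: piecewise_rational_mono[of "coordinate m ` {..<m * l}"])
  from point_polynomial_Suc[OF Suc.prems] show ?case
  proof induction
    case (product G h)
    then obtain b where h: "h = (\<lambda>p. p l ^ b)" by blast
    let ?Q = "\<lambda>x. \<Sum>i<m. G (x i) * x i l ^ b"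
    have G: "(\<lambda>x. G (x i)) \<in> piecewise_rational (prefix_coords m l)" if "i < m" for i
    proof (rule polynomial_imp_piecewise_rational, rule polynomial_functions_subst[OF product(1)])
      fix c :: "(nat \<Rightarrow> complex) \<Rightarrow> complex" assume "c \<in> (\<lambda>j p. p j) ` {..<l}"
      then obtain j where "j < l" "c = (\<lambda>p. p j)" by auto
      then show "(\<lambda>x. c (x i)) \<in> tuple_polynomials m l"
        using prefix_coordsI[OF that, of j l] by (simp add: polynomial_functions.coord)
    qed
    \<comment> \<open>Before descent: the prefixes are ordered, the coordinates of block \<open>l\<close> are not.\<close>
    have Q_level: "?Q \<in> piecewise_rational (level_data m l)"
    proof -
      have "(\<lambda>x. \<Sum>i<m. G (x i) * (\<Sum>i'\<in>fibre m l x i. x i' l ^ b) / of_nat (card (fibre m l x i)))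
          \<in> piecewise_rational (level_data m l)"
        by (intro piecewise_rational_sum piecewise_rational_divide piecewise_rational.mult
            piecewise_rational_fibre_power_sum piecewise_rational_level_data
            piecewise_rational_card_fibre G) auto
      moreover have "?Q = (\<lambda>x. \<Sum>i<m. G (x i) * (\<Sum>i'\<in>fibre m l x i. x i' l ^ b) / of_nat (card (fibre m l x i)))"
        by (rule ext, rule power_sum_via_fibres) (rule point_polynomial_same_prefix[OF product(1)])
      ultimately show ?thesis by (simp only:)
    qed
    have "level_data m l \<subseteq> prefix_coords m l \<union> ?R"
      using interpolant_in_coordinate_field[of _ m l] by (auto simp: level_data_def)
    from piecewise_rational_mono[OF this Q_level]
    have Q: "?Q \<in> piecewise_rational (prefix_coords m l \<union> ?R)" .
    have inv: "relabelling.invariant m ?Q"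
      unfolding relabelling_invariant_iff
    proof (intro allI impI)
      fix \<sigma> and x :: tuple assume \<sigma>: "\<sigma> permutes {..<m}"
      show "(\<Sum>i<m. G ((x \<circ> \<sigma>) i) * (x \<circ> \<sigma>) i l ^ b) = ?Q x"
        using sum.permute[OF \<sigma>, of "\<lambda>i. G (x i) * x i l ^ b"] by (simp add: o_def)
    qed
    have ps: "power_sum m F \<in> ?R" if "F \<in> point_polynomials l" for F
      using Suc.IH[OF that] mono by blast
    have "?Q \<in> ?R"
    proof (rule descent_to_power_sums[OF _ _ _ Q inv])
      show "f \<in> ?R" if "f \<in> piecewise_rational ?R" for f using that by (rule coordinate_field_closed)
      show "relabelling.invariant m f" if "f \<in> ?R" for f using that by (rule coordinate_field_invariant)
      show "power_sum m F \<in> ?R" if "F \<in> point_polynomials l" for F using that by (rule ps)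
    qed
    then show ?case unfolding power_sum_def[abs_def] h .
  next
    case (add p q)
    have "(\<lambda>x. power_sum m p x + power_sum m q x) \<in> ?R"
      by (rule coordinate_field_closed) (intro piecewise_rational.add piecewise_rational.coord add.IH)
    then show ?case by (simp add: power_sum_def[abs_def] sum.distrib)
  qed
qed

theorem invariant_in_coordinate_field:
  assumes "f \<in> piecewise_rational (prefix_coords m n)" "relabelling.invariant m f"
  shows "f \<in> coordinate_field m n"
proof (rule descent_to_power_sums[OF _ _ _ piecewise_rational_mono[OF Un_upper1 assms(1)] assms(2)])
  show "h \<in> coordinate_field m n" if "h \<in> piecewise_rational (coordinate_field m n)" for h
    using that by (rule coordinate_field_closed)
  show "relabelling.invariant m h" if "h \<in> coordinate_field m n" for h
    using that by (rule coordinate_field_invariant)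
  show "power_sum m F \<in> coordinate_field m n" if "F \<in> point_polynomials n" for F
    using that by (rule power_sum_in_coordinate_field)
qed

lemma prefix_coords_stable:
  assumes "c \<in> prefix_coords m l" "g \<in> index_permutations m"
  shows "(\<lambda>x. c (g x)) \<in> prefix_coords m l"
proof -
  obtain i j \<sigma> where "c = (\<lambda>x. x i j)" "i < m" "j < l" "\<sigma> permutes {..<m}" "g = (\<lambda>x. x \<circ> \<sigma>)"
    using assms unfolding prefix_coords_def index_permutations_def by blast
  then show ?thesis using prefix_coordsI[of "\<sigma> i" m j l] permutes_in_image[of \<sigma> "{..<m}" i] by simp
qed

lemma polynomial_functions_stable:
  assumes "p \<in> tuple_polynomials m l" "g \<in> index_permutations m"
  shows "(\<lambda>x. p (g x)) \<in> tuple_polynomials m l"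
  using polynomial_functions_subst[OF assms(1), of g] prefix_coords_stable[OF _ assms(2)]
  by (auto intro: polynomial_functions.coord)

abbreviation symmetric_polynomials :: "nat \<Rightarrow> nat \<Rightarrow> (tuple \<Rightarrow> complex) set" where
  "symmetric_polynomials m n \<equiv> relabelling.invariant_polynomials m (prefix_coords m n)"

lemma symmetric_polynomial_reynolds:
  assumes "p \<in> tuple_polynomials m n"
  shows "relabelling.reynolds m p \<in> symmetric_polynomials m n"
proof -
  have "(\<lambda>x. \<Sum>g\<in>index_permutations m. p (g x)) \<in> tuple_polynomials m n"
    by (rule polynomial_functions_sum) (rule polynomial_functions_stable[OF assms])
  then show ?thesis
    using relabelling.invariant_reynolds[of m p]
    unfolding relabelling.invariant_polynomials_def relabelling.reynolds_def[abs_def] by simp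
qed

theorem coordinate_rational_in_symmetric_polynomials:
  assumes "k < m * n"
  shows "coordinate m k \<in> piecewise_rational (symmetric_polynomials m n)"
proof (rule relabelling.piecewise_rational_descent[where K = "tuple_polynomials m n"
      and C = "prefix_coords m n" and m = m])
  let ?R = "piecewise_rational (symmetric_polynomials m n)"
  show "f \<in> ?R" if "f \<in> piecewise_rational ?R" for f
    using that by (rule piecewise_rational_trans) simp
  show "relabelling.invariant m f" if "f \<in> ?R" for f
    unfolding relabelling.invariant_def
  proof (intro ballI allI)
    fix g :: "tuple \<Rightarrow> tuple" and x assume g: "g \<in> index_permutations m"
    show "f (g x) = f x"
      by (rule piecewise_rational_cong[OF that])
        (use g in \<open>auto simp: relabelling.invariant_polynomials_def relabelling.invariant_def\<close>)
  qed
  show "relabelling.reynolds m a \<in> ?R" if "a \<in> tuple_polynomials m n" for a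
    using symmetric_polynomial_reynolds[OF that] by (rule piecewise_rational.coord)
  show "prefix_coords m n \<subseteq> combinations ?R (tuple_polynomials m n)"
  proof
    fix c assume "c \<in> prefix_coords m n"
    then have "c \<in> tuple_polynomials m n" by (rule polynomial_functions.coord)
    from combinations.product[OF piecewise_rational.const[of 1] this]
    show "c \<in> combinations ?R (tuple_polynomials m n)" by simp
  qed
  show "(\<lambda>x. a (g x)) \<in> tuple_polynomials m n"
    if "a \<in> tuple_polynomials m n" "g \<in> index_permutations m" for a g
    using that by (rule polynomial_functions_stable)
  show "coordinate m k \<in> piecewise_rational (prefix_coords m n)"
    by (rule piecewise_rational_coordinate[OF assms])
  show "(\<lambda>_. 1) \<in> tuple_polynomials m n" by (rule polynomial_functions.const)
  show "(\<lambda>x. a x * b x) \<in> tuple_polynomials m n"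
    if "a \<in> tuple_polynomials m n" "b \<in> tuple_polynomials m n" for a b
    using that by (rule polynomial_functions.mult)
  show "relabelling.invariant m (coordinate m k)" by (rule coordinate_invariant)
qed

section \<open>The coordinates determine the configuration\<close>

text \<open>
  The fundamental theorem of algebra, with the roots labelled by a given index set.
\<close>

lemma monic_poly_factors:
  fixes p :: "complex poly"
  assumes "finite I" "degree p = card I" "coeff p (card I) = 1"
  shows "\<exists>y. p = (\<Prod>i\<in>I. [:- y i, 1:])"
  using assms
proof (induction I arbitrary: p)
  case empty
  then obtain a where "p = [:a:]" using degree_eq_zeroE by (metis card.empty)
  then show ?case using empty by simp
next
  case (insert i I)
  have "degree p > 0" using insert by simp
  from alg_closed_imp_poly_has_root[OF this] obtain z where "poly p z = 0" ..
  then have "[:- z, 1:] dvd p" by (simp add: poly_eq_0_iff_dvd)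
  then obtain q where q: "p = [:- z, 1:] * q" by (rule dvdE)
  have "q \<noteq> 0" using q insert by auto
  then have "degree p = Suc (degree q)" unfolding q by (subst degree_mult_eq) auto
  then have deg: "degree q = card I" using insert by simp
  have "lead_coeff p = lead_coeff q" unfolding q lead_coeff_mult by simp
  then have "coeff q (card I) = 1" using insert deg by simp
  from insert.IH[OF deg this] obtain y where y: "q = (\<Prod>i\<in>I. [:- y i, 1:])" by blast
  have "(\<Prod>i'\<in>I. [:- (y(i := z)) i', 1:]) = q"
    unfolding y using insert.hyps by (intro prod.cong) auto
  then have "p = (\<Prod>i'\<in>insert i I. [:- (y(i := z)) i', 1:])"
    using insert.hyps by (simp add: q)
  then show ?case by blast
qed

text \<open>
  Given the prefixes, every polynomial of degree less than \<open>m\<close> is an interpolant: its Taylor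
  coefficients at the node of a prefix are the lower coefficients of a monic polynomial, whose roots are assigned to
  the points with this prefix.
\<close>

lemma extend_configuration:
  fixes x :: tuple and g :: "complex poly"
  assumes g: "\<forall>k\<ge>m. coeff g k = 0"
  obtains y where "interpolant m l (\<lambda>i. (x i)(l := y i)) = g"
proof -
  \<comment> \<open>the fibre polynomial that \<open>g\<close> prescribes for a fibre \<open>S\<close> with node \<open>t\<close>\<close>
  define target where "target S t = monom 1 (card S) + (\<Sum>r<card S. monom (coeff (taylor g t) r) r)"
    for S :: "nat set" and t
  have coeff_target: "coeff (target S t) r
      = (if r < card S then coeff (taylor g t) r else if r = card S then 1 else 0)" for S t r
    by (simp add: target_def coeff_sum)
  have deg: "degree (target S t) = card S" for S t
  proof (rule antisym)
    show "degree (target S t) \<le> card S" by (rule degree_le) (simp add: coeff_target)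
    show "card S \<le> degree (target S t)" by (rule le_degree) (simp add: coeff_target)
  qed
  have "\<exists>y. target S t = (\<Prod>i\<in>S. [:- y i, 1:])" if "finite S" for S t
    using that deg coeff_target by (intro monic_poly_factors) auto
  then obtain roots where roots: "\<And>S t. finite S \<Longrightarrow> target S t = (\<Prod>i\<in>S. [:- roots S t i, 1:])"
    by metis
  \<comment> \<open>Fibre and node depend on the prefix of \<open>x i\<close> only, so points of a fibre use the same factorisation.\<close>
  define y where "y i = roots (fibre m l x i) (node m l x i) i" for i
  let ?x = "\<lambda>i. (x i)(l := y i)"
  have lf: "linear_form a l (?x i) = linear_form a l (x i)" for a i
    by (simp add: linear_form_def)
  have sp: "same_prefix l (?x i) (?x i') \<longleftrightarrow> same_prefix l (x i) (x i')" for i i'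
    by (simp add: same_prefix_def)
  have node: "node m l ?x = node m l x" by (simp add: fun_eq_iff node_def separates_def lf sp)
  have fib: "fibre m l ?x = fibre m l x" by (simp add: fun_eq_iff fibre_def sp)
  have poly: "fibre_poly m l ?x i = target (fibre m l x i) (node m l x i)" if "i < m" for i
  proof -
    have "(\<Prod>i'\<in>fibre m l x i. [:- y i', 1:])
        = (\<Prod>i'\<in>fibre m l x i. [:- roots (fibre m l x i) (node m l x i) i', 1:])"
    proof (rule prod.cong[OF refl])
      fix i' assume "i' \<in> fibre m l x i"
      then have i': "i' < m" "same_prefix l (x i') (x i)" by (auto simp: fibre_def)
      then have "fibre m l x i' = fibre m l x i" "node m l x i' = node m l x i"
        using fibre_cong node_eq_iff[OF i'(1) that] by auto
      then show "[:- y i', 1:] = [:- roots (fibre m l x i) (node m l x i) i', 1:]"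
        by (simp add: y_def)
    qed
    then show ?thesis unfolding fibre_poly_def fib roots[OF finite_fibre] by simp
  qed
  have "interpolates m (node m l ?x) (\<lambda>i. coeff (fibre_poly m l ?x i)) g"
    unfolding interpolates_def
  proof (intro conjI allI impI)
    show "coeff g k = 0" if "m \<le> k" for k using g that by blast
    fix i r assume "i < m" "r < multiplicity_at m (node m l ?x) i"
    then show "coeff (taylor g (node m l ?x i)) r = coeff (fibre_poly m l ?x i) r"
      unfolding node by (simp add: multiplicity_at_node poly coeff_target)
  qed
  then have "interpolant m l ?x = g" unfolding interpolant_def by (rule hermite_eqI)
  then show ?thesis by (rule that)
qed

theorem coordinates_surjective: "\<exists>x. \<forall>k<m * n. coordinate m k x = c k"
proof (induction n)
  case 0 show ?case by simp
next
  case (Suc n)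
  then obtain x where x: "\<And>k. k < m * n \<Longrightarrow> coordinate m k x = c k" by blast
  define g where "g = (\<Sum>j<m. monom (c (m * n + j)) j)"
  have coeff_g: "coeff g j = (if j < m then c (m * n + j) else 0)" for j
    by (simp add: g_def coeff_sum)
  then have "\<forall>k\<ge>m. coeff g k = 0" by simp
  then obtain y where y: "interpolant m n (\<lambda>i. (x i)(n := y i)) = g" by (rule extend_configuration)
  let ?x = "\<lambda>i. (x i)(n := y i)"
  have "coordinate m k ?x = c k" if k: "k < m * Suc n" for k
  proof (cases "k < m * n")
    case True
    then have "k div m < n" by (simp add: less_mult_imp_div_less mult.commute)
    then have "interpolant m (k div m) ?x = interpolant m (k div m) x"
      by (intro interpolant_local) auto
    then show ?thesis using x[OF True] by (simp add: coordinate_def)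
  next
    case False
    define j where "j = k - m * n"
    have j: "j < m" "k = m * n + j" using k False by (auto simp: j_def)
    then have "k div m = n" "k mod m = j" by auto
    then show ?thesis using j y coeff_g[of j] by (simp add: coordinate_def)
  qed
  then show ?case by blast
qed

text \<open>
  The coordinates determine all symmetric polynomials, and these separate orbits. Explicitly, if \<open>y\<close>
  is not a relabelling of \<open>x\<close>, some polynomial \<open>q\<close> vanishes on the orbit of \<open>x\<close> but not at \<open>y\<close>. The
  orbit polynomial of \<open>q\<close> has symmetric coefficients, so it is the same at \<open>x\<close> and \<open>y\<close>; but at \<open>x\<close> its
  only root is \<open>0\<close>, whereas \<open>q y\<close> is a root at \<open>y\<close>.
\<close>

theorem coordinates_injective:
  assumes "\<And>k. k < m * n \<Longrightarrow> coordinate m k x = coordinate m k y"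
  obtains (relabelled) \<sigma> where "\<sigma> permutes {..<m}" "\<And>i j. i < m \<Longrightarrow> j < n \<Longrightarrow> y i j = x (\<sigma> i) j"
proof (rule ccontr)
  assume not_thesis: "\<not> thesis"
  have "\<exists>i j. i < m \<and> j < n \<and> y i j \<noteq> x (\<sigma> i) j" if \<sigma>: "\<sigma> permutes {..<m}" for \<sigma>
  proof (rule ccontr)
    assume "\<nexists>i j. i < m \<and> j < n \<and> y i j \<noteq> x (\<sigma> i) j"
    then have thesis by (intro relabelled[OF \<sigma>]) blast
    with not_thesis show False ..
  qed
  then obtain I J where IJ: "\<And>\<sigma>. \<sigma> permutes {..<m} \<Longrightarrow>
      I \<sigma> < m \<and> J \<sigma> < n \<and> y (I \<sigma>) (J \<sigma>) \<noteq> x (\<sigma> (I \<sigma>)) (J \<sigma>)"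
    by metis
  define q where "q z = (\<Prod>\<sigma> | \<sigma> permutes {..<m}. z (I \<sigma>) (J \<sigma>) + - x (\<sigma> (I \<sigma>)) (J \<sigma>))" for z
  have q_poly: "q \<in> tuple_polynomials m n"
    unfolding q_def[abs_def]
    by (intro polynomial_functions_prod polynomial_functions.add polynomial_functions.const
        polynomial_functions.coord prefix_coordsI) (use IJ in auto)
  have fin: "finite {\<sigma>. \<sigma> permutes {..<m}}" by (simp add: finite_permutations)
  have qy: "q y \<noteq> 0" unfolding q_def using IJ fin by auto
  have qx: "q (g x) = 0" if g: "g \<in> index_permutations m" for g
  proof -
    obtain \<sigma> where \<sigma>: "\<sigma> permutes {..<m}" "g = (\<lambda>x. x \<circ> \<sigma>)"
      using g unfolding index_permutations_def by blast
    show ?thesis unfolding q_def using fin \<sigma> by (intro prod_zero bexI[of _ \<sigma>]) auto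
  qed
  have "coeff (relabelling.orbit_poly m q x) k = coeff (relabelling.orbit_poly m q y) k" for k
  proof -
    let ?f = "\<lambda>z. coeff (relabelling.orbit_poly m q z) k"
    have "?f \<in> tuple_polynomials m n"
    proof (rule relabelling.coeff_orbit_poly_in[OF _ _ _ _ q_poly])
      show "(\<lambda>x. p (g x)) \<in> tuple_polynomials m n"
        if "p \<in> tuple_polynomials m n" "g \<in> index_permutations m" for p g
        using that by (rule polynomial_functions_stable)
    qed (rule polynomial_functions.const polynomial_functions.add polynomial_functions.mult; assumption)+
    moreover have "relabelling.invariant m ?f"
      using relabelling.invariant_orbit_poly[of m q] by (simp add: relabelling.invariant_def)
    ultimately have "?f \<in> coordinate_field m n"
      by (intro invariant_in_coordinate_field polynomial_imp_piecewise_rational)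
    then show ?thesis unfolding coordinate_field_def
      by (rule piecewise_rational_cong) (use assms in auto)
  qed
  then have "relabelling.orbit_poly m q y = relabelling.orbit_poly m q x" by (simp add: poly_eq_iff)
  moreover have "poly (relabelling.orbit_poly m q x) (q y) \<noteq> 0"
    unfolding relabelling.orbit_poly_def poly_prod using qx qy relabelling.finite_G by auto
  ultimately show False using relabelling.poly_orbit_poly[of m q y] by simp
qed

section \<open>Piecewise isomorphisms from piecewise rational bijections\<close>

definition rational_on :: "('a \<Rightarrow> complex) set \<Rightarrow> 'a set \<Rightarrow> ('a \<Rightarrow> complex) \<Rightarrow> bool" where
  "rational_on C Z f \<longleftrightarrow>
     (\<exists>g\<in>polynomial_functions C. \<exists>h\<in>polynomial_functions C. \<forall>x\<in>Z. h x \<noteq> 0 \<and> f x = g x / h x)"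

lemma rational_onI:
  assumes "g \<in> polynomial_functions C" "h \<in> polynomial_functions C"
    "\<And>x. x \<in> Z \<Longrightarrow> h x \<noteq> 0" "\<And>x. x \<in> Z \<Longrightarrow> f x = g x / h x"
  shows "rational_on C Z f"
  using assms unfolding rational_on_def by blast

lemma rational_onE:
  assumes "rational_on C Z f"
  obtains g h where "g \<in> polynomial_functions C" "h \<in> polynomial_functions C"
    "\<And>x. x \<in> Z \<Longrightarrow> h x \<noteq> 0" "\<And>x. x \<in> Z \<Longrightarrow> f x = g x / h x"
  using assms unfolding rational_on_def by blast

lemma rational_on_subset: "rational_on C Z f \<Longrightarrow> Z' \<subseteq> Z \<Longrightarrow> rational_on C Z' f"
  unfolding rational_on_def by blast

lemma rational_on_polynomial: "p \<in> polynomial_functions C \<Longrightarrow> rational_on C Z p"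
  by (rule rational_onI[of p C "\<lambda>_. 1"]) (auto intro: polynomial_functions.const)

lemma rational_on_add:
  assumes "rational_on C Z f" "rational_on C Z f'"
  shows "rational_on C Z (\<lambda>x. f x + f' x)"
proof -
  obtain g h where gh: "g \<in> polynomial_functions C" "h \<in> polynomial_functions C"
    "\<And>x. x \<in> Z \<Longrightarrow> h x \<noteq> 0" "\<And>x. x \<in> Z \<Longrightarrow> f x = g x / h x" using assms(1) by (rule rational_onE) blast
  obtain g' h' where gh': "g' \<in> polynomial_functions C" "h' \<in> polynomial_functions C"
    "\<And>x. x \<in> Z \<Longrightarrow> h' x \<noteq> 0" "\<And>x. x \<in> Z \<Longrightarrow> f' x = g' x / h' x" using assms(2) by (rule rational_onE) blast
  show ?thesis
  proof (rule rational_onI)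
    show "(\<lambda>x. g x * h' x + g' x * h x) \<in> polynomial_functions C"
      by (intro polynomial_functions.add polynomial_functions.mult gh gh')
    show "(\<lambda>x. h x * h' x) \<in> polynomial_functions C"
      by (intro polynomial_functions.mult gh gh')
    fix x assume x: "x \<in> Z"
    show "h x * h' x \<noteq> 0" using gh(3) gh'(3) x by simp
    show "f x + f' x = (g x * h' x + g' x * h x) / (h x * h' x)"
      using gh(3,4)[OF x] gh'(3,4)[OF x] by (simp add: add_frac_eq)
  qed
qed

lemma rational_on_mult:
  assumes "rational_on C Z f" "rational_on C Z f'"
  shows "rational_on C Z (\<lambda>x. f x * f' x)"
proof -
  obtain g h where gh: "g \<in> polynomial_functions C" "h \<in> polynomial_functions C"
    "\<And>x. x \<in> Z \<Longrightarrow> h x \<noteq> 0" "\<And>x. x \<in> Z \<Longrightarrow> f x = g x / h x" using assms(1) by (rule rational_onE) blast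
  obtain g' h' where gh': "g' \<in> polynomial_functions C" "h' \<in> polynomial_functions C"
    "\<And>x. x \<in> Z \<Longrightarrow> h' x \<noteq> 0" "\<And>x. x \<in> Z \<Longrightarrow> f' x = g' x / h' x" using assms(2) by (rule rational_onE) blast
  show ?thesis
  proof (rule rational_onI)
    show "(\<lambda>x. g x * g' x) \<in> polynomial_functions C"
      by (intro polynomial_functions.mult gh gh')
    show "(\<lambda>x. h x * h' x) \<in> polynomial_functions C"
      by (intro polynomial_functions.mult gh gh')
    fix x assume x: "x \<in> Z"
    show "h x * h' x \<noteq> 0" using gh(3) gh'(3) x by simp
    show "f x * f' x = (g x * g' x) / (h x * h' x)"
      using gh(4)[OF x] gh'(4)[OF x] by simp
  qed
qed

definition rational_map ::
    "('a \<Rightarrow> complex) set \<Rightarrow> 'a set \<Rightarrow> ('b \<Rightarrow> complex) set \<Rightarrow> ('a \<Rightarrow> 'b) \<Rightarrow> bool" where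
  "rational_map C Z D \<phi> \<longleftrightarrow> (\<forall>c\<in>D. rational_on C Z (\<lambda>x. c (\<phi> x)))"

lemma rational_on_compose:
  assumes p: "p \<in> polynomial_functions D" and \<phi>: "rational_map C Z D \<phi>"
  shows "rational_on C Z (\<lambda>x. p (\<phi> x))"
  using p
proof induction
  case (const a)
  show ?case by (intro rational_on_polynomial polynomial_functions.const)
next
  case (coord c)
  with \<phi> show ?case unfolding rational_map_def by blast
next
  case (add p q)
  then show ?case by (intro rational_on_add)
next
  case (mult p q)
  then show ?case by (intro rational_on_mult)
qed

lemma rational_map_subset: "rational_map C Z D \<phi> \<Longrightarrow> Z' \<subseteq> Z \<Longrightarrow> rational_map C Z' D \<phi>"
  unfolding rational_map_def rational_on_def by blast

lemma rational_map_fractions: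
  assumes "rational_map C Z D \<phi>" "F \<subseteq> polynomial_functions D"
  obtains g h where "\<And>f. f \<in> F \<Longrightarrow> g f \<in> polynomial_functions C"
    "\<And>f x. f \<in> F \<Longrightarrow> x \<in> Z \<Longrightarrow> h f x \<noteq> (0 :: complex) \<and> f (\<phi> x) = g f x / h f x"
proof -
  have "\<exists>g h. g \<in> polynomial_functions C \<and> (\<forall>x\<in>Z. h x \<noteq> 0 \<and> f (\<phi> x) = g x / h x)" if "f \<in> F" for f
  proof -
    have "f \<in> polynomial_functions D" using that assms(2) by blast
    from rational_on_compose[OF this assms(1)] show ?thesis unfolding rational_on_def by blast
  qed
  then show ?thesis using that by metis
qed

text \<open>
  For fixed \<open>P\<close> these sets form a partition, indexed by the subsets \<open>N\<close> of \<open>P\<close>.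
\<close>

definition stratum :: "('a \<Rightarrow> complex) set \<Rightarrow> ('a \<Rightarrow> complex) set \<Rightarrow> 'a set" where
  "stratum P N = {x. \<forall>p\<in>P. p x \<noteq> 0 \<longleftrightarrow> p \<in> N}"

lemma stratum_antimono: "P \<subseteq> P' \<Longrightarrow> stratum P' N \<subseteq> stratum P N"
  unfolding stratum_def by blast

lemma stratum_Int: "stratum P (N \<inter> P) = stratum P N"
  unfolding stratum_def by blast

text \<open>
  To invert a function, refine the stratification by its numerators: where the numerator is nonzero,
  numerator and denominator are exchanged, and where it vanishes, the inverse is \<open>0\<close>.
\<close>

lemma piecewise_rational_stratification:
  assumes "f \<in> piecewise_rational C"
  shows "\<exists>P. finite P \<and> P \<subseteq> polynomial_functions C \<and> (\<forall>N. rational_on C (stratum P N) f)"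
  using assms
proof induction
  case (const a)
  show ?case by (intro exI[of _ "{}"]) (auto intro: rational_on_polynomial polynomial_functions.const)
next
  case (coord c)
  then show ?case by (intro exI[of _ "{}"]) (auto intro: rational_on_polynomial polynomial_functions.coord)
next
  case (add p q)
  then obtain P Q where P: "finite P" "P \<subseteq> polynomial_functions C" "\<And>N. rational_on C (stratum P N) p"
    and Q: "finite Q" "Q \<subseteq> polynomial_functions C" "\<And>N. rational_on C (stratum Q N) q" by blast
  have "rational_on C (stratum (P \<union> Q) N) (\<lambda>x. p x + q x)" for N
    using P(3)[of N] Q(3)[of N] stratum_antimono[of P "P \<union> Q" N] stratum_antimono[of Q "P \<union> Q" N]
    by (intro rational_on_add) (auto intro: rational_on_subset)
  with P(1,2) Q(1,2) show ?case by (intro exI[of _ "P \<union> Q"]) auto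
next
  case (mult p q)
  then obtain P Q where P: "finite P" "P \<subseteq> polynomial_functions C" "\<And>N. rational_on C (stratum P N) p"
    and Q: "finite Q" "Q \<subseteq> polynomial_functions C" "\<And>N. rational_on C (stratum Q N) q" by blast
  have "rational_on C (stratum (P \<union> Q) N) (\<lambda>x. p x * q x)" for N
    using P(3)[of N] Q(3)[of N] stratum_antimono[of P "P \<union> Q" N] stratum_antimono[of Q "P \<union> Q" N]
    by (intro rational_on_mult) (auto intro: rational_on_subset)
  with P(1,2) Q(1,2) show ?case by (intro exI[of _ "P \<union> Q"]) auto
next
  case (inverse p)
  then obtain P where P: "finite P" "P \<subseteq> polynomial_functions C" "\<And>N. rational_on C (stratum P N) p" by blast
  have "\<forall>N. \<exists>g h. g \<in> polynomial_functions C \<and> h \<in> polynomial_functions C \<and>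
      (\<forall>x\<in>stratum P N. h x \<noteq> 0 \<and> p x = g x / h x)"
    using P(3) unfolding rational_on_def by blast
  then obtain g h where gh: "\<And>N. g N \<in> polynomial_functions C" "\<And>N. h N \<in> polynomial_functions C"
    "\<And>N x. x \<in> stratum P N \<Longrightarrow> h N x \<noteq> 0 \<and> p x = g N x / h N x" by metis
  \<comment> \<open>\<open>g N\<close> is the numerator of \<open>p\<close> on the stratum of \<open>N\<close>.\<close>
  let ?P = "P \<union> g ` Pow P"
  have "rational_on C (stratum ?P N) (\<lambda>x. inverse (p x))" for N
  proof -
    let ?N = "N \<inter> P"
    have sub: "x \<in> stratum P ?N" if "x \<in> stratum ?P N" for x
      using that stratum_antimono[of P ?P N] unfolding stratum_Int by blast
    have numerator: "g ?N x \<noteq> 0 \<longleftrightarrow> g ?N \<in> N" if "x \<in> stratum ?P N" for x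
      using that unfolding stratum_def by blast
    show ?thesis
    proof (cases "g ?N \<in> N")
      case True
      show ?thesis
        by (rule rational_onI[OF gh(2)[of ?N] gh(1)[of ?N]])
          (use True numerator gh(3)[OF sub] in auto)
    next
      case False
      have "inverse (p x) = 0 / 1" if "x \<in> stratum ?P N" for x
        using gh(3)[OF sub[OF that]] numerator[OF that] False by simp
      then show ?thesis
        by (intro rational_onI[of "\<lambda>_. 0" C "\<lambda>_. 1"] polynomial_functions.const) auto
    qed
  qed
  with P(1,2) gh(1) show ?case by (intro exI[of _ ?P]) auto
qed

lemma finite_piecewise_rational_stratification:
  assumes "finite F" "F \<subseteq> piecewise_rational C"
  shows "\<exists>P. finite P \<and> P \<subseteq> polynomial_functions C \<and> (\<forall>f\<in>F. \<forall>N. rational_on C (stratum P N) f)"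
  using assms
proof induction
  case empty show ?case by (intro exI[of _ "{}"]) auto
next
  case (insert f F)
  have "F \<subseteq> piecewise_rational C" and f: "f \<in> piecewise_rational C" using insert.prems by auto
  from insert.IH[OF this(1)]
  obtain P where P: "finite P \<and> P \<subseteq> polynomial_functions C \<and> (\<forall>f\<in>F. \<forall>N. rational_on C (stratum P N) f)" ..
  from piecewise_rational_stratification[OF f]
  obtain Q where Q: "finite Q \<and> Q \<subseteq> polynomial_functions C \<and> (\<forall>N. rational_on C (stratum Q N) f)" ..
  have "rational_on C (stratum (P \<union> Q) N) f'" if "f' \<in> insert f F" for f' N
  proof (cases "f' = f")
    case True
    with Q have "rational_on C (stratum Q N) f'" by simp
    then show ?thesis by (rule rational_on_subset) (simp add: stratum_antimono)
  next
    case False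
    with P that have "rational_on C (stratum P N) f'" by simp
    then show ?thesis by (rule rational_on_subset) (simp add: stratum_antimono)
  qed
  with P Q show ?case by (intro exI[of _ "P \<union> Q"]) simp
qed

lemma openin_nonvanishing:
  "F \<subseteq> polynomial_functions (coords V) \<Longrightarrow>
    openin (zariski_topology V) {x \<in> points V. \<exists>f\<in>F. f x \<noteq> 0}"
  unfolding openin_zariski_topology zero_locus_def by (intro exI[of _ F]) auto

lemma openin_nonvanishing1:
  "f \<in> polynomial_functions (coords V) \<Longrightarrow> openin (zariski_topology V) {x \<in> points V. f x \<noteq> 0}"
  using openin_nonvanishing[of "{f}" V] by simp

lemma openin_zariskiE:
  assumes "openin (zariski_topology V) U"
  obtains F where "F \<subseteq> polynomial_functions (coords V)" "U = {x \<in> points V. \<exists>f\<in>F. f x \<noteq> 0}"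
proof -
  obtain F where "F \<subseteq> polynomial_functions (coords V)" "U = points V - zero_locus V F"
    using assms unfolding openin_zariski_topology by blast
  then show ?thesis by (intro that[of F]) (auto simp: zero_locus_def)
qed

lemma zariski_variety: "zariski (variety V) = zariski_topology V"
  by (simp add: variety_def)

lemma regular_on_subspace_of:
  "regular_on (subspace_of X Z) V f \<longleftrightarrow> (\<forall>x\<in>V. \<exists>U g. openin (zariski X) U \<and> x \<in> U \<and>
     regular_on X U g \<and> (\<forall>y\<in>U \<inter> V. f y = g y))"
  by (simp add: subspace_of_def)

lemma regular_on_variety:
  "regular_on (variety V) U f \<longleftrightarrow> (\<forall>x\<in>U. \<exists>W. openin (zariski_topology V) W \<and> x \<in> W \<and> W \<subseteq> U \<and>
     (\<exists>g\<in>polynomial_functions (coords V). \<exists>h\<in>polynomial_functions (coords V).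
        \<forall>y\<in>W. h y \<noteq> 0 \<and> f y = g y / h y))"
  by (simp add: variety_def)

lemma regular_on_varietyE:
  assumes "regular_on (variety V) U f" "x \<in> U"
  obtains W g h where "openin (zariski_topology V) W" "x \<in> W" "W \<subseteq> U"
    "g \<in> polynomial_functions (coords V)" "h \<in> polynomial_functions (coords V)"
    "\<And>y. y \<in> W \<Longrightarrow> h y \<noteq> 0 \<and> f y = g y / h y"
proof -
  from assms(1)[unfolded regular_on_variety] assms(2)
  have "\<exists>W. openin (zariski_topology V) W \<and> x \<in> W \<and> W \<subseteq> U \<and>
     (\<exists>g\<in>polynomial_functions (coords V). \<exists>h\<in>polynomial_functions (coords V).
        \<forall>y\<in>W. h y \<noteq> 0 \<and> f y = g y / h y)" by (rule bspec)
  then obtain W where W: "openin (zariski_topology V) W \<and> x \<in> W \<and> W \<subseteq> U \<and>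
     (\<exists>g\<in>polynomial_functions (coords V). \<exists>h\<in>polynomial_functions (coords V).
        \<forall>y\<in>W. h y \<noteq> 0 \<and> f y = g y / h y)" ..
  then have "\<exists>g\<in>polynomial_functions (coords V). \<exists>h\<in>polynomial_functions (coords V).
        \<forall>y\<in>W. h y \<noteq> 0 \<and> f y = g y / h y" by (elim conjE)
  then obtain g h where "g \<in> polynomial_functions (coords V)" "h \<in> polynomial_functions (coords V)"
    "\<forall>y\<in>W. h y \<noteq> 0 \<and> f y = g y / h y" by (elim bexE) (rule that)
  with W show ?thesis by (intro that[of W g h]) simp_all
qed

lemma openin_preimage:
  assumes AB: "A \<subseteq> points V" "B \<subseteq> points W" "\<phi> ` A \<subseteq> B"
    and coords: "rational_map (coords V) A (coords W) \<phi>"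
    and T: "openin (zariski_topology W) T"
  obtains T' where "openin (zariski_topology V) T'" "{x \<in> A. \<phi> x \<in> T} = T' \<inter> A"
proof -
  obtain F where F: "F \<subseteq> polynomial_functions (coords W)" "T = {x \<in> points W. \<exists>f\<in>F. f x \<noteq> 0}"
    using T by (rule openin_zariskiE)
  obtain g h where gh: "\<And>f. f \<in> F \<Longrightarrow> g f \<in> polynomial_functions (coords V)"
    "\<And>f x. f \<in> F \<Longrightarrow> x \<in> A \<Longrightarrow> h f x \<noteq> (0 :: complex) \<and> f (\<phi> x) = g f x / h f x"
    using coords F(1) by (rule rational_map_fractions) blast
  show ?thesis
  proof (rule that)
    show "openin (zariski_topology V) {x \<in> points V. \<exists>f\<in>g ` F. f x \<noteq> 0}"
      using gh(1) by (intro openin_nonvanishing) auto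
    show "{x \<in> A. \<phi> x \<in> T} = {x \<in> points V. \<exists>f\<in>g ` F. f x \<noteq> 0} \<inter> A"
    proof (rule Set.set_eqI)
      fix x
      have "f (\<phi> x) \<noteq> 0 \<longleftrightarrow> g f x \<noteq> 0" if "f \<in> F" "x \<in> A" for f using gh(2)[OF that] by simp
      then show "x \<in> {x \<in> A. \<phi> x \<in> T} \<longleftrightarrow> x \<in> {x \<in> points V. \<exists>f\<in>g ` F. f x \<noteq> 0} \<inter> A"
        using AB unfolding F(2) by auto
    qed
  qed
qed

text \<open>
  A map between subsets of varieties is a morphism if its coordinates are quotients of polynomials:
  polynomials, and hence open sets and local fractions, then pull back to fractions of the same kind.
\<close>

lemma morphism_if_rational_coords:
  assumes AB: "A \<subseteq> points V" "B \<subseteq> points W" "\<phi> ` A \<subseteq> B"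
    and coords: "rational_map (coords V) A (coords W) \<phi>"
  shows "morphism (subspace_of (variety V) A) (subspace_of (variety W) B) \<phi>"
proof -
  have z: "zariski (subspace_of (variety V) A) = subtopology (zariski_topology V) A"
    "zariski (subspace_of (variety W) B) = subtopology (zariski_topology W) B"
    by (simp_all add: subspace_of_def zariski_variety)
  have top: "topspace (subtopology (zariski_topology V) A) = A"
    "topspace (subtopology (zariski_topology W) B) = B" using AB by auto
  show ?thesis
    unfolding morphism_def z top
  proof (intro conjI allI impI)
    show "continuous_map (subtopology (zariski_topology V) A) (subtopology (zariski_topology W) B) \<phi>"
      unfolding continuous_map_def top
    proof (intro conjI allI impI)
      show "\<phi> \<in> A \<rightarrow> B" using AB(3) by auto
      fix U assume "openin (subtopology (zariski_topology W) B) U"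
      then obtain T where T: "openin (zariski_topology W) T" "U = T \<inter> B" by (auto simp: openin_subtopology)
      obtain T' where T': "openin (zariski_topology V) T'" "{x \<in> A. \<phi> x \<in> T} = T' \<inter> A"
        using AB coords T(1) by (rule openin_preimage)
      have "{x \<in> A. \<phi> x \<in> U} = T' \<inter> A" using T'(2) T(2) AB(3) by auto
      then show "openin (subtopology (zariski_topology V) A) {x \<in> A. \<phi> x \<in> U}"
        using T'(1) by (auto simp: openin_subtopology)
    qed
    fix V0 f assume V0: "openin (subtopology (zariski_topology W) B) V0"
      and reg: "regular_on (subspace_of (variety W) B) V0 f"
    show "regular_on (subspace_of (variety V) A) {x \<in> A. \<phi> x \<in> V0} (f \<circ> \<phi>)"
      unfolding regular_on_subspace_of zariski_variety
    proof
      fix x assume "x \<in> {x \<in> A. \<phi> x \<in> V0}"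
      then have x: "x \<in> A" "\<phi> x \<in> V0" by auto
      from reg[unfolded regular_on_subspace_of zariski_variety] x(2)
      have "\<exists>U g. openin (zariski_topology W) U \<and> \<phi> x \<in> U \<and> regular_on (variety W) U g \<and>
          (\<forall>y\<in>U \<inter> V0. f y = g y)" by (rule bspec)
      then obtain U g where "openin (zariski_topology W) U \<and> \<phi> x \<in> U \<and> regular_on (variety W) U g \<and>
          (\<forall>y\<in>U \<inter> V0. f y = g y)" by (elim exE) (rule that)
      then have U: "openin (zariski_topology W) U" "\<phi> x \<in> U" "regular_on (variety W) U g"
        "\<And>y. y \<in> U \<inter> V0 \<Longrightarrow> f y = g y" by simp_all
      obtain W0 a b where W0: "openin (zariski_topology W) W0" "\<phi> x \<in> W0" "W0 \<subseteq> U"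
        and ab: "a \<in> polynomial_functions (coords W)" "b \<in> polynomial_functions (coords W)"
          "\<And>y. y \<in> W0 \<Longrightarrow> b y \<noteq> 0 \<and> g y = a y / b y"
        using U(3,2) by (rule regular_on_varietyE) (rule that)
      obtain a1 a2 where a: "a1 \<in> polynomial_functions (coords V)" "a2 \<in> polynomial_functions (coords V)"
        "\<And>x. x \<in> A \<Longrightarrow> a2 x \<noteq> 0" "\<And>x. x \<in> A \<Longrightarrow> a (\<phi> x) = a1 x / a2 x"
        using rational_on_compose[OF ab(1) coords] by (rule rational_onE) blast
      obtain b1 b2 where b: "b1 \<in> polynomial_functions (coords V)" "b2 \<in> polynomial_functions (coords V)"
        "\<And>x. x \<in> A \<Longrightarrow> b2 x \<noteq> 0" "\<And>x. x \<in> A \<Longrightarrow> b (\<phi> x) = b1 x / b2 x"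
        using rational_on_compose[OF ab(2) coords] by (rule rational_onE) blast
      obtain T' where T': "openin (zariski_topology V) T'" "{x \<in> A. \<phi> x \<in> W0} = T' \<inter> A"
        using AB coords W0(1) by (rule openin_preimage)
      define num where "num z = a1 z * b2 z" for z
      \<comment> \<open>the compound fraction \<open>(a1 / a2) / (b1 / b2)\<close>\<close>
      define den where "den z = a2 z * b1 z" for z
      have num: "num \<in> polynomial_functions (coords V)" and den: "den \<in> polynomial_functions (coords V)"
        unfolding num_def[abs_def] den_def[abs_def] by (intro polynomial_functions.mult a b)+
      define U' where "U' = T' \<inter> {z \<in> points V. den z \<noteq> 0}"
      have U': "openin (zariski_topology V) U'"
        unfolding U'_def using T'(1) openin_nonvanishing1[OF den] by (rule openin_Int)
      have xU': "x \<in> U'"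
      proof -
        have "b1 x \<noteq> 0" using ab(3)[OF W0(2)] b(4)[OF x(1)] by auto
        moreover have "x \<in> T'" using T'(2) x(1) W0(2) by blast
        ultimately show ?thesis using a(3)[OF x(1)] x(1) AB(1) by (auto simp: U'_def den_def)
      qed
      have regular: "regular_on (variety V) U' (\<lambda>z. num z / den z)"
        unfolding variety_def fun_space.simps
      proof
        fix z assume "z \<in> U'"
        with U' num den show "\<exists>W'. openin (zariski_topology V) W' \<and> z \<in> W' \<and> W' \<subseteq> U' \<and>
          (\<exists>g\<in>polynomial_functions (coords V). \<exists>h\<in>polynomial_functions (coords V).
            \<forall>y\<in>W'. h y \<noteq> 0 \<and> num y / den y = g y / h y)"
          by (intro exI[of _ U'] conjI bexI[of _ num] bexI[of _ den]) (auto simp: U'_def)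
      qed
      have agree: "(f \<circ> \<phi>) z = num z / den z" if z: "z \<in> U' \<inter> {x \<in> A. \<phi> x \<in> V0}" for z
      proof -
        have zA: "z \<in> A" "\<phi> z \<in> V0" "\<phi> z \<in> W0" using z T'(2) by (auto simp: U'_def)
        then have "f (\<phi> z) = g (\<phi> z)" using U(4)[of "\<phi> z"] W0(3) by blast
        also have "\<dots> = a (\<phi> z) / b (\<phi> z)" using ab(3)[OF zA(3)] by simp
        also have "\<dots> = num z / den z"
          unfolding a(4)[OF zA(1)] b(4)[OF zA(1)] num_def den_def by simp
        finally show ?thesis by simp
      qed
      show "\<exists>U g. openin (zariski_topology V) U \<and> x \<in> U \<and> regular_on (variety V) U g \<and>
          (\<forall>y\<in>U \<inter> {x \<in> A. \<phi> x \<in> V0}. (f \<circ> \<phi>) y = g y)"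
        using U' xU' regular agree
        by (intro exI[of _ U'] exI[of _ "\<lambda>z. num z / den z"] conjI ballI)
    qed
  qed
qed

lemma locally_closed_in_Int:
  assumes "locally_closed_in T X" "locally_closed_in T Y" shows "locally_closed_in T (X \<inter> Y)"
proof -
  obtain U C U' C' where "openin T U" "closedin T C" "X = U \<inter> C" "openin T U'" "closedin T C'" "Y = U' \<inter> C'"
    using assms unfolding locally_closed_in_def by blast
  then show ?thesis unfolding locally_closed_in_def
    by (intro exI[of _ "U \<inter> U'"] exI[of _ "C \<inter> C'"]) auto
qed

lemma locally_closed_sign_condition:
  assumes "finite J" "\<And>j. j \<in> J \<Longrightarrow> f j \<in> polynomial_functions (coords V)"
  shows "locally_closed_in (zariski_topology V) {x \<in> points V. \<forall>j\<in>J. f j x \<noteq> 0 \<longleftrightarrow> b j}"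
  using assms
proof (induction J)
  case empty
  have "openin (zariski_topology V) (points V)" "closedin (zariski_topology V) (points V)"
    using openin_topspace[of "zariski_topology V"] closedin_topspace[of "zariski_topology V"] by simp_all
  then show ?case unfolding locally_closed_in_def by blast
next
  case (insert j J)
  let ?U = "{x \<in> points V. f j x \<noteq> 0}"
  have U: "openin (zariski_topology V) ?U" using insert by (intro openin_nonvanishing1) auto
  have "locally_closed_in (zariski_topology V) {x \<in> points V. f j x \<noteq> 0 \<longleftrightarrow> b j}"
  proof (cases "b j")
    case True
    have "closedin (zariski_topology V) (points V)" using closedin_topspace[of "zariski_topology V"] by simp
    then show ?thesis using U True unfolding locally_closed_in_def
      by (intro exI[of _ ?U] exI[of _ "points V"]) auto
  next
    case False
    have "closedin (zariski_topology V) (points V - ?U)" using closedin_diff[OF closedin_topspace U] by simp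
    moreover have "openin (zariski_topology V) (points V)" using openin_topspace[of "zariski_topology V"] by simp
    ultimately show ?thesis using False unfolding locally_closed_in_def
      by (intro exI[of _ "points V"] exI[of _ "points V - ?U"]) auto
  qed
  from locally_closed_in_Int[OF this insert.IH] insert.prems
  have "locally_closed_in (zariski_topology V)
      ({x \<in> points V. f j x \<noteq> 0 \<longleftrightarrow> b j} \<inter> {x \<in> points V. \<forall>j\<in>J. f j x \<noteq> 0 \<longleftrightarrow> b j})" by blast
  then show ?case by (rule back_subst[where P = "locally_closed_in (zariski_topology V)"]) auto
qed

text \<open>
  On a stratum of \<open>V\<close>, the polynomials on \<open>W\<close> pull back to fractions with nonvanishing denominators,
  so the preimage of a stratum of \<open>W\<close> is described by the vanishing of numerators.
\<close>

lemma locally_closed_piece: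
  assumes P: "finite P" "P \<subseteq> polynomial_functions (coords V)"
    and Q: "finite Q" "Q \<subseteq> polynomial_functions (coords W)"
    and coords: "rational_map (coords V) (points V \<inter> stratum P N) (coords W) \<phi>"
  shows "locally_closed_in (zariski_topology V) {x \<in> points V. x \<in> stratum P N \<and> \<phi> x \<in> stratum Q N'}"
proof -
  obtain g h where gh: "\<And>q. q \<in> Q \<Longrightarrow> g q \<in> polynomial_functions (coords V)"
    "\<And>q x. q \<in> Q \<Longrightarrow> x \<in> points V \<inter> stratum P N \<Longrightarrow> h q x \<noteq> (0 :: complex) \<and> q (\<phi> x) = g q x / h q x"
    using coords Q(2) by (rule rational_map_fractions) blast
  have "locally_closed_in (zariski_topology V) {x \<in> points V. \<forall>q\<in>Q. g q x \<noteq> 0 \<longleftrightarrow> q \<in> N'}"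
    using Q(1) gh(1) by (rule locally_closed_sign_condition)
  moreover have "locally_closed_in (zariski_topology V) {x \<in> points V. \<forall>p\<in>P. p x \<noteq> 0 \<longleftrightarrow> p \<in> N}"
    using P by (intro locally_closed_sign_condition) auto
  ultimately have "locally_closed_in (zariski_topology V) ({x \<in> points V. \<forall>p\<in>P. p x \<noteq> 0 \<longleftrightarrow> p \<in> N}
      \<inter> {x \<in> points V. \<forall>q\<in>Q. g q x \<noteq> 0 \<longleftrightarrow> q \<in> N'})"
    by (intro locally_closed_in_Int)
  moreover have "{x \<in> points V. \<forall>p\<in>P. p x \<noteq> 0 \<longleftrightarrow> p \<in> N} \<inter> {x \<in> points V. \<forall>q\<in>Q. g q x \<noteq> 0 \<longleftrightarrow> q \<in> N'}
      = {x \<in> points V. x \<in> stratum P N \<and> \<phi> x \<in> stratum Q N'}"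
  proof (rule Set.set_eqI)
    fix x
    have "q (\<phi> x) \<noteq> 0 \<longleftrightarrow> g q x \<noteq> 0" if "q \<in> Q" "x \<in> points V \<inter> stratum P N" for q
      using gh(2)[OF that] by simp
    then show "x \<in> {x \<in> points V. \<forall>p\<in>P. p x \<noteq> 0 \<longleftrightarrow> p \<in> N} \<inter> {x \<in> points V. \<forall>q\<in>Q. g q x \<noteq> 0 \<longleftrightarrow> q \<in> N'}
      \<longleftrightarrow> x \<in> {x \<in> points V. x \<in> stratum P N \<and> \<phi> x \<in> stratum Q N'}"
      by (auto simp: stratum_def)
  qed
  ultimately show ?thesis by simp
qed

lemma piecewise_isomorphicI:
  assumes "finite I"
    and A: "\<And>i. i \<in> I \<Longrightarrow> locally_closed_in (zariski X) (A i)" "disjoint_family_on A I"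
      "(\<Union>i\<in>I. A i) = topspace (zariski X)"
    and B: "\<And>i. i \<in> I \<Longrightarrow> locally_closed_in (zariski Y) (B i)" "disjoint_family_on B I"
      "(\<Union>i\<in>I. B i) = topspace (zariski Y)"
    and iso: "\<And>i. i \<in> I \<Longrightarrow> isomorphic (subspace_of X (A i)) (subspace_of Y (B i))"
  shows "piecewise_isomorphic X Y"
proof -
  obtain h where h: "bij_betw h {1..card I} I" using ex_bij_betw_nat_finite_1[OF \<open>finite I\<close>] by blast
  have in_I: "h i \<in> I" if "i \<in> {1..card I}" for i using bij_betwE[OF h] that by blast
  have img: "h ` {1..card I} = I" using h by (rule bij_betw_imp_surj_on)
  have disj: "disjoint_family_on (\<lambda>i. D (h i)) {1..card I}" if "disjoint_family_on D I" for D :: "_ \<Rightarrow> 'z set"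
    unfolding disjoint_family_on_def
  proof (intro ballI impI)
    fix i j assume ij: "i \<in> {1..card I}" "j \<in> {1..card I}" "i \<noteq> j"
    then have "h i \<noteq> h j" using bij_betw_imp_inj_on[OF h] by (auto dest: inj_onD)
    then show "D (h i) \<inter> D (h j) = {}" using that in_I ij unfolding disjoint_family_on_def by blast
  qed
  have un: "(\<Union>i\<in>{1..card I}. D (h i)) = (\<Union>i\<in>I. D i)" for D :: "_ \<Rightarrow> 'z set"
  proof -
    have "(\<Union>i\<in>{1..card I}. D (h i)) = (\<Union>i\<in>h ` {1..card I}. D i)" by (simp only: image_image)
    then show ?thesis by (simp only: img)
  qed
  show ?thesis
    unfolding piecewise_isomorphic_def locally_closed_decomposition_def
  proof (rule exI[of _ "card I"], rule exI[of _ "\<lambda>i. A (h i)"], rule exI[of _ "\<lambda>i. B (h i)"],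
      intro conjI ballI)
    show "disjoint_family_on (\<lambda>i. A (h i)) {1..card I}" by (rule disj) (rule A)
    show "disjoint_family_on (\<lambda>i. B (h i)) {1..card I}" by (rule disj) (rule B)
    show "(\<Union>i\<in>{1..card I}. A (h i)) = topspace (zariski X)" unfolding un A(3) ..
    show "(\<Union>i\<in>{1..card I}. B (h i)) = topspace (zariski Y)" unfolding un B(3) ..
    fix i assume i: "i \<in> {1..card I}"
    show "locally_closed_in (zariski X) (A (h i))" by (rule A) (rule in_I[OF i])
    show "locally_closed_in (zariski Y) (B (h i))" by (rule B) (rule in_I[OF i])
    show "isomorphic (subspace_of X (A (h i))) (subspace_of Y (B (h i)))" by (rule iso) (rule in_I[OF i])
  qed
qed

definition piecewise_rational_map ::
    "('a \<Rightarrow> complex) set \<Rightarrow> 'a set \<Rightarrow> ('b \<Rightarrow> complex) set \<Rightarrow> ('a \<Rightarrow> 'b) \<Rightarrow> bool" where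
  "piecewise_rational_map C X D \<phi> \<longleftrightarrow>
     (\<forall>c\<in>D. \<exists>q. q \<in> piecewise_rational C \<and> (\<forall>x\<in>X. c (\<phi> x) = q x))"

lemma piecewise_rational_map_stratification:
  assumes D: "finite D" and \<phi>: "piecewise_rational_map C X D \<phi>"
  shows "\<exists>P. finite P \<and> P \<subseteq> polynomial_functions C \<and> (\<forall>N. rational_map C (X \<inter> stratum P N) D \<phi>)"
proof -
  from bchoice[OF \<phi>[unfolded piecewise_rational_map_def]]
  obtain q where q: "\<forall>c\<in>D. q c \<in> piecewise_rational C \<and> (\<forall>x\<in>X. c (\<phi> x) = q c x)" ..
  then have "q ` D \<subseteq> piecewise_rational C" by blast
  from finite_piecewise_rational_stratification[OF finite_imageI[OF D] this]
  obtain P where P: "finite P \<and> P \<subseteq> polynomial_functions C \<and>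
      (\<forall>f\<in>q ` D. \<forall>N. rational_on C (stratum P N) f)" ..
  have "rational_map C (X \<inter> stratum P N) D \<phi>" for N
    unfolding rational_map_def
  proof
    fix c assume c: "c \<in> D"
    then have "rational_on C (stratum P N) (q c)" using P by blast
    then obtain g h where gh: "g \<in> polynomial_functions C" "h \<in> polynomial_functions C"
      "\<And>x. x \<in> stratum P N \<Longrightarrow> h x \<noteq> 0" "\<And>x. x \<in> stratum P N \<Longrightarrow> q c x = g x / h x"
      by (rule rational_onE) (rule that)
    show "rational_on C (X \<inter> stratum P N) (\<lambda>x. c (\<phi> x))"
    proof (rule rational_onI[OF gh(1,2)])
      fix x assume x: "x \<in> X \<inter> stratum P N"
      show "h x \<noteq> 0" using gh(3) x by blast
      have "c (\<phi> x) = q c x" using q c x by blast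
      also have "\<dots> = g x / h x" using gh(4) x by blast
      finally show "c (\<phi> x) = g x / h x" .
    qed
  qed
  with P show ?thesis by blast
qed

text \<open>
  Stratify both sides so that \<open>\<phi>\<close> and \<open>\<psi>\<close> are given by fractions on the strata. The pieces are the
  intersections of a stratum with the preimage of a stratum of the other side; on each of them both maps
  are morphisms, inverse to each other. Finiteness of the sets of coordinates makes the number of
  strata finite.
\<close>

theorem piecewise_isomorphic_if_piecewise_rational:
  fixes V :: "'a coordinatized" and W :: "'b coordinatized"
  assumes fin: "finite (coords V)" "finite (coords W)"
    and maps: "\<And>x. x \<in> points V \<Longrightarrow> \<phi> x \<in> points W" "\<And>y. y \<in> points W \<Longrightarrow> \<psi> y \<in> points V"
    and inverse: "\<And>x. x \<in> points V \<Longrightarrow> \<psi> (\<phi> x) = x" "\<And>y. y \<in> points W \<Longrightarrow> \<phi> (\<psi> y) = y"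
    and \<phi>: "piecewise_rational_map (coords V) (points V) (coords W) \<phi>"
    and \<psi>: "piecewise_rational_map (coords W) (points W) (coords V) \<psi>"
  shows "piecewise_isomorphic (variety V) (variety W)"
proof -
  from piecewise_rational_map_stratification[OF fin(2) \<phi>]
  obtain P where "finite P \<and> P \<subseteq> polynomial_functions (coords V) \<and>
    (\<forall>N. rational_map (coords V) (points V \<inter> stratum P N) (coords W) \<phi>)" ..
  then have P: "finite P" "P \<subseteq> polynomial_functions (coords V)"
    "\<And>N. rational_map (coords V) (points V \<inter> stratum P N) (coords W) \<phi>" by simp_all
  from piecewise_rational_map_stratification[OF fin(1) \<psi>]
  obtain Q where "finite Q \<and> Q \<subseteq> polynomial_functions (coords W) \<and>
    (\<forall>N. rational_map (coords W) (points W \<inter> stratum Q N) (coords V) \<psi>)" ..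
  then have Q: "finite Q" "Q \<subseteq> polynomial_functions (coords W)"
    "\<And>N. rational_map (coords W) (points W \<inter> stratum Q N) (coords V) \<psi>" by simp_all
  define A where "A = (\<lambda>(N, N'). {x \<in> points V. x \<in> stratum P N \<and> \<phi> x \<in> stratum Q N'})"
  define B where "B = (\<lambda>(N, N'). {y \<in> points W. y \<in> stratum Q N' \<and> \<psi> y \<in> stratum P N})"
  have unique: "N = M" if "x \<in> stratum R N" "x \<in> stratum R M" "N \<subseteq> R" "M \<subseteq> R" for x R N M
    using that unfolding stratum_def by blast
  have exists: "\<exists>N\<in>Pow R. x \<in> stratum R N" for x R
    by (intro bexI[of _ "{p \<in> R. p x \<noteq> 0}"]) (auto simp: stratum_def)
  show ?thesis
  proof (rule piecewise_isomorphicI[where I = "Pow P \<times> Pow Q" and A = A and B = B])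
    show "finite (Pow P \<times> Pow Q)" using P Q by simp
    show "locally_closed_in (zariski (variety V)) (A i)" for i
      using locally_closed_piece[OF P(1,2) Q(1,2) P(3)] by (cases i) (simp add: A_def zariski_variety)
    show "locally_closed_in (zariski (variety W)) (B i)" for i
      using locally_closed_piece[OF Q(1,2) P(1,2) Q(3)] by (cases i) (simp add: B_def zariski_variety)
    show "disjoint_family_on A (Pow P \<times> Pow Q)"
      unfolding disjoint_family_on_def A_def by (auto dest: unique)
    show "disjoint_family_on B (Pow P \<times> Pow Q)"
      unfolding disjoint_family_on_def B_def by (auto dest: unique)
    show "(\<Union>i\<in>Pow P \<times> Pow Q. A i) = topspace (zariski (variety V))"
    proof -
      have "x \<in> (\<Union>i\<in>Pow P \<times> Pow Q. A i)" if "x \<in> points V" for x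
      proof -
        obtain N N' where "N \<in> Pow P" "x \<in> stratum P N" "N' \<in> Pow Q" "\<phi> x \<in> stratum Q N'"
          using exists by metis
        then show ?thesis using that by (intro UN_I[of "(N, N')"]) (auto simp: A_def)
      qed
      then show ?thesis by (auto simp: zariski_variety A_def)
    qed
    show "(\<Union>i\<in>Pow P \<times> Pow Q. B i) = topspace (zariski (variety W))"
    proof -
      have "y \<in> (\<Union>i\<in>Pow P \<times> Pow Q. B i)" if "y \<in> points W" for y
      proof -
        obtain N N' where "N \<in> Pow P" "\<psi> y \<in> stratum P N" "N' \<in> Pow Q" "y \<in> stratum Q N'"
          using exists by metis
        then show ?thesis using that by (intro UN_I[of "(N, N')"]) (auto simp: B_def)
      qed
      then show ?thesis by (auto simp: zariski_variety B_def)
    qed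
    show "isomorphic (subspace_of (variety V) (A i)) (subspace_of (variety W) (B i))" for i
    proof -
      obtain N N' where i: "i = (N, N')" by (cases i)
      have sub: "A i \<subseteq> points V" "B i \<subseteq> points W" by (auto simp: A_def B_def i)
      have "\<phi> ` A i \<subseteq> B i" using maps inverse by (auto simp: A_def B_def i)
      moreover have "\<psi> ` B i \<subseteq> A i" using maps inverse by (auto simp: A_def B_def i)
      moreover have "rational_map (coords V) (A i) (coords W) \<phi>"
        using P(3)[of N] by (rule rational_map_subset) (auto simp: A_def i)
      moreover have "rational_map (coords W) (B i) (coords V) \<psi>"
        using Q(3)[of N'] by (rule rational_map_subset) (auto simp: B_def i)
      ultimately have "morphism (subspace_of (variety V) (A i)) (subspace_of (variety W) (B i)) \<phi>"
        "morphism (subspace_of (variety W) (B i)) (subspace_of (variety V) (A i)) \<psi>"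
        using sub by (auto intro!: morphism_if_rational_coords)
      moreover have "topspace (zariski (subspace_of (variety V) (A i))) \<subseteq> points V"
        "topspace (zariski (subspace_of (variety W) (B i))) \<subseteq> points W"
        by (auto simp: subspace_of_def zariski_variety)
      ultimately show ?thesis unfolding isomorphic_def using inverse by blast
    qed
  qed
qed

section \<open>The symmetric power as a variety of orbits\<close>

text \<open>
  A space with functions matters only through its open sets and the regular functions on them;
  \<open>regular_on\<close> has no meaning on other sets.
\<close>

lemma piecewise_isomorphic_cong_left:
  assumes top: "zariski X = zariski X'"
    and reg: "\<And>U f. openin (zariski X) U \<Longrightarrow> regular_on X U f \<longleftrightarrow> regular_on X' U f"
  shows "piecewise_isomorphic X Y \<longleftrightarrow> piecewise_isomorphic X' Y"
proof -
  have "subspace_of X Z = subspace_of X' Z" for Z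
  proof -
    have "(openin (zariski X') U \<and> x \<in> U \<and> regular_on X U g \<and> R) \<longleftrightarrow>
        (openin (zariski X') U \<and> x \<in> U \<and> regular_on X' U g \<and> R)" for U x g R
      using reg[of U g] unfolding top by blast
    then show ?thesis unfolding subspace_of_def top by (simp only:)
  qed
  then show ?thesis unfolding piecewise_isomorphic_def locally_closed_decomposition_def top by simp
qed

locale point_configurations =
  fixes m n :: nat
begin

definition tuples :: "tuple set" where
  "tuples = ({..<m} \<rightarrow>\<^sub>E ({..<n} \<rightarrow>\<^sub>E UNIV))"

definition orbit_rel :: "(tuple \<times> tuple) set" where
  "orbit_rel = permutation_orbits m ({..<n} \<rightarrow>\<^sub>E UNIV)"

definition orbit :: "tuple \<Rightarrow> tuple set" where
  "orbit x = orbit_rel `` {x}"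

text \<open>
  A symmetric function descends to orbits by evaluation at a representative.
\<close>

definition representative :: "tuple set \<Rightarrow> tuple" where
  "representative O' = (SOME x. x \<in> O')"

abbreviation power_variety :: "tuple coordinatized" where
  "power_variety \<equiv> cartesian_power m (affine_space n)"

lemma points_power_variety: "points power_variety = tuples"
  by (simp add: cartesian_power_def affine_space_def tuples_def)

lemma coords_power_variety: "coords power_variety = prefix_coords m n"
proof
  show "coords power_variety \<subseteq> prefix_coords m n"
    by (auto simp: cartesian_power_def affine_space_def prefix_coords_def)
  show "prefix_coords m n \<subseteq> coords power_variety"
  proof
    fix c assume "c \<in> prefix_coords m n"
    then obtain i j where "i < m" "j < n" "c = (\<lambda>x. x i j)" unfolding prefix_coords_def by blast
    then show "c \<in> coords power_variety"
      unfolding cartesian_power_def affine_space_def coordinatized.simps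
      by (intro CollectI exI[of _ i] exI[of _ "\<lambda>p. p j"]) auto
  qed
qed

lemma equiv_orbit_rel: "equiv tuples orbit_rel"
  unfolding tuples_def orbit_rel_def by (rule equiv_permutation_orbits)

lemma tuples_permute: "x \<in> tuples \<Longrightarrow> \<sigma> permutes {..<m} \<Longrightarrow> x \<circ> \<sigma> \<in> tuples"
  using permutes_in_image[of \<sigma> "{..<m}"]
  by (auto simp: tuples_def PiE_iff extensional_def permutes_def)

lemma orbit_rel_iff:
  "(x, y) \<in> orbit_rel \<longleftrightarrow> x \<in> tuples \<and> (\<exists>\<sigma>. \<sigma> permutes {..<m} \<and> y = x \<circ> \<sigma>)"
  using tuples_permute unfolding orbit_rel_def permutation_orbits_def tuples_def by auto

lemma orbit_eq: "x \<in> tuples \<Longrightarrow> orbit x = {x \<circ> \<sigma> | \<sigma>. \<sigma> permutes {..<m}}"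
  by (auto simp: orbit_def orbit_rel_iff)

lemma orbit_eq_iff: "x \<in> tuples \<Longrightarrow> y \<in> tuples \<Longrightarrow> orbit x = orbit y \<longleftrightarrow> (x, y) \<in> orbit_rel"
  unfolding orbit_def by (rule eq_equiv_class_iff[OF equiv_orbit_rel])

lemma orbit_permute:
  assumes "x \<in> tuples" "\<sigma> permutes {..<m}" shows "orbit (x \<circ> \<sigma>) = orbit x"
proof -
  have "(x, x \<circ> \<sigma>) \<in> orbit_rel" using assms by (auto simp: orbit_rel_iff)
  then show ?thesis using orbit_eq_iff[OF assms(1) tuples_permute[OF assms]] by simp
qed

definition orbits :: "tuple set set" where
  "orbits = tuples // orbit_rel"

lemma orbit_in_orbits: "x \<in> tuples \<Longrightarrow> orbit x \<in> orbits"
  unfolding orbits_def orbit_def by (rule quotientI)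

lemma representative:
  assumes "O' \<in> orbits"
  shows "representative O' \<in> tuples" "orbit (representative O') = O'" "representative O' \<in> O'"
proof -
  from assms obtain x where x: "x \<in> tuples" "O' = orbit x"
    unfolding orbits_def orbit_def by (rule quotientE)
  have "x \<in> O'" using x permutes_id[of "{..<m}"] by (auto simp: orbit_eq intro!: exI[of _ id])
  then show rep: "representative O' \<in> O'" unfolding representative_def some_in_eq by blast
  with x obtain \<sigma> where \<sigma>: "\<sigma> permutes {..<m}" "representative O' = x \<circ> \<sigma>" by (auto simp: orbit_eq)
  then show "representative O' \<in> tuples" "orbit (representative O') = O'"
    using x tuples_permute orbit_permute by auto
qed

lemma mem_orbit:
  assumes "O' \<in> orbits" "x \<in> O'" shows "x \<in> tuples" "orbit x = O'"
proof -
  have O': "O' = orbit (representative O')" using representative(2)[OF assms(1)] by simp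
  with assms(2) obtain \<sigma> where "\<sigma> permutes {..<m}" "x = representative O' \<circ> \<sigma>"
    using orbit_eq[OF representative(1)[OF assms(1)]] by auto
  then show "x \<in> tuples" "orbit x = O'"
    using representative[OF assms(1)] tuples_permute orbit_permute by auto
qed

lemma mem_Union_orbits:
  assumes "U \<subseteq> orbits" shows "x \<in> \<Union>U \<longleftrightarrow> x \<in> tuples \<and> orbit x \<in> U"
proof
  assume "x \<in> \<Union>U"
  then show "x \<in> tuples \<and> orbit x \<in> U" using mem_orbit assms by blast
next
  assume "x \<in> tuples \<and> orbit x \<in> U"
  moreover have "x \<in> orbit x" if "x \<in> tuples"
    using that permutes_id[of "{..<m}"] by (auto simp: orbit_eq intro!: exI[of _ id])
  ultimately show "x \<in> \<Union>U" by blast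
qed

lemma symmetric_at_representative:
  assumes "relabelling.invariant m q" "x \<in> tuples"
  shows "q (representative (orbit x)) = q x"
proof -
  have "representative (orbit x) \<in> orbit x" by (rule representative(3)[OF orbit_in_orbits[OF assms(2)]])
  then obtain \<sigma> where "\<sigma> permutes {..<m}" "representative (orbit x) = x \<circ> \<sigma>"
    using orbit_eq[OF assms(2)] by auto
  then show ?thesis using assms(1) by (simp add: relabelling_invariant_iff)
qed

text \<open>
  A finite set of generators is needed, rather than all symmetric polynomials, because the
  coordinates of a variety must be finite in number for a finite stratification.
\<close>

definition generators :: "(tuple \<Rightarrow> complex) set" where
  "generators = (SOME F. finite F \<and> F \<subseteq> symmetric_polynomials m n \<and>
     symmetric_polynomials m n \<subseteq> polynomial_functions F)"

lemma generators:
  "finite generators" "generators \<subseteq> symmetric_polynomials m n"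
  "symmetric_polynomials m n \<subseteq> polynomial_functions generators"
proof -
  have "prefix_coords m n = (\<lambda>(i, j) x. x i j) ` ({..<m} \<times> {..<n})"
    unfolding prefix_coords_def by auto
  then have "finite (prefix_coords m n)" by simp
  have "\<exists>F. finite F \<and> F \<subseteq> symmetric_polynomials m n \<and> symmetric_polynomials m n \<subseteq> polynomial_functions F"
  proof (rule relabelling.noether_finite_generation[where C = "prefix_coords m n" and m = m])
    show "finite (prefix_coords m n)" by fact
    show "(\<lambda>x. c (g x)) \<in> prefix_coords m n" if "c \<in> prefix_coords m n" "g \<in> index_permutations m" for c g
      using that by (rule prefix_coords_stable)
    show "\<exists>F. finite F \<and> F \<subseteq> symmetric_polynomials m n \<and> symmetric_polynomials m n \<subseteq> polynomial_functions F"
      if "finite F" "F \<subseteq> symmetric_polynomials m n" "symmetric_polynomials m n \<subseteq> polynomial_functions F" for F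
      using that by blast
  qed
  then have "finite generators \<and> generators \<subseteq> symmetric_polynomials m n \<and>
     symmetric_polynomials m n \<subseteq> polynomial_functions generators"
    unfolding generators_def by (rule someI_ex)
  then show "finite generators" "generators \<subseteq> symmetric_polynomials m n"
    "symmetric_polynomials m n \<subseteq> polynomial_functions generators" by simp_all
qed

definition orbit_variety :: "tuple set coordinatized" where
  "orbit_variety = \<lparr> points = orbits, coords = (\<lambda>q O'. q (representative O')) ` generators \<rparr>"

lemma orbit_variety_simps [simp]:
  "points orbit_variety = orbits"
  "coords orbit_variety = (\<lambda>q O'. q (representative O')) ` generators"
  by (simp_all add: orbit_variety_def)

lemma pull_back_polynomial:
  assumes "f \<in> polynomial_functions (coords orbit_variety)"
  obtains p where "p \<in> symmetric_polynomials m n" "\<And>x. x \<in> tuples \<Longrightarrow> f (orbit x) = p x"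
proof -
  have "\<exists>p. p \<in> symmetric_polynomials m n \<and> (\<forall>x\<in>tuples. f (orbit x) = p x)"
    using assms
  proof induction
    case (const a)
    show ?case
      by (intro exI[of _ "\<lambda>_. a"])
        (auto simp: relabelling.invariant_polynomials_def relabelling.invariant_def intro: polynomial_functions.const)
  next
    case (coord c)
    then obtain q where q: "q \<in> generators" "c = (\<lambda>O'. q (representative O'))" by auto
    then have "q \<in> symmetric_polynomials m n" using generators(2) by blast
    moreover from this have "relabelling.invariant m q" by (simp add: relabelling.invariant_polynomials_def)
    ultimately show ?case using q(2) symmetric_at_representative by (intro exI[of _ q]) auto
  next
    case (add f g)
    then obtain p q where "p \<in> symmetric_polynomials m n \<and> (\<forall>x\<in>tuples. f (orbit x) = p x)"
      "q \<in> symmetric_polynomials m n \<and> (\<forall>x\<in>tuples. g (orbit x) = q x)" by (elim exE) (rule that)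
    then show ?case
      by (intro exI[of _ "\<lambda>x. p x + q x"])
        (auto simp: relabelling.invariant_polynomials_def relabelling.invariant_def intro: polynomial_functions.add)
  next
    case (mult f g)
    then obtain p q where "p \<in> symmetric_polynomials m n \<and> (\<forall>x\<in>tuples. f (orbit x) = p x)"
      "q \<in> symmetric_polynomials m n \<and> (\<forall>x\<in>tuples. g (orbit x) = q x)" by (elim exE) (rule that)
    then show ?case
      by (intro exI[of _ "\<lambda>x. p x * q x"])
        (auto simp: relabelling.invariant_polynomials_def relabelling.invariant_def intro: polynomial_functions.mult)
  qed
  then show ?thesis using that by blast
qed

lemma push_forward_polynomial:
  assumes "p \<in> symmetric_polynomials m n"
  shows "(\<lambda>O'. p (representative O')) \<in> polynomial_functions (coords orbit_variety)"
proof (rule polynomial_functions_subst[where f = p and C = generators])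
  show "p \<in> polynomial_functions generators" using assms generators(3) by blast
  show "(\<lambda>O'. c (representative O')) \<in> polynomial_functions (coords orbit_variety)" if "c \<in> generators" for c
    using that by (intro polynomial_functions.coord) simp
qed

text \<open>
  A polynomial that defines \<open>W\<close> near \<open>x\<close>, multiplied by linear factors that vanish at the other points
  of the orbit of \<open>x\<close>. The purpose of these factors is that averaging does not cancel the value at \<open>x\<close>:
  only the stabiliser of \<open>x\<close> contributes to it.
\<close>

lemma bump_polynomial:
  assumes W: "openin (zariski_topology power_variety) W" and x: "x \<in> W"
  obtains r where "r \<in> tuple_polynomials m n" "r x \<noteq> 0"
    "\<And>z. z \<in> tuples \<Longrightarrow> z \<notin> W \<Longrightarrow> r z = 0"
    "\<And>\<sigma>. \<sigma> permutes {..<m} \<Longrightarrow> x \<circ> \<sigma> \<noteq> x \<Longrightarrow> r (x \<circ> \<sigma>) = 0"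
proof -
  obtain F where F: "F \<subseteq> polynomial_functions (coords power_variety)"
    "W = {x \<in> points power_variety. \<exists>f\<in>F. f x \<noteq> 0}"
    using W by (rule openin_zariskiE)
  then obtain f where f: "f \<in> F" "f x \<noteq> 0" using x by blast
  have xt: "x \<in> tuples" using x F(2) by (simp add: points_power_variety)
  let ?S = "{\<sigma>. \<sigma> permutes {..<m} \<and> x \<circ> \<sigma> \<noteq> x}"
  \<comment> \<open>a coordinate in which \<open>x\<close> and its relabelling by \<open>\<sigma>\<close> differ\<close>
  let ?moved = "\<lambda>\<sigma> ij. fst ij < m \<and> snd ij < n \<and> x (fst ij) (snd ij) \<noteq> x (\<sigma> (fst ij)) (snd ij)"
  have "\<forall>\<sigma>\<in>?S. \<exists>ij. ?moved \<sigma> ij"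
  proof (rule ballI, rule ccontr)
    fix \<sigma> assume \<sigma>: "\<sigma> \<in> ?S"
    assume none: "\<not> (\<exists>ij. ?moved \<sigma> ij)"
    have eq: "x i j = (x \<circ> \<sigma>) i j" if "i < m" "j < n" for i j
    proof (rule ccontr)
      assume "x i j \<noteq> (x \<circ> \<sigma>) i j"
      with that have "?moved \<sigma> (i, j)" by simp
      then have "\<exists>ij. ?moved \<sigma> ij" by (rule exI)
      with none show False ..
    qed
    have "x \<circ> \<sigma> \<in> tuples" using \<sigma> xt tuples_permute by blast
    have "x i = (x \<circ> \<sigma>) i" for i
    proof (cases "i < m")
      case True
      have "x i \<in> {..<n} \<rightarrow>\<^sub>E UNIV" "(x \<circ> \<sigma>) i \<in> {..<n} \<rightarrow>\<^sub>E UNIV"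
        using PiE_mem[of x "{..<m}" "\<lambda>_. {..<n} \<rightarrow>\<^sub>E UNIV" i] PiE_mem[of "x \<circ> \<sigma>" "{..<m}" "\<lambda>_. {..<n} \<rightarrow>\<^sub>E UNIV" i]
          xt \<open>x \<circ> \<sigma> \<in> tuples\<close> True unfolding tuples_def by blast+
      then show ?thesis by (rule PiE_ext) (use eq[OF True] in simp)
    next
      case False
      then show ?thesis using xt \<open>x \<circ> \<sigma> \<in> tuples\<close> unfolding tuples_def
        by (metis PiE_arb lessThan_iff)
    qed
    then show False using \<sigma> by auto
  qed
  from bchoice[OF this] obtain IJ where "\<forall>\<sigma>\<in>?S. ?moved \<sigma> (IJ \<sigma>)" ..
  then have IJ: "?moved \<sigma> (IJ \<sigma>)" if "\<sigma> \<in> ?S" for \<sigma>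
    using that by (rule bspec)
  have fin: "finite ?S" using finite_permutations[of "{..<m}"] by simp
  define r where "r z = f z * (\<Prod>\<sigma>\<in>?S. z (fst (IJ \<sigma>)) (snd (IJ \<sigma>)) + - x (\<sigma> (fst (IJ \<sigma>))) (snd (IJ \<sigma>)))" for z
  show ?thesis
  proof (rule that)
    show "r \<in> tuple_polynomials m n"
      unfolding r_def[abs_def]
    proof (intro polynomial_functions.mult polynomial_functions_prod)
      show "f \<in> tuple_polynomials m n" using F(1) f(1) by (auto simp: coords_power_variety)
      show "(\<lambda>z. z (fst (IJ \<sigma>)) (snd (IJ \<sigma>)) + - x (\<sigma> (fst (IJ \<sigma>))) (snd (IJ \<sigma>)))
          \<in> tuple_polynomials m n" if "\<sigma> \<in> ?S" for \<sigma>
        using IJ[OF that]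
        by (intro polynomial_functions.add polynomial_functions.const polynomial_functions.coord prefix_coordsI) simp_all
    qed
    show "r x \<noteq> 0" unfolding r_def using f(2) fin IJ by simp
    show "r z = 0" if "z \<in> tuples" "z \<notin> W" for z
      using that F(2) f(1) unfolding r_def by (auto simp: points_power_variety)
    show "r (x \<circ> \<sigma>) = 0" if "\<sigma> permutes {..<m}" "x \<circ> \<sigma> \<noteq> x" for \<sigma>
      unfolding r_def using fin that by (auto intro!: prod_zero bexI[of _ \<sigma>])
  qed
qed

lemma reynolds_bump_nonzero:
  fixes x :: tuple
  assumes bump: "\<And>\<sigma>. \<sigma> permutes {..<m} \<Longrightarrow> x \<circ> \<sigma> \<noteq> x \<Longrightarrow> r (x \<circ> \<sigma>) = 0"
    and nz: "r x \<noteq> 0" "h x \<noteq> 0"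
  shows "relabelling.reynolds m (\<lambda>z. r z * h z) x \<noteq> 0"
proof -
  let ?S = "{\<sigma>. \<sigma> permutes {..<m}}"
  have fin: "finite ?S" by (simp add: finite_permutations)
  have "relabelling.reynolds m (\<lambda>z. r z * h z) x = (\<Sum>\<sigma>\<in>?S. if x \<circ> \<sigma> = x then r x * h x else 0)"
    unfolding relabelling_reynolds by (intro sum.cong) (auto simp: bump)
  also have "\<dots> = of_nat (card {\<sigma> \<in> ?S. x \<circ> \<sigma> = x}) * (r x * h x)"
    by (subst sum.inter_filter[OF fin, symmetric]) simp
  finally have *: "relabelling.reynolds m (\<lambda>z. r z * h z) x
      = of_nat (card {\<sigma> \<in> ?S. x \<circ> \<sigma> = x}) * (r x * h x)" .
  have "id \<in> {\<sigma> \<in> ?S. x \<circ> \<sigma> = x}" by (simp add: permutes_id)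
  moreover have fin_stab: "finite {\<sigma> \<in> ?S. x \<circ> \<sigma> = x}" using fin by simp
  ultimately have "card {\<sigma> \<in> ?S. x \<circ> \<sigma> = x} \<noteq> 0" unfolding card_0_eq[OF fin_stab] by blast
  then show ?thesis unfolding * using nz by simp
qed

lemma zariski_symmetric_power:
  "zariski (symmetric_power m (affine_space n)) = quotient_topology (zariski_topology power_variety) orbit_rel"
  by (simp add: symmetric_power_def quotient_space_def zariski_variety orbit_rel_def affine_space_def)

lemma openin_symmetric_power:
  "openin (zariski (symmetric_power m (affine_space n))) U \<longleftrightarrow>
     U \<subseteq> orbits \<and> openin (zariski_topology power_variety) (\<Union>U)"
  unfolding zariski_symmetric_power orbits_def
  using openin_quotient_topology[of "zariski_topology power_variety" orbit_rel] equiv_orbit_rel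
  by (simp add: points_power_variety)

text \<open>
  If the union of \<open>U\<close> is open, averages of bump polynomials are symmetric polynomials that vanish
  outside this union, and every orbit in \<open>U\<close> is avoided by the zero set of one of them.
\<close>

lemma openin_orbit_variety:
  "openin (zariski_topology orbit_variety) U \<longleftrightarrow>
     U \<subseteq> orbits \<and> openin (zariski_topology power_variety) (\<Union>U)"
proof
  assume "openin (zariski_topology orbit_variety) U"
  then obtain F where F: "F \<subseteq> polynomial_functions (coords orbit_variety)"
    "U = {O' \<in> points orbit_variety. \<exists>f\<in>F. f O' \<noteq> 0}"
    by (rule openin_zariskiE)
  have "\<forall>f\<in>F. \<exists>p. p \<in> symmetric_polynomials m n \<and> (\<forall>x\<in>tuples. f (orbit x) = p x)"
  proof
    fix f assume "f \<in> F"
    then have "f \<in> polynomial_functions (coords orbit_variety)" using F(1) by blast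
    then show "\<exists>p. p \<in> symmetric_polynomials m n \<and> (\<forall>x\<in>tuples. f (orbit x) = p x)"
      by (rule pull_back_polynomial) blast
  qed
  from bchoice[OF this] obtain p where
    p: "\<forall>f\<in>F. p f \<in> symmetric_polynomials m n \<and> (\<forall>x\<in>tuples. f (orbit x) = p f x)" ..
  have sub: "U \<subseteq> orbits" unfolding F(2) by auto
  have "\<Union>U = {x \<in> points power_variety. \<exists>f\<in>p ` F. f x \<noteq> 0}"
  proof (rule Set.set_eqI)
    fix x
    have "x \<in> \<Union>U \<longleftrightarrow> x \<in> tuples \<and> orbit x \<in> U" by (rule mem_Union_orbits[OF sub])
    also have "\<dots> \<longleftrightarrow> x \<in> tuples \<and> (\<exists>f\<in>F. f (orbit x) \<noteq> 0)"
      unfolding F(2) using orbit_in_orbits by auto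
    also have "\<dots> \<longleftrightarrow> x \<in> tuples \<and> (\<exists>f\<in>F. p f x \<noteq> 0)"
      using p by auto
    finally show "x \<in> \<Union>U \<longleftrightarrow> x \<in> {x \<in> points power_variety. \<exists>f\<in>p ` F. f x \<noteq> 0}"
      by (simp add: points_power_variety)
  qed
  moreover have "p ` F \<subseteq> polynomial_functions (coords power_variety)"
    using p unfolding coords_power_variety by (auto simp: relabelling.invariant_polynomials_def)
  ultimately show "U \<subseteq> orbits \<and> openin (zariski_topology power_variety) (\<Union>U)"
    using openin_nonvanishing[of "p ` F" power_variety] sub by simp
next
  assume U: "U \<subseteq> orbits \<and> openin (zariski_topology power_variety) (\<Union>U)"
  let ?F = "{f \<in> polynomial_functions (coords orbit_variety). \<forall>O'\<in>orbits - U. f O' = 0}"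
  have "\<exists>f\<in>?F. f O' \<noteq> 0" if O': "O' \<in> U" for O'
  proof -
    define x where "x = representative O'"
    have "O' \<in> orbits" using U O' by blast
    then have x: "x \<in> tuples" "orbit x = O'" "x \<in> \<Union>U"
      using representative[of O'] O' unfolding x_def by auto
    obtain r where r: "r \<in> tuple_polynomials m n" "r x \<noteq> 0"
      "\<And>z. z \<in> tuples \<Longrightarrow> z \<notin> \<Union>U \<Longrightarrow> r z = 0"
      "\<And>\<sigma>. \<sigma> permutes {..<m} \<Longrightarrow> x \<circ> \<sigma> \<noteq> x \<Longrightarrow> r (x \<circ> \<sigma>) = 0"
      using conjunct2[OF U] x(3) by (rule bump_polynomial) (rule that)
    define R where "R = relabelling.reynolds m r"
    have R: "R \<in> symmetric_polynomials m n" unfolding R_def by (rule symmetric_polynomial_reynolds[OF r(1)])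
    have "R x \<noteq> 0"
      using reynolds_bump_nonzero[of x r "\<lambda>_. 1", OF r(4) r(2)] by (simp add: R_def)
    then have "R (representative O') \<noteq> 0" by (simp add: x_def)
    moreover have "R (representative O'') = 0" if "O'' \<in> orbits - U" for O''
    proof -
      let ?z = "representative O''"
      have z: "?z \<in> tuples" "orbit ?z = O''" using that representative[of O''] by auto
      have "r (?z \<circ> \<sigma>) = 0" if "\<sigma> permutes {..<m}" for \<sigma>
      proof (rule r(3))
        show "?z \<circ> \<sigma> \<in> tuples" by (rule tuples_permute[OF z(1) that])
        show "?z \<circ> \<sigma> \<notin> \<Union>U"
          using mem_Union_orbits[of U "?z \<circ> \<sigma>"] U orbit_permute[OF z(1) that] z(2) \<open>O'' \<in> orbits - U\<close> by auto
      qed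
      then show ?thesis unfolding R_def relabelling_reynolds by (intro sum.neutral) auto
    qed
    ultimately show ?thesis
      using push_forward_polynomial[OF R] by (intro bexI[of _ "\<lambda>O'. R (representative O')"]) auto
  qed
  then have "U = {O' \<in> points orbit_variety. \<exists>f\<in>?F. f O' \<noteq> 0}" using U by auto
  then show "openin (zariski_topology orbit_variety) U"
    using openin_nonvanishing[of ?F orbit_variety] by auto
qed

lemma regular_on_symmetric_power:
  "regular_on (symmetric_power m (affine_space n)) U f \<longleftrightarrow>
     regular_on (variety power_variety) (\<Union>U) (\<lambda>x. f (orbit x))"
  by (simp add: symmetric_power_def quotient_space_def orbit_def orbit_rel_def affine_space_def)

text \<open>
  Suppose \<open>f = g / h\<close> near a point \<open>x\<close> of an orbit. With a bump polynomial \<open>r\<close> supported in this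
  neighbourhood, \<open>r h f = r g\<close> holds everywhere. Averaging over the permutations, under which \<open>f\<close> is
  invariant, gives \<open>H f = G\<close> with symmetric polynomials \<open>G\<close> and \<open>H\<close>, where \<open>H x \<noteq> 0\<close>.
\<close>

lemma regular_on_orbit_variety:
  assumes U: "openin (zariski_topology orbit_variety) U"
  shows "regular_on (variety power_variety) (\<Union>U) (\<lambda>x. f (orbit x)) \<longleftrightarrow> regular_on (variety orbit_variety) U f"
proof
  have sub: "U \<subseteq> orbits" and open_U: "openin (zariski_topology power_variety) (\<Union>U)"
    using U unfolding openin_orbit_variety by auto
  assume reg: "regular_on (variety power_variety) (\<Union>U) (\<lambda>x. f (orbit x))"
  show "regular_on (variety orbit_variety) U f"
    unfolding regular_on_variety
  proof
    fix O' assume O': "O' \<in> U"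
    define x where "x = representative O'"
    have "O' \<in> orbits" using sub O' by blast
    then have x: "x \<in> tuples" "orbit x = O'" "x \<in> \<Union>U"
      using representative[of O'] O' unfolding x_def by auto
    obtain W g h where W: "openin (zariski_topology power_variety) W" "x \<in> W" "W \<subseteq> \<Union>U"
      and gh: "g \<in> polynomial_functions (coords power_variety)" "h \<in> polynomial_functions (coords power_variety)"
        "\<And>y. y \<in> W \<Longrightarrow> h y \<noteq> 0 \<and> f (orbit y) = g y / h y"
      using reg x(3) by (rule regular_on_varietyE) (rule that)
    obtain r where r: "r \<in> tuple_polynomials m n" "r x \<noteq> 0"
      "\<And>z. z \<in> tuples \<Longrightarrow> z \<notin> W \<Longrightarrow> r z = 0"
      "\<And>\<sigma>. \<sigma> permutes {..<m} \<Longrightarrow> x \<circ> \<sigma> \<noteq> x \<Longrightarrow> r (x \<circ> \<sigma>) = 0"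
      using W(1,2) by (rule bump_polynomial) (rule that)
    define G where "G = relabelling.reynolds m (\<lambda>z. r z * g z)"
    define H where "H = relabelling.reynolds m (\<lambda>z. r z * h z)"
    have G: "G \<in> symmetric_polynomials m n" and H: "H \<in> symmetric_polynomials m n"
      unfolding G_def H_def using gh(1,2) r(1) unfolding coords_power_variety
      by (auto intro!: symmetric_polynomial_reynolds polynomial_functions.mult)
    have "H x \<noteq> 0"
      unfolding H_def by (rule reynolds_bump_nonzero[of x r h, OF r(4) r(2)]) (use gh(3)[OF W(2)] in auto)
    have HG: "H z * f (orbit z) = G z" if z: "z \<in> tuples" for z
    proof -
      have "r (z \<circ> \<sigma>) * h (z \<circ> \<sigma>) * f (orbit z) = r (z \<circ> \<sigma>) * g (z \<circ> \<sigma>)" if \<sigma>: "\<sigma> permutes {..<m}" for \<sigma>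
      proof (cases "z \<circ> \<sigma> \<in> W")
        case True
        from gh(3)[OF this] show ?thesis unfolding orbit_permute[OF z \<sigma>] by simp
      next
        case False
        then show ?thesis using r(3)[OF tuples_permute[OF z \<sigma>]] by simp
      qed
      then show ?thesis unfolding H_def G_def relabelling_reynolds sum_distrib_right by (intro sum.cong) auto
    qed
    let ?W = "U \<inter> {O' \<in> points orbit_variety. H (representative O') \<noteq> 0}"
    have "openin (zariski_topology orbit_variety) ?W"
      using U openin_nonvanishing1[OF push_forward_polynomial[OF H]] by (rule openin_Int)
    moreover have "O' \<in> ?W" using O' \<open>O' \<in> orbits\<close> \<open>H x \<noteq> 0\<close> by (simp add: x_def)
    moreover have "?W \<subseteq> U" by blast
    moreover have "\<exists>g\<in>polynomial_functions (coords orbit_variety). \<exists>h\<in>polynomial_functions (coords orbit_variety).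
        \<forall>P\<in>?W. h P \<noteq> 0 \<and> f P = g P / h P"
    proof (rule bexI[OF _ push_forward_polynomial[OF G]], rule bexI[OF _ push_forward_polynomial[OF H]], rule ballI)
      fix P assume "P \<in> ?W"
      then have P: "P \<in> orbits" "H (representative P) \<noteq> 0" by auto
      then have "H (representative P) * f P = G (representative P)"
        using HG[OF representative(1)[OF P(1)]] representative(2)[OF P(1)] by simp
      then show "H (representative P) \<noteq> 0 \<and> f P = G (representative P) / H (representative P)"
        using P(2) by (simp add: eq_divide_eq mult.commute)
    qed
    ultimately show "\<exists>W. openin (zariski_topology orbit_variety) W \<and> O' \<in> W \<and> W \<subseteq> U \<and>
        (\<exists>g\<in>polynomial_functions (coords orbit_variety). \<exists>h\<in>polynomial_functions (coords orbit_variety).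
          \<forall>y\<in>W. h y \<noteq> 0 \<and> f y = g y / h y)"
      by (intro exI[of _ ?W] conjI)
  qed
next
  have sub: "U \<subseteq> orbits" using U unfolding openin_orbit_variety by auto
  assume reg: "regular_on (variety orbit_variety) U f"
  show "regular_on (variety power_variety) (\<Union>U) (\<lambda>x. f (orbit x))"
    unfolding regular_on_variety
  proof
    fix x assume "x \<in> \<Union>U"
    then have x: "x \<in> tuples" "orbit x \<in> U" using mem_Union_orbits[OF sub] by auto
    obtain W g h where W: "openin (zariski_topology orbit_variety) W" "orbit x \<in> W" "W \<subseteq> U"
      and gh: "g \<in> polynomial_functions (coords orbit_variety)" "h \<in> polynomial_functions (coords orbit_variety)"
        "\<And>y. y \<in> W \<Longrightarrow> h y \<noteq> 0 \<and> f y = g y / h y"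
      using reg x(2) by (rule regular_on_varietyE) (rule that)
    obtain g' where g': "g' \<in> symmetric_polynomials m n" "\<And>x. x \<in> tuples \<Longrightarrow> g (orbit x) = g' x"
      using gh(1) by (rule pull_back_polynomial) (rule that)
    obtain h' where h': "h' \<in> symmetric_polynomials m n" "\<And>x. x \<in> tuples \<Longrightarrow> h (orbit x) = h' x"
      using gh(2) by (rule pull_back_polynomial) (rule that)
    have polys: "g' \<in> polynomial_functions (coords power_variety)" "h' \<in> polynomial_functions (coords power_variety)"
      using g'(1) h'(1) by (simp_all add: coords_power_variety relabelling.invariant_polynomials_def)
    have subW: "W \<subseteq> orbits" and "openin (zariski_topology power_variety) (\<Union>W)"
      using W(1) unfolding openin_orbit_variety by auto
    moreover have "x \<in> \<Union>W" using mem_Union_orbits[OF subW] x W(2) by simp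
    moreover have "\<Union>W \<subseteq> \<Union>U" using W(3) by blast
    moreover have "h' y \<noteq> 0 \<and> f (orbit y) = g' y / h' y" if "y \<in> \<Union>W" for y
      using mem_Union_orbits[OF subW, of y] that gh(3)[of "orbit y"] g'(2)[of y] h'(2)[of y] by auto
    ultimately show "\<exists>W. openin (zariski_topology power_variety) W \<and> x \<in> W \<and> W \<subseteq> \<Union>U \<and>
        (\<exists>g\<in>polynomial_functions (coords power_variety). \<exists>h\<in>polynomial_functions (coords power_variety).
          \<forall>y\<in>W. h y \<noteq> 0 \<and> f (orbit y) = g y / h y)"
      using polys by (intro exI[of _ "\<Union>W"] conjI bexI[of _ g'] bexI[of _ h']) auto
  qed
qed

theorem piecewise_isomorphic_orbit_variety:
  "piecewise_isomorphic (symmetric_power m (affine_space n)) Y \<longleftrightarrow>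
     piecewise_isomorphic (variety orbit_variety) Y"
proof (rule piecewise_isomorphic_cong_left)
  show "zariski (symmetric_power m (affine_space n)) = zariski (variety orbit_variety)"
    unfolding topology_eq zariski_variety openin_symmetric_power openin_orbit_variety by simp
  show "regular_on (symmetric_power m (affine_space n)) U f \<longleftrightarrow> regular_on (variety orbit_variety) U f"
    if "openin (zariski (symmetric_power m (affine_space n))) U" for U f
    using that regular_on_orbit_variety[of U f]
    unfolding openin_symmetric_power openin_orbit_variety regular_on_symmetric_power by simp
qed

section \<open>The piecewise isomorphism\<close>

definition coordinate_map :: "tuple set \<Rightarrow> nat \<Rightarrow> complex" where
  "coordinate_map O' = restrict (\<lambda>k. coordinate m k (representative O')) {..<m * n}"

definition configuration :: "(nat \<Rightarrow> complex) \<Rightarrow> tuple" where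
  "configuration c = (SOME x. \<forall>k<m * n. coordinate m k x = c k)"

text \<open>
  Points of the Cartesian power are extensional functions, while the configurations above are
  arbitrary outside the relevant indices.
\<close>

definition truncate :: "tuple \<Rightarrow> tuple" where
  "truncate x = restrict (\<lambda>i. restrict (x i) {..<n}) {..<m}"

lemma coordinate_configuration: "k < m * n \<Longrightarrow> coordinate m k (configuration c) = c k"
  using someI_ex[OF coordinates_surjective[of m n c]] unfolding configuration_def by blast

lemma truncate_in_tuples: "truncate x \<in> tuples"
  by (auto simp: truncate_def tuples_def)

lemma truncate_cong:
  assumes "f \<in> piecewise_rational (prefix_coords m n)" shows "f (truncate x) = f x"
  by (rule piecewise_rational_cong[OF assms]) (auto simp: prefix_coords_def truncate_def)

lemma truncate_tuple: "x \<in> tuples \<Longrightarrow> truncate x = x"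
  by (auto simp: truncate_def tuples_def fun_eq_iff PiE_iff extensional_def)

lemma coordinate_at_orbit:
  assumes "x \<in> tuples" shows "coordinate m k (representative (orbit x)) = coordinate m k x"
  by (rule symmetric_at_representative[OF coordinate_invariant assms])

lemma coordinate_map_configuration:
  assumes "c \<in> {..<m * n} \<rightarrow>\<^sub>E UNIV"
  shows "coordinate_map (orbit (truncate (configuration c))) = c"
proof
  fix k show "coordinate_map (orbit (truncate (configuration c))) k = c k"
  proof (cases "k < m * n")
    case True
    let ?x = "configuration c"
    have "coordinate_map (orbit (truncate ?x)) k = coordinate m k (representative (orbit (truncate ?x)))"
      using True by (simp add: coordinate_map_def)
    also have "\<dots> = coordinate m k (truncate ?x)" by (rule coordinate_at_orbit[OF truncate_in_tuples])
    also have "\<dots> = coordinate m k ?x" by (rule truncate_cong[OF piecewise_rational_coordinate[OF True]])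
    also have "\<dots> = c k" by (rule coordinate_configuration[OF True])
    finally show ?thesis .
  next
    case False
    then show ?thesis using PiE_arb[OF assms, of k] by (simp add: coordinate_map_def)
  qed
qed

lemma configuration_coordinate_map:
  assumes "O' \<in> orbits"
  shows "orbit (truncate (configuration (coordinate_map O'))) = O'"
proof -
  let ?x = "representative O'" and ?y = "configuration (coordinate_map O')"
  have same: "coordinate m k ?x = coordinate m k ?y" if "k < m * n" for k
    using that by (simp add: coordinate_configuration coordinate_map_def)
  obtain \<sigma> where \<sigma>: "\<sigma> permutes {..<m}" "\<And>i j. i < m \<Longrightarrow> j < n \<Longrightarrow> ?y i j = ?x (\<sigma> i) j"
    by (rule coordinates_injective[of m n ?x ?y]) (rule same, assumption, rule that)
  have x: "?x \<in> tuples" by (rule representative(1)[OF assms])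
  have "truncate ?y = truncate (?x \<circ> \<sigma>)"
    by (auto simp: truncate_def fun_eq_iff restrict_def \<sigma>(2))
  also have "\<dots> = ?x \<circ> \<sigma>" by (rule truncate_tuple[OF tuples_permute[OF x \<sigma>(1)]])
  finally show ?thesis using orbit_permute[OF x \<sigma>(1)] representative(2)[OF assms] by simp
qed

text \<open>
  The two maps are given by \<open>coordinate\<close> and by a choice of a configuration with given coordinates.
  The first is piecewise rational in symmetric polynomials by descent; the second is so because symmetric
  polynomials of a configuration are piecewise rational in its coordinates, whatever the choice.
\<close>

theorem piecewise_isomorphic_affine_space:
  "piecewise_isomorphic (variety orbit_variety) (variety (affine_space (m * n)))"
proof (rule piecewise_isomorphic_if_piecewise_rational[where \<phi> = coordinate_map
      and \<psi> = "\<lambda>c. orbit (truncate (configuration c))"])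
  let ?A = "affine_space (m * n)"
  have A: "points ?A = {..<m * n} \<rightarrow>\<^sub>E UNIV" "coords ?A = (\<lambda>k c. c k) ` {..<m * n}"
    by (auto simp: affine_space_def)
  show "finite (coords orbit_variety)" using generators(1) by simp
  show "finite (coords ?A)" by (simp add: A)
  show "coordinate_map O' \<in> points ?A" for O' by (auto simp: A coordinate_map_def)
  show "orbit (truncate (configuration c)) \<in> points orbit_variety" for c
    by (simp add: orbit_in_orbits truncate_in_tuples)
  show "orbit (truncate (configuration (coordinate_map O'))) = O'" if "O' \<in> points orbit_variety" for O'
    using that by (simp add: configuration_coordinate_map)
  show "coordinate_map (orbit (truncate (configuration c))) = c" if "c \<in> points ?A" for c
    using that coordinate_map_configuration by (simp add: A)
  show "piecewise_rational_map (coords orbit_variety) (points orbit_variety) (coords ?A) coordinate_map"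
    unfolding piecewise_rational_map_def
  proof
    fix c assume "c \<in> coords ?A"
    then obtain k where k: "k < m * n" "c = (\<lambda>c. c k)" by (auto simp: A)
    have "symmetric_polynomials m n \<subseteq> piecewise_rational generators"
      using generators(3) polynomial_imp_piecewise_rational by blast
    from piecewise_rational_trans[OF coordinate_rational_in_symmetric_polynomials[OF k(1)] this]
    have "(\<lambda>O'. coordinate m k (representative O')) \<in> piecewise_rational (coords orbit_variety)"
      by (rule piecewise_rational_subst) (auto intro: piecewise_rational.coord)
    moreover have "c (coordinate_map O') = coordinate m k (representative O')" for O'
      using k by (simp add: coordinate_map_def)
    ultimately show "\<exists>q. q \<in> piecewise_rational (coords orbit_variety) \<and>
        (\<forall>O'\<in>points orbit_variety. c (coordinate_map O') = q O')" by blast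
  qed
  show "piecewise_rational_map (coords ?A) (points ?A) (coords orbit_variety) (\<lambda>c. orbit (truncate (configuration c)))"
    unfolding piecewise_rational_map_def
  proof
    fix f assume "f \<in> coords orbit_variety"
    then obtain q where q: "q \<in> generators" "f = (\<lambda>O'. q (representative O'))" by auto
    have qs: "q \<in> symmetric_polynomials m n" using q(1) generators(2) by blast
    then have q_poly: "q \<in> piecewise_rational (prefix_coords m n)" and q_inv: "relabelling.invariant m q"
      by (simp_all add: relabelling.invariant_polynomials_def polynomial_imp_piecewise_rational)
    have "q \<in> piecewise_rational (coordinate m ` {..<m * n})"
      using invariant_in_coordinate_field[OF q_poly q_inv] unfolding coordinate_field_def .
    then have "(\<lambda>c. q (configuration c)) \<in> piecewise_rational (coords ?A)"
      by (rule piecewise_rational_subst)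
        (auto simp: A coordinate_configuration intro!: piecewise_rational.coord)
    moreover have "f (orbit (truncate (configuration c))) = q (configuration c)" for c
      using symmetric_at_representative[OF q_inv truncate_in_tuples] truncate_cong[OF q_poly] q(2) by simp
    ultimately show "\<exists>q. q \<in> piecewise_rational (coords ?A) \<and>
        (\<forall>c\<in>points ?A. f (orbit (truncate (configuration c))) = q c)" by blast
  qed
qed

end

theorem theorem1:
  fixes m n :: nat
  assumes "m \<ge> 1" and "n \<ge> 1"
  shows "piecewise_isomorphic (symmetric_power m (affine_space n)) (variety (affine_space (m * n)))"
  by (simp add: point_configurations.piecewise_isomorphic_orbit_variety
      point_configurations.piecewise_isomorphic_affine_space)

end
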